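(* \textbf{(A) Compact case.} Let $\mathcal B$ be a complex Banach space, $L$ a bounded operator on $\mathcal B$, and $(L_K)_{K\ge1}$ a sequence of bounded finite-rank operators on $\mathcal B$ with $\|L-L_K\|\le\varepsilon_K$, where $\varepsilon_K\to0$. Let $U\subset\mathbb C$ be a bounded domain with $0\notin\overline U$ whose boundary $\Gamma=\partial U$ is a piecewise $C^1$ Jordan curve. If $\Gamma\subset\rho(L)$, then there is $K_0$ such that for all $K\ge K_0$ one has $\Gamma\subset\rho(L_K)$ and: (A1) $L_K$ and $L$ have the same number of eigenvalues in $U$, counted with algebraic multiplicity, i.e. $\dim\operatorname{Ran}P_{L_K}(U)=\dim\operatorname{Ran}P_L(U)$; (A2) $\|P_{L_K}(U)-P_L(U)\|\to0$ as $K\to\infty$; (A3) the perturbation condition $\sup_{z\in\Gamma}\varepsilon_K\,\|(zI-L_K)^{-1}\|<1$, which involves only $\varepsilon_K$ and $L_K$, is satisfied. Moreover, without assuming $\Gamma\subset\rho(L)$: for any $K$ with $\Gamma\subset\rho(L_K)$ for which the perturbation condition in (A3) holds, one has $\Gamma\subset\rho(L)$ and the equality in (A1) holds for that $K$. Consequently, every isolated nonzero eigenvalue, eigenvector and Riesz projector of $L$ is approximated to arbitrary precision by $L_K$: if $\lambda\ne0$ is an eigenvalue of $L$ of algebraic multiplicity $m$ and $D$ is an open disc centred at $\lambda$ with $0\notin\overline D$ and $\overline D\cap\sigma(L)=\{\lambda\}$, then for all large $K$ the operator $L_K$ has exactly $m$ eigenvalues in $D$ counted with multiplicity, $P_{L_K}(D)\to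 P_L(D)$ in operator norm, and $P_{L_K}(D)v\to v$ for each eigenvector $v$ of $L$ with eigenvalue $\lambda$. \textbf{(B) Strong--weak (DFLY) case.} Let $L$, $(L_k)$, $\mathcal B_s,\mathcal B_w$, $a,b,M$, $\delta_k$, $E_{k,w\to s}$ be as described in the context, with $0<a<M$. Fix $\mu\in(a,M)$, put $\mathfrak q=|\log(\mu/M)|/|\log(a/M)|\in(0,1)$, and assume the rate condition $$\delta_k\,E_{k,w\to s}^{\mathfrak q}\longrightarrow0\qquad(k\to\infty).$$ Let $U\subset\mathbb C$ be a bounded domain with piecewise $C^1$ Jordan boundary $\Gamma=\partial U$ such that $\inf_{z\in\Gamma}|z|\ge\mu$ and $U$ is disjoint from $\{|z|\le a\}$. If $\Gamma\subset\rho(L)$, then there is $k_0$ such that for all $k\ge k_0$ one has $\Gamma\subset\rho(L_k)$ and: (B1) $\dim\operatorname{Ran}P_{L_k}(U)=\dim\operatorname{Ran}P_L(U)$; (B2) $\|P_{L_k}(U)-P_L(U)\|_{s\to w}\to0$ as $k\to\infty$; (B3) the perturbation condition $\sup_{z\in\Gamma}b\,\delta_k\,\|(zI-L_k)^{-1}\|_{w\to w}<\inf_{z\in\Gamma}(|z|-a)$, which involves only $a,b,\delta_k$ and $L_k$, is satisfied. Moreover, without assuming $\Gamma\subset\rho(L)$: for any $k$ with $\Gamma\subset\rho(L_k)$ for which the perturbation condition in (B3) holds, one has $\Gamma\subset\rho(L)$ and the equality in (B1) holds for that $k$. Consequently, for every eigenvalue $\lambda$ of $L$ on $\mathcal B_s$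 with $|\lambda|>\mu$, of algebraic multiplicity $m$, and every open disc $D$ centred at $\lambda$ with $\overline D\subset\{|z|\ge\mu\}$ and $\overline D\cap\sigma(L)=\{\lambda\}$: for all large $k$, $L_k$ has exactly $m$ eigenvalues in $D$ counted with multiplicity, $\|P_{L_k}(D)-P_L(D)\|_{s\to w}\to0$, and $\|P_{L_k}(D)v-v\|_w\to0$ for each eigenvector $v\in\mathcal B_s$ of $L$ with eigenvalue $\lambda$.
   Context: For a bounded operator $A$: $\rho(A)$ and $\sigma(A)$ are its resolvent set and spectrum, and for a bounded domain $U$ with piecewise $C^1$ Jordan boundary $\partial U\subset\rho(A)$ the Riesz projector is $P_A(U)=\frac1{2\pi i}\int_{\partial U}(zI-A)^{-1}dz$. Setting for part (B). $(\mathcal B_s,\|\cdot\|_s)\hookrightarrow(\mathcal B_w,\|\cdot\|_w)$ are complex Banach spaces with continuous and compact embedding $i$, $E_{s\to w}:=\|i\|_{s\to w}$; $\|\cdot\|_{x\to y}$ denotes the operator norm from $\mathcal B_x$ to $\mathcal B_y$. $L$ is a bounded operator on $\mathcal B_s$ with a bounded extension to $\mathcal B_w$ (same symbol), and there are constants $a,b,M\in(0,\infty)$ with $\|Lu\|_s\le a\|u\|_s+b\|u\|_w$ and $\|Lu\|_w\le M\|u\|_w$ for all $u\in\mathcal B_s$ (Doeblin--Fortet--Lasota--Yorke, DFLY, inequality). There are finite-rank projections $\pi_k:\mathcal B_w\to\mathcal B_w$ ($k\ge1$) with $\pi_k^2=\pi_k$, $\|\pi_k\|_{w\to w}\le1$,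 $\|\pi_k\|_{s\to s}\le1$, $\pi_k\pi_{k'}=\pi_k$ for $k'\ge k$, $\operatorname{Ran}(\pi_k)\subset\mathcal B_s$, and $L_k:=\pi_kL\pi_k$. The operators $L_k$ are bounded on $\mathcal B_s$ and $\mathcal B_w$ and satisfy the same bounds $\|L_ku\|_s\le a\|u\|_s+b\|u\|_w$, $\|L_ku\|_w\le M\|u\|_w$ for $u\in\mathcal B_s$. There is a sequence $\varepsilon_k\downarrow0$ with $\|(\mathrm{Id}-\pi_k)L\|_{s\to w}+\|L(\mathrm{Id}-\pi_k)\|_{s\to w}\le\varepsilon_k$. Put $\delta_k:=\|L-L_k\|_{s\to w}$, $E_k:=\operatorname{Ran}(\pi_k)$ and $E_{k,w\to s}:=\sup_{u\in E_k\setminus\{0\}}\|u\|_s/\|u\|_w<\infty$. Here $\rho(L),\sigma(L)$ and Riesz projectors of $L$ refer to $L$ on $\mathcal B_s$; $\rho(L_k)$ means that $zI-L_k$ is boundedly invertible on both $\mathcal B_s$ and $\mathcal B_w$, and Riesz projectors of $L_k$ refer to $L_k$ on $\mathcal B_s$. *)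

theory Defs
  imports "HOL-Complex_Analysis.Complex_Analysis" "HOL-Library.Extended_Nat"
begin

section \<open>Complex Banach spaces\<close>

text \<open>The libraries provide real Banach spaces only. A complex Banach space is a real one carrying a
  compatible multiplication by complex scalars for which the norm is absolutely homogeneous.\<close>

class scaleC = scaleR +
  fixes scaleC :: "complex \<Rightarrow> 'a \<Rightarrow> 'a" (infixr \<open>*\<^sub>C\<close> 75)
  assumes scaleR_scaleC: "r *\<^sub>R x = complex_of_real r *\<^sub>C x"

class complex_vector = scaleC + ab_group_add +
  assumes scaleC_add_right: "c *\<^sub>C (x + y) = c *\<^sub>C x + c *\<^sub>C y"
    and scaleC_add_left: "(c + d) *\<^sub>C x = c *\<^sub>C x + d *\<^sub>C x"
    and scaleC_scaleC: "c *\<^sub>C d *\<^sub>C x = (c * d) *\<^sub>C x"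
    and scaleC_one: "1 *\<^sub>C x = x"

class complex_normed_vector = complex_vector + real_normed_vector +
  assumes norm_scaleC: "norm (c *\<^sub>C x) = cmod c * norm x"

class complex_banach = complex_normed_vector + banach

global_interpretation complex_vector: vector_space "scaleC :: complex \<Rightarrow> 'a \<Rightarrow> 'a::complex_vector"
  by unfold_locales (simp_all add: scaleC_add_right scaleC_add_left scaleC_scaleC scaleC_one)

abbreviation clinear :: "('a::complex_vector \<Rightarrow> 'b::complex_vector) \<Rightarrow> bool"
  where "clinear \<equiv> Vector_Spaces.linear scaleC scaleC"

definition finite_cdim :: "'a::complex_vector set \<Rightarrow> bool"
  where "finite_cdim S \<longleftrightarrow> (\<exists>B. finite B \<and> S \<subseteq> complex_vector.span B)"

text \<open>The library dimension of an infinite-dimensional space is 0; here it is \<open>\<infinity>\<close>.\<close>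

definition cdim :: "'a::complex_vector set \<Rightarrow> enat"
  where "cdim S = (if finite_cdim S then enat (complex_vector.dim S) else \<infinity>)"

section \<open>Bounded operators\<close>

text \<open>Bounded complex-linear operators are the elements \<open>A\<close> of the library type of bounded
  (real-)linear maps for which \<open>clinear A\<close> holds; their norm is the operator norm.\<close>

lemma bounded_linear_scaleC: "bounded_linear (\<lambda>x::'a::complex_normed_vector. c *\<^sub>C x)"
proof (rule bounded_linear_intro[where K = "cmod c"])
  fix r :: real and x :: 'a
  show "c *\<^sub>C r *\<^sub>R x = r *\<^sub>R c *\<^sub>C x"
    by (simp add: scaleR_scaleC scaleC_scaleC mult.commute)
qed (simp_all add: scaleC_add_right norm_scaleC)

instantiation blinfun :: (real_normed_vector, complex_normed_vector) complex_normed_vector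
begin

lift_definition scaleC_blinfun :: "complex \<Rightarrow> 'a \<Rightarrow>\<^sub>L 'b \<Rightarrow> 'a \<Rightarrow>\<^sub>L 'b" is "\<lambda>c f x. c *\<^sub>C f x"
  by (rule bounded_linear_compose[OF bounded_linear_scaleC])

instance
proof
  fix c d :: complex and r :: real and A B :: "'a \<Rightarrow>\<^sub>L 'b"
  show "r *\<^sub>R A = complex_of_real r *\<^sub>C A"
    by transfer (simp add: scaleR_scaleC)
  show "c *\<^sub>C (A + B) = c *\<^sub>C A + c *\<^sub>C B"
    by transfer (simp add: scaleC_add_right)
  show "(c + d) *\<^sub>C A = c *\<^sub>C A + d *\<^sub>C A"
    by transfer (simp add: scaleC_add_left)
  show *: "c *\<^sub>C d *\<^sub>C A = (c * d) *\<^sub>C A" for c d :: complex and A :: "'a \<Rightarrow>\<^sub>L 'b"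
    by transfer (simp add: scaleC_scaleC)
  show one: "1 *\<^sub>C A = A" for A :: "'a \<Rightarrow>\<^sub>L 'b"
    by transfer (simp add: scaleC_one)
  have le: "norm (c *\<^sub>C A) \<le> cmod c * norm A" for c and A :: "'a \<Rightarrow>\<^sub>L 'b"
    by (rule norm_blinfun_bound)
      (simp_all add: scaleC_blinfun.rep_eq norm_scaleC mult.assoc mult_left_mono norm_blinfun)
  show "norm (c *\<^sub>C A) = cmod c * norm A"
  proof (cases "c = 0")
    case True
    with le[of 0 A] show ?thesis by simp
  next
    case False
    have "norm A = norm (inverse c *\<^sub>C c *\<^sub>C A)"
      using False by (simp add: * one)
    also have "\<dots> \<le> cmod (inverse c) * norm (c *\<^sub>C A)"
      by (rule le)
    finally have "cmod c * norm A \<le> norm (c *\<^sub>C A)"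
      using False by (simp add: norm_divide field_simps)
    with le show ?thesis by (rule antisym)
  qed
qed

end

instance blinfun :: (real_normed_vector, complex_banach) complex_banach ..

definition finite_rank :: "('a::real_normed_vector \<Rightarrow>\<^sub>L 'b::complex_normed_vector) \<Rightarrow> bool"
  where "finite_rank A \<longleftrightarrow> finite_cdim (range (blinfun_apply A))"

definition compact_operator :: "('a::real_normed_vector \<Rightarrow>\<^sub>L 'b::real_normed_vector) \<Rightarrow> bool"
  where "compact_operator A \<longleftrightarrow> (\<forall>S. bounded S \<longrightarrow> compact (closure (blinfun_apply A ` S)))"

section \<open>Spectral notions\<close>

definition is_resolvent ::
  "('a::complex_normed_vector \<Rightarrow>\<^sub>L 'a) \<Rightarrow> complex \<Rightarrow> ('a \<Rightarrow>\<^sub>L 'a) \<Rightarrow> bool"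
  where "is_resolvent A z R \<longleftrightarrow>
    (z *\<^sub>C id_blinfun - A) o\<^sub>L R = id_blinfun \<and> R o\<^sub>L (z *\<^sub>C id_blinfun - A) = id_blinfun"

definition resolvent_set :: "('a::complex_normed_vector \<Rightarrow>\<^sub>L 'a) \<Rightarrow> complex set"
  where "resolvent_set A = {z. \<exists>R. is_resolvent A z R}"

definition resolvent :: "('a::complex_normed_vector \<Rightarrow>\<^sub>L 'a) \<Rightarrow> complex \<Rightarrow> 'a \<Rightarrow>\<^sub>L 'a"
  where "resolvent A z = (THE R. is_resolvent A z R)"

definition spectrum :: "('a::complex_normed_vector \<Rightarrow>\<^sub>L 'a) \<Rightarrow> complex set"
  where "spectrum A = - resolvent_set A"

definition eigenvector ::
  "('a::complex_normed_vector \<Rightarrow>\<^sub>L 'a) \<Rightarrow> complex \<Rightarrow> 'a \<Rightarrow> bool"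
  where "eigenvector A \<zeta> v \<longleftrightarrow> v \<noteq> 0 \<and> A v = \<zeta> *\<^sub>C v"

definition eigenvalue :: "('a::complex_normed_vector \<Rightarrow>\<^sub>L 'a) \<Rightarrow> complex \<Rightarrow> bool"
  where "eigenvalue A \<zeta> \<longleftrightarrow> (\<exists>v. eigenvector A \<zeta> v)"

definition generalized_eigenspace ::
  "('a::complex_normed_vector \<Rightarrow>\<^sub>L 'a) \<Rightarrow> complex \<Rightarrow> 'a set"
  where "generalized_eigenspace A \<zeta> = (\<Union>n. {v. ((\<lambda>u. \<zeta> *\<^sub>C u - A u) ^^ n) v = 0})"

definition algebraic_multiplicity ::
  "('a::complex_normed_vector \<Rightarrow>\<^sub>L 'a) \<Rightarrow> complex \<Rightarrow> enat"
  where "algebraic_multiplicity A \<zeta> = cdim (generalized_eigenspace A \<zeta>)"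

definition eigenvalue_count ::
  "('a::complex_normed_vector \<Rightarrow>\<^sub>L 'a) \<Rightarrow> complex set \<Rightarrow> enat"
  where "eigenvalue_count A U =
    (if finite {\<zeta>\<in>U. eigenvalue A \<zeta>}
     then \<Sum>\<zeta> | \<zeta> \<in> U \<and> eigenvalue A \<zeta>. algebraic_multiplicity A \<zeta> else \<infinity>)"

section \<open>Jordan domains and Riesz projectors\<close>

text \<open>Piecewise \<open>C\<^sup>1\<close> in the classical sense: \<open>C\<^sup>1\<close> on each closed piece of a finite partition of
  \<open>[0,1]\<close>, with one-sided derivatives at the end points of the piece. This implies
  \<^const>\<open>valid_path\<close>, which would allow an unbounded derivative near the break points.\<close>

definition piecewise_C1_path :: "(real \<Rightarrow> complex) \<Rightarrow> bool"
  where "piecewise_C1_path \<gamma> \<longleftrightarrow>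
    (\<exists>T. finite T \<and> {0, 1} \<subseteq> T \<and> T \<subseteq> {0..1} \<and>
      (\<forall>s\<in>T. \<forall>t\<in>T. s < t \<and> {s<..<t} \<inter> T = {} \<longrightarrow>
        (\<exists>\<gamma>'. continuous_on {s..t} \<gamma>' \<and>
          (\<forall>x\<in>{s..t}. (\<gamma> has_vector_derivative \<gamma>' x) (at x within {s..t})))))"

text \<open>The winding number fixes the positive orientation of \<open>\<gamma>\<close>, on which the sign of the Riesz
  projector depends.\<close>

definition jordan_domain :: "complex set \<Rightarrow> (real \<Rightarrow> complex) \<Rightarrow> bool"
  where "jordan_domain U \<gamma> \<longleftrightarrow>
    U \<noteq> {} \<and> open U \<and> connected U \<and> bounded U \<and>
    piecewise_C1_path \<gamma> \<and> simple_path \<gamma> \<and> pathfinish \<gamma> = pathstart \<gamma> \<and>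
    path_image \<gamma> = frontier U \<and> (\<forall>z\<in>U. winding_number \<gamma> z = 1)"

text \<open>The formula behind the library's \<^const>\<open>contour_integral\<close>, for vector-valued integrands.\<close>

definition vector_contour_integral ::
  "(real \<Rightarrow> complex) \<Rightarrow> (complex \<Rightarrow> 'a::complex_normed_vector) \<Rightarrow> 'a"
  where "vector_contour_integral \<gamma> f =
    integral {0..1} (\<lambda>t. vector_derivative \<gamma> (at t within {0..1}) *\<^sub>C f (\<gamma> t))"

text \<open>For \<open>jordan_domain U \<gamma>\<close> with \<open>frontier U \<subseteq> resolvent_set A\<close> this is \<open>P\<^sub>A(U)\<close>; by Cauchy's
  theorem it does not depend on the choice of \<open>\<gamma>\<close>.\<close>

definition riesz_projector ::
  "('a::complex_normed_vector \<Rightarrow>\<^sub>L 'a) \<Rightarrow> (real \<Rightarrow> complex) \<Rightarrow> 'a \<Rightarrow>\<^sub>L 'a"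
  where "riesz_projector A \<gamma> =
    (1 / (2 * complex_of_real pi * \<i>)) *\<^sub>C vector_contour_integral \<gamma> (resolvent A)"

definition riesz_rank ::
  "('a::complex_normed_vector \<Rightarrow>\<^sub>L 'a) \<Rightarrow> (real \<Rightarrow> complex) \<Rightarrow> enat"
  where "riesz_rank A \<gamma> = cdim (range (blinfun_apply (riesz_projector A \<gamma>)))"

section \<open>The strong--weak setting\<close>

definition compression :: "('a::real_normed_vector \<Rightarrow>\<^sub>L 'a) \<Rightarrow> ('a \<Rightarrow>\<^sub>L 'a) \<Rightarrow> 'a \<Rightarrow>\<^sub>L 'a"
  where "compression P L = P o\<^sub>L L o\<^sub>L P"

text \<open>The embedding of the strong space \<open>'s\<close> into the weak space \<open>'w\<close> is the injection \<open>\<iota>\<close>. An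
  operator acting on both spaces is a pair of operators intertwined by \<open>\<iota>\<close>: \<open>Ls\<close> is \<open>L\<close> on the
  strong space and \<open>Lw\<close> its extension to the weak one; likewise \<open>\<pi>s k\<close>, \<open>\<pi>w k\<close> for \<open>\<pi>\<^sub>k\<close>, where
  \<open>\<pi>s k\<close> exists because the range of \<open>\<pi>\<^sub>k\<close> lies in the strong space. The \<open>s \<rightarrow> w\<close> norm of an
  operator \<open>A\<close> on the strong space is \<open>norm (\<iota> o\<^sub>L A)\<close>. The index \<open>k\<close> starts at 1.\<close>

locale dfly_scheme =
  fixes \<iota> :: "'s::complex_banach \<Rightarrow>\<^sub>L 'w::complex_banach"
    and Ls :: "'s \<Rightarrow>\<^sub>L 's" and Lw :: "'w \<Rightarrow>\<^sub>L 'w"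
    and \<pi>s :: "nat \<Rightarrow> 's \<Rightarrow>\<^sub>L 's" and \<pi>w :: "nat \<Rightarrow> 'w \<Rightarrow>\<^sub>L 'w"
    and a b M :: real
  assumes embedding: "clinear \<iota>" "inj \<iota>" "compact_operator \<iota>"
    and L_clinear: "clinear Ls" "clinear Lw"
    and L_extension: "\<iota> o\<^sub>L Ls = Lw o\<^sub>L \<iota>"
    and constants_pos: "0 < a" "0 < b" "0 < M"
    and L_strong: "norm (Ls u) \<le> a * norm u + b * norm (\<iota> u)"
    and L_weak: "norm (\<iota> (Ls u)) \<le> M * norm (\<iota> u)"
    and pi_clinear: "1 \<le> k \<Longrightarrow> clinear (\<pi>s k)" "1 \<le> k \<Longrightarrow> clinear (\<pi>w k)"
    and pi_restriction: "1 \<le> k \<Longrightarrow> \<iota> o\<^sub>L \<pi>s k = \<pi>w k o\<^sub>L \<iota>"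
    and pi_finite_rank: "1 \<le> k \<Longrightarrow> finite_rank (\<pi>w k)"
    and pi_idem: "1 \<le> k \<Longrightarrow> \<pi>w k o\<^sub>L \<pi>w k = \<pi>w k"
    and pi_norm: "1 \<le> k \<Longrightarrow> norm (\<pi>w k) \<le> 1" "1 \<le> k \<Longrightarrow> norm (\<pi>s k) \<le> 1"
    and pi_nested: "1 \<le> k \<Longrightarrow> k \<le> k' \<Longrightarrow> \<pi>w k o\<^sub>L \<pi>w k' = \<pi>w k"
    and pi_range: "1 \<le> k \<Longrightarrow> range (\<pi>w k) \<subseteq> range \<iota>"
    and Lk_strong: "1 \<le> k \<Longrightarrow>
      norm (compression (\<pi>s k) Ls u) \<le> a * norm u + b * norm (\<iota> u)"
    and Lk_weak: "1 \<le> k \<Longrightarrow> norm (\<iota> (compression (\<pi>s k) Ls u)) \<le> M * norm (\<iota> u)"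
    and approximation: "\<exists>\<epsilon>::nat \<Rightarrow> real. \<epsilon> \<longlonglongrightarrow> 0 \<and> (\<forall>k\<ge>1. \<forall>k'\<ge>k. \<epsilon> k' \<le> \<epsilon> k) \<and>
      (\<forall>k\<ge>1. norm (\<iota> o\<^sub>L (id_blinfun - \<pi>s k) o\<^sub>L Ls) + norm (\<iota> o\<^sub>L Ls o\<^sub>L (id_blinfun - \<pi>s k)) \<le> \<epsilon> k)"

text \<open>The supremum of \<open>\<parallel>u\<parallel>\<^sub>s / \<parallel>u\<parallel>\<^sub>w\<close> over the range of the projection \<open>P\<close> of the weak space. The
  vector \<open>u = 0\<close> contributes \<open>0 / 0 = 0\<close>; it matters only for \<open>P = 0\<close>, where the supremum is 0.\<close>

definition weak_to_strong_const ::
  "('s::real_normed_vector \<Rightarrow>\<^sub>L 'w::real_normed_vector) \<Rightarrow> ('w \<Rightarrow>\<^sub>L 'w) \<Rightarrow> real"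
  where "weak_to_strong_const \<iota> P = (SUP u\<in>{u. \<iota> u \<in> range P}. norm u / norm (\<iota> u))"

end

theory Submission
  imports Defs "HOL-Computational_Algebra.Fundamental_Theorem_Algebra"
begin

text \<open>Both parts compare \<open>L\<close> with its finite-rank approximation \<open>L\<^sub>k\<close> along the segment
  \<open>L\<^sub>k + t (L - L\<^sub>k)\<close>. If \<open>z - L\<^sub>k - t (L - L\<^sub>k)\<close> is bounded below, uniformly in \<open>t \<in> [0,1]\<close> and in \<open>z\<close> on
  the boundary curve, and the curve lies in the resolvent set of \<open>L\<^sub>k\<close>, then it stays in the resolvent
  set along the segment and the Riesz projectors depend continuously on \<open>t\<close>. Projections at distance
  less than 1 have ranges of equal dimension, so the rank is constant (\<open>riesz_rank_homotopy\<close>). Each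
  perturbation condition yields such a lower bound (\<open>finite_rank_certificate\<close>, \<open>dfly_certificate\<close>): in
  the compact case directly, in the strong--weak case through the DFLY inequality, which bounds the
  strong norm by the weak one, and the weak resolvent of \<open>L\<^sub>k\<close>. The Riesz projector of a finite-rank
  operator has finite rank if \<open>0\<close> is outside the curve, and the equality of the ranks carries this
  over to \<open>L\<close>. A Riesz projector of finite rank counts
  eigenvalues: its range is the direct sum of the generalized eigenspaces for the eigenvalues in the
  domain (\<open>eigenvalue_count_eq_rank\<close>).

  Conversely, if the curve lies in the resolvent set of \<open>L\<close>, the conditions hold for large \<open>k\<close>. In the
  compact case this is stability of the resolvent under small perturbations. In the strong--weak case
  it is the perturbation theory of Keller and Liverani. The DFLY inequality gives
  \<open>\<parallel>R(z) g\<parallel>\<^sub>w \<le> K ((a/\<mu>)\<^sup>n \<parallel>g\<parallel>\<^sub>s + (M/\<mu>)\<^sup>n \<parallel>g\<parallel>\<^sub>w)\<close> for \<open>\<bar>z\<bar> \<ge> \<mu>\<close> and all \<open>n\<close> (\<open>weak_resolvent_estimate\<close>).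
  Used for \<open>L\<close>, with \<open>n\<close> fixed, it bounds the strong resolvents of \<open>L\<^sub>k\<close> uniformly in \<open>k\<close>
  (\<open>strong_resolvents_bounded\<close>) and makes the Riesz projectors converge in the norm from the strong to the
  weak space. Used for \<open>L\<^sub>k\<close> on the range of \<open>\<pi>\<^sub>k\<close>, where \<open>\<parallel>g\<parallel>\<^sub>s \<le> E\<^sub>k \<parallel>g\<parallel>\<^sub>w\<close>, with \<open>n\<close> balancing the two terms,
  it bounds the weak resolvents of \<open>L\<^sub>k\<close> by a constant times \<open>1 + E\<^sub>k\<close> to the power \<open>q\<close>
  (\<open>weak_resolvent_bound\<close>), and the rate condition is what makes the perturbation condition follow.

  The Riesz projectors are integrals of operator-valued functions. Cauchy's theorem is applied to
  them through bounded functionals, which separate points by a form of the Hahn--Banach theorem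
  (\<open>functional_eqI\<close>); it is needed only for the idempotence of the projectors (\<open>projector_idem\<close>).\<close>

section \<open>Functionals separate points\<close>

text \<open>Sublinear functionals. Positive homogeneity is required only as an inequality; applying it to \<open>s\<close> and \<open>1 / s\<close> gives
  equality.\<close>

definition sublinear :: "('a::real_vector \<Rightarrow> real) \<Rightarrow> bool"
  where "sublinear p \<longleftrightarrow>
    (\<forall>x y. p (x + y) \<le> p x + p y) \<and> (\<forall>s>0. \<forall>x. p (s *\<^sub>R x) \<le> s * p x)"

lemma sublinear_zero: "p 0 = 0" if "sublinear p"
proof -
  have "p (s *\<^sub>R 0) \<le> s * p 0" if "0 < s" for s
    using \<open>sublinear p\<close> that unfolding sublinear_def by blast
  from this[of 2] this[of "1/2"] 
  show ?thesis by simp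
qed

lemma sublinear_lower: "- p (- x) \<le> p x" if "sublinear p"
proof -
  have "p (x + - x) \<le> p x + p (- x)"
    using that unfolding sublinear_def by blast
  then show ?thesis using sublinear_zero[OF that] by simp
qed

text \<open>For sublinear \<open>p\<close>, the largest sublinear functional below \<open>p\<close> whose value at \<open>- y\<close> is at most
  \<open>- p y\<close>.\<close>

definition lower_at :: "('a::real_vector \<Rightarrow> real) \<Rightarrow> 'a \<Rightarrow> 'a \<Rightarrow> real"
  where "lower_at p y x = (INF t\<in>{0..}. p (x + t *\<^sub>R y) - t * p y)"

lemma sublinear_scale: "p (t *\<^sub>R y) = t * p y" if p: "sublinear p" and "0 \<le> t"
proof (cases "t = 0")
  case True
  then show ?thesis using sublinear_zero[OF p] by simp
next
  case False
  with \<open>0 \<le> t\<close> have t: "0 < t" by simp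
  then have "p (inverse t *\<^sub>R t *\<^sub>R y) \<le> inverse t * p (t *\<^sub>R y)"
    using p unfolding sublinear_def by (meson positive_imp_inverse_positive)
  then have "t * p y \<le> p (t *\<^sub>R y)"
    using t by (simp add: field_simps)
  moreover have "p (t *\<^sub>R y) \<le> t * p y"
    using p t unfolding sublinear_def by blast
  ultimately show ?thesis by simp
qed

lemma lower_at_le:
  assumes p: "sublinear p" and "0 \<le> t"
  shows "lower_at p y x \<le> p (x + t *\<^sub>R y) - t * p y"
proof -
  have "- p (- x) \<le> p (x + s *\<^sub>R y) - s * p y" if "0 \<le> s" for s
  proof -
    have "p (- x + (x + s *\<^sub>R y)) \<le> p (- x) + p (x + s *\<^sub>R y)"
      using p unfolding sublinear_def by blast
    then show ?thesis using sublinear_scale[OF p that, of y] by simp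
  qed
  then have "bdd_below ((\<lambda>t. p (x + t *\<^sub>R y) - t * p y) ` {0..})"
    by (intro bdd_belowI2[of _ "- p (- x)"]) auto
  then show ?thesis
    unfolding lower_at_def using \<open>0 \<le> t\<close> by (intro cINF_lower) auto
qed

lemma le_lower_at: "c \<le> lower_at p y x" if "\<And>t. 0 \<le> t \<Longrightarrow> c \<le> p (x + t *\<^sub>R y) - t * p y"
  unfolding lower_at_def using that by (intro cINF_greatest) auto

lemma lower_at_below: "lower_at p y \<le> p" if "sublinear p"
  using lower_at_le[OF that, of 0] by (auto simp: le_fun_def)

lemma sublinear_lower_at:
  assumes p: "sublinear p"
  shows "sublinear (lower_at p y)"
  unfolding sublinear_def
proof (intro conjI allI impI)
  fix x1 x2
  have *: "lower_at p y (x1 + x2) \<le> (p (x1 + t1 *\<^sub>R y) - t1 * p y) + (p (x2 + t2 *\<^sub>R y) - t2 * p y)"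
    if "0 \<le> t1" "0 \<le> t2" for t1 t2
  proof -
    have "lower_at p y (x1 + x2) \<le> p (x1 + x2 + (t1 + t2) *\<^sub>R y) - (t1 + t2) * p y"
      using that by (intro lower_at_le p) simp
    also have "x1 + x2 + (t1 + t2) *\<^sub>R y = (x1 + t1 *\<^sub>R y) + (x2 + t2 *\<^sub>R y)"
      by (simp add: algebra_simps)
    also have "p \<dots> \<le> p (x1 + t1 *\<^sub>R y) + p (x2 + t2 *\<^sub>R y)"
      using p unfolding sublinear_def by blast
    finally show ?thesis by (simp add: algebra_simps)
  qed
  have **: "lower_at p y (x1 + x2) - (p (x1 + t1 *\<^sub>R y) - t1 * p y) \<le> lower_at p y x2"
    if "0 \<le> t1" for t1
  proof (rule le_lower_at)
    fix t2 :: real assume "0 \<le> t2"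
    then show "lower_at p y (x1 + x2) - (p (x1 + t1 *\<^sub>R y) - t1 * p y) \<le> p (x2 + t2 *\<^sub>R y) - t2 * p y"
      using * [of t1 t2] that by linarith
  qed
  have "lower_at p y (x1 + x2) - lower_at p y x2 \<le> lower_at p y x1"
  proof (rule le_lower_at)
    fix t1 :: real assume "0 \<le> t1"
    then show "lower_at p y (x1 + x2) - lower_at p y x2 \<le> p (x1 + t1 *\<^sub>R y) - t1 * p y"
      using ** [of t1] by linarith
  qed
  then show "lower_at p y (x1 + x2) \<le> lower_at p y x1 + lower_at p y x2"
    by simp
next
  fix s :: real and x
  assume s: "0 < s"
  have "lower_at p y (s *\<^sub>R x) / s \<le> lower_at p y x"
  proof (rule le_lower_at)
    fix t :: real assume t: "0 \<le> t"
    have "lower_at p y (s *\<^sub>R x) \<le> p (s *\<^sub>R x + (s * t) *\<^sub>R y) - (s * t) * p y"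
      using s t by (intro lower_at_le p) simp
    also have "s *\<^sub>R x + (s * t) *\<^sub>R y = s *\<^sub>R (x + t *\<^sub>R y)"
      by (simp add: algebra_simps)
    also have "p \<dots> = s * p (x + t *\<^sub>R y)"
      using s by (intro sublinear_scale p) simp
    finally show "lower_at p y (s *\<^sub>R x) / s \<le> p (x + t *\<^sub>R y) - t * p y"
      using s by (simp add: field_simps)
  qed
  then show "lower_at p y (s *\<^sub>R x) \<le> s * lower_at p y x"
    using s by (simp add: field_simps)
qed

lemma minimal_sublinear_exists:
  fixes q :: "'a::real_vector \<Rightarrow> real"
  assumes q: "sublinear q"
  obtains p where "sublinear p" "p \<le> q" "\<And>p'. sublinear p' \<Longrightarrow> p' \<le> p \<Longrightarrow> p' = p"
proof -
  let ?A = "{p. sublinear p \<and> p \<le> q}" and ?P = "\<lambda>p p' :: 'a \<Rightarrow> real. p' \<le> p"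
  have "\<exists>m\<in>?A. \<forall>p\<in>?A. ?P m p \<longrightarrow> p = m"
  proof (rule predicate_Zorn)
    show "partial_order_on ?A (relation_of ?P ?A)"
      by (rule partial_order_on_relation_ofI) auto
  next
    fix C assume "C \<in> Chains (relation_of ?P ?A)"
    then have sub: "C \<subseteq> ?A" and chain: "\<And>p p'. p \<in> C \<Longrightarrow> p' \<in> C \<Longrightarrow> p \<le> p' \<or> p' \<le> p"
      by (auto simp: Chains_def relation_of_def)
    show "\<exists>u\<in>?A. \<forall>p\<in>C. ?P p u"
    proof (cases "C = {}")
      case True
      then show ?thesis using q by auto
    next
      case False
      define u where "u x = (INF p\<in>C. p x)" for x
      have low: "- q (- x) \<le> p x" if "p \<in> C" for p x
      proof -
        have "- q (- x) \<le> - p (- x)" using sub that by (auto simp: le_fun_def)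
        also have "\<dots> \<le> p x" using sub that by (intro sublinear_lower) auto
        finally show ?thesis .
      qed
      have u_le: "u x \<le> p x" if "p \<in> C" for p x
        unfolding u_def using that low by (intro cINF_lower bdd_belowI2[of _ "- q (- x)"]) auto
      have le_u: "c \<le> u x" if "\<And>p. p \<in> C \<Longrightarrow> c \<le> p x" for c x
        unfolding u_def using that False by (intro cINF_greatest) auto
      have "sublinear u"
        unfolding sublinear_def
      proof (intro conjI allI impI)
        fix x y
        have *: "u (x + y) \<le> p x + p' y" if pp: "p \<in> C" "p' \<in> C" for p p'
        proof -
          obtain r where r: "r \<in> C" "r \<le> p" "r \<le> p'"
            using chain[OF pp] pp by blast
          have "u (x + y) \<le> r (x + y)" by (rule u_le) (rule r)
          also have "\<dots> \<le> r x + r y" using r(1) sub by (auto simp: sublinear_def)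
          also have "\<dots> \<le> p x + p' y" using r by (auto simp: le_fun_def intro: add_mono)
          finally show ?thesis .
        qed
        have "u (x + y) - p x \<le> p' y" if "p \<in> C" "p' \<in> C" for p p'
          using *[OF that] by (simp add: algebra_simps)
        then have **: "u (x + y) - p x \<le> u y" if "p \<in> C" for p
          using that by (intro le_u) blast
        have "u (x + y) - u y \<le> p x" if "p \<in> C" for p
          using **[OF that] by (simp add: algebra_simps)
        then have "u (x + y) - u y \<le> u x"
          by (intro le_u) blast
        then show "u (x + y) \<le> u x + u y" by simp
      next
        fix s :: real and x assume s: "0 < s"
        have "u (s *\<^sub>R x) / s \<le> u x"
        proof (rule le_u)
          fix p assume p: "p \<in> C"
          have "u (s *\<^sub>R x) \<le> p (s *\<^sub>R x)" by (rule u_le[OF p])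
          also have "\<dots> \<le> s * p x" using p sub s by (auto simp: sublinear_def)
          finally show "u (s *\<^sub>R x) / s \<le> p x" using s by (simp add: field_simps)
        qed
        then show "u (s *\<^sub>R x) \<le> s * u x" using s by (simp add: field_simps)
      qed
      moreover have "u \<le> q"
      proof (rule le_funI)
        fix x
        from False obtain p where p: "p \<in> C" by blast
        then have "p x \<le> q x" using sub by (auto simp: le_fun_def)
        with u_le[OF p, of x] show "u x \<le> q x" by linarith
      qed
      ultimately show ?thesis using u_le by (auto simp: le_fun_def)
    qed
  qed
  then obtain p where p: "sublinear p" "p \<le> q"
    and min: "\<And>p'. sublinear p' \<Longrightarrow> p' \<le> q \<Longrightarrow> p' \<le> p \<Longrightarrow> p' = p" by auto
  show ?thesis
    by (rule that[OF p]) (rule min, assumption, erule order_trans[OF _ p(2)], assumption)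
qed

text \<open>A weak form of the Hahn--Banach theorem: the dual of a normed space separates points. A minimal
  sublinear functional \<open>p\<close> is linear because \<^term>\<open>lower_at p y\<close> cannot lie strictly below it.
  Starting from \<^term>\<open>lower_at norm x0\<close> makes it nonzero at \<open>x0\<close>.\<close>

lemma real_functional_nonzero:
  fixes x0 :: "'a::real_normed_vector"
  assumes "x0 \<noteq> 0"
  obtains f :: "'a \<Rightarrow> real" where "bounded_linear f" "f x0 \<noteq> 0"
proof -
  have n: "sublinear (norm :: 'a \<Rightarrow> real)"
    by (simp add: sublinear_def norm_triangle_ineq)
  obtain p where p: "sublinear p" "p \<le> lower_at norm x0"
    and min: "\<And>p'. sublinear p' \<Longrightarrow> p' \<le> p \<Longrightarrow> p' = p"
    by (rule minimal_sublinear_exists[OF sublinear_lower_at[OF n, of x0]]) blast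
  have add: "p (x + y) = p x + p y" for x y
  proof (rule antisym)
    show "p (x + y) \<le> p x + p y" using p(1) unfolding sublinear_def by blast
    have "lower_at p y = p"
      by (intro min sublinear_lower_at lower_at_below p)
    then have "p x \<le> p (x + 1 *\<^sub>R y) - 1 * p y"
      using lower_at_le[OF p(1), of 1 y x] by simp
    then show "p x + p y \<le> p (x + y)" by simp
  qed
  have neg: "p (- x) = - p x" for x
    using add[of x "- x"] sublinear_zero[OF p(1)] by simp
  have scale: "p (s *\<^sub>R x) = s * p x" for s x
  proof (cases "0 \<le> s")
    case True
    then show ?thesis by (rule sublinear_scale[OF p(1)])
  next
    case False
    then have "p ((- s) *\<^sub>R x) = (- s) * p x" by (intro sublinear_scale p) simp
    then show ?thesis using neg[of "s *\<^sub>R x"] by simp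
  qed
  have le: "p x \<le> norm x" for x
    using le_funD[OF p(2), of x] le_funD[OF lower_at_below[OF n, of x0], of x] by linarith
  have "bounded_linear p"
  proof (rule bounded_linear_intro[where K = 1])
    show "norm (p x) \<le> norm x * 1" for x
      using le[of x] le[of "- x"] neg[of x] by auto
  qed (simp_all add: add scale)
  moreover have "p (- x0) \<le> norm (- x0 + 1 *\<^sub>R x0) - 1 * norm x0"
    using le_funD[OF p(2), of "- x0"] lower_at_le[OF n, of 1 x0 "- x0"] by linarith
  then have "p x0 \<noteq> 0" using neg[of x0] assms by auto
  ultimately show ?thesis by (rule that)
qed

text \<open>Bounded complex-linear functionals.\<close>

definition cfunctional :: "('a::complex_normed_vector \<Rightarrow> complex) \<Rightarrow> bool"
  where "cfunctional \<phi> \<longleftrightarrow> bounded_linear \<phi> \<and> (\<forall>c x. \<phi> (c *\<^sub>C x) = c * \<phi> x)"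

lemma functional_nonzero:
  fixes x0 :: "'a::complex_normed_vector"
  assumes "x0 \<noteq> 0"
  obtains \<phi> where "cfunctional \<phi>" "\<phi> x0 \<noteq> 0"
proof -
  obtain f :: "'a \<Rightarrow> real" where f: "bounded_linear f" "f x0 \<noteq> 0"
    using real_functional_nonzero[OF assms] .
  interpret f: bounded_linear f by (rule f)
  \<comment> \<open>The complex-linear functional whose real part is \<open>f\<close>.\<close>
  define \<phi> where "\<phi> x = complex_of_real (f x) - \<i> * complex_of_real (f (\<i> *\<^sub>C x))" for x
  have bl: "bounded_linear \<phi>"
    unfolding \<phi>_def
    by (intro bounded_linear_sub bounded_linear_const_mult
        bounded_linear_compose[OF bounded_linear_of_real]
        bounded_linear_compose[OF f(1)] f(1) bounded_linear_scaleC)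
  interpret \<phi>: bounded_linear \<phi> by (rule bl)
  have i: "\<phi> (\<i> *\<^sub>C x) = \<i> * \<phi> x" for x
  proof -
    have "\<i> *\<^sub>C \<i> *\<^sub>C x = - x"
      using scaleR_scaleC[of "-1" x] by (simp add: scaleC_scaleC)
    then show ?thesis by (simp add: \<phi>_def linear_neg[OF bounded_linear.linear[OF f(1)]] algebra_simps)
  qed
  have "\<phi> (c *\<^sub>C x) = c * \<phi> x" for c x
  proof -
    have "c *\<^sub>C x = Re c *\<^sub>R x + Im c *\<^sub>R (\<i> *\<^sub>C x)"
      by (simp add: scaleR_scaleC scaleC_scaleC flip: scaleC_add_left)
        (simp add: complex_eq mult.commute)
    then have "\<phi> (c *\<^sub>C x) = (complex_of_real (Re c) + \<i> * complex_of_real (Im c)) * \<phi> x"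
      by (simp add: \<phi>.add \<phi>.scaleR i scaleR_conv_of_real algebra_simps)
    then show ?thesis by (simp flip: complex_eq)
  qed
  moreover have "Re (\<phi> x0) = f x0" by (simp add: \<phi>_def)
  with f(2) have "\<phi> x0 \<noteq> 0" by auto
  ultimately show ?thesis using bl that by (auto simp: cfunctional_def)
qed

lemma functional_eqI:
  fixes x y :: "'a::complex_normed_vector"
  assumes "\<And>\<phi>. cfunctional \<phi> \<Longrightarrow> \<phi> x = \<phi> y"
  shows "x = y"
proof (rule ccontr)
  assume "x \<noteq> y"
  then have "x - y \<noteq> 0" by simp
  then obtain \<phi> where \<phi>: "cfunctional \<phi>" "\<phi> (x - y) \<noteq> 0"
    by (rule functional_nonzero)
  then show False
    using assms[OF \<phi>(1)] by (simp add: cfunctional_def linear_diff bounded_linear.linear)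
qed

section \<open>Complex-linear maps\<close>

lemma clinear_iff:
  "clinear f \<longleftrightarrow> (\<forall>x y. f (x + y) = f x + f y) \<and> (\<forall>c x. f (c *\<^sub>C x) = c *\<^sub>C f x)"
  for f :: "'a::complex_vector \<Rightarrow> 'b::complex_vector"
  by (simp add: Vector_Spaces.linear_iff complex_vector.vector_space_axioms)

lemma clinear_add: "clinear f \<Longrightarrow> f (x + y) = f x + f y"
  and clinear_scaleC: "clinear f \<Longrightarrow> f (c *\<^sub>C x) = c *\<^sub>C f x"
  for f :: "'a::complex_vector \<Rightarrow> 'b::complex_vector"
  by (auto simp: clinear_iff)

lemma scaleC_zero_right [simp]: "c *\<^sub>C (0::'a::complex_vector) = 0"
  by (rule complex_vector.scale_zero_right)

lemma scaleC_zero_left [simp]: "0 *\<^sub>C (x::'a::complex_vector) = 0"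
  by (rule complex_vector.scale_zero_left)

lemma scaleC_one_left [simp]: "1 *\<^sub>C (x::'a::complex_vector) = x"
  by (rule scaleC_one)

lemmas scaleC_algebra = scaleC_add_right scaleC_add_left complex_vector.scale_right_diff_distrib
  complex_vector.scale_left_diff_distrib scaleC_scaleC

lemma clinear_zero: "clinear f \<Longrightarrow> f 0 = 0"
  for f :: "'a::complex_vector \<Rightarrow> 'b::complex_vector"
  using clinear_scaleC[of f 0 0] by simp

lemma clinear_diff: "clinear f \<Longrightarrow> f (x - y) = f x - f y"
  for f :: "'a::complex_vector \<Rightarrow> 'b::complex_vector"
  using clinear_add[of f "x - y" y] by simp

lemma clinear_sum: "clinear f \<Longrightarrow> f (sum g A) = (\<Sum>i\<in>A. f (g i))"
  for f :: "'a::complex_vector \<Rightarrow> 'b::complex_vector"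
  by (induction A rule: infinite_finite_induct) (simp_all add: clinear_zero clinear_add)

lemma clinear_funpow: "clinear f \<Longrightarrow> clinear (f ^^ n)"
  for f :: "'a::complex_vector \<Rightarrow> 'a"
  by (induction n) (auto simp: clinear_iff)

lemma subspace_range_clinear: "complex_vector.subspace (range f)" if "clinear f"
  for f :: "'a::complex_vector \<Rightarrow> 'b::complex_vector"
proof (rule complex_vector.subspaceI)
  show "0 \<in> range f" using clinear_zero[OF that] by (metis rangeI)
  show "x + y \<in> range f" if "x \<in> range f" "y \<in> range f" for x y
    using that by (auto simp flip: clinear_add[OF \<open>clinear f\<close>])
  show "c *\<^sub>C x \<in> range f" if "x \<in> range f" for c x
    using that by (auto simp flip: clinear_scaleC[OF \<open>clinear f\<close>])
qed

section \<open>Finite-dimensional subspaces\<close>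

lemma finite_cdim_mono: "finite_cdim T \<Longrightarrow> S \<subseteq> T \<Longrightarrow> finite_cdim S"
  by (auto simp: finite_cdim_def)

lemma finite_cdim_basis:
  assumes "finite_cdim V"
  obtains B where "B \<subseteq> V" "complex_vector.independent B" "V \<subseteq> complex_vector.span B" "finite B"
    "card B = complex_vector.dim V"
proof -
  obtain B where B: "B \<subseteq> V" "complex_vector.independent B" "V \<subseteq> complex_vector.span B"
    "card B = complex_vector.dim V"
    by (rule complex_vector.basis_exists)
  obtain C where "finite C" "V \<subseteq> complex_vector.span C"
    using assms by (auto simp: finite_cdim_def)
  then have "finite B"
    using complex_vector.independent_span_bound[of C B] B by blast
  with B that show ?thesis by blast
qed

lemma independent_card_le_dim:
  assumes "finite_cdim V" "complex_vector.independent B" "B \<subseteq> V"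
  shows "finite B" "card B \<le> complex_vector.dim V"
proof -
  obtain C where C: "V \<subseteq> complex_vector.span C" "finite C" "card C = complex_vector.dim V"
    using finite_cdim_basis[OF assms(1)] .
  then show "finite B" "card B \<le> complex_vector.dim V"
    using complex_vector.independent_span_bound[of C B] assms by auto
qed

lemma independent_image_clinear:
  fixes f :: "'a::complex_vector \<Rightarrow> 'b::complex_vector"
  assumes "clinear f" "complex_vector.independent B" "complex_vector.subspace V" "B \<subseteq> V" "inj_on f V"
  shows "complex_vector.independent (f ` B)"
proof -
  interpret vector_space_pair "scaleC :: complex \<Rightarrow> 'a \<Rightarrow> 'a" "scaleC :: complex \<Rightarrow> 'b \<Rightarrow> 'b"
    by unfold_locales
  have "complex_vector.span B \<subseteq> V"
    using assms by (simp add: complex_vector.span_minimal)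
  then show ?thesis
    using assms by (intro linear_independent_injective_image) (auto intro: inj_on_subset)
qed

lemma finite_cdim_injective:
  fixes f :: "'a::complex_vector \<Rightarrow> 'b::complex_vector"
  assumes f: "clinear f" and V: "complex_vector.subspace V" and inj: "inj_on f V"
    and fV: "f ` V \<subseteq> W" and W: "finite_cdim W"
  shows "finite_cdim V" "complex_vector.dim V \<le> complex_vector.dim W"
proof -
  obtain B where B: "B \<subseteq> V" "complex_vector.independent B" "V \<subseteq> complex_vector.span B"
    "card B = complex_vector.dim V"
    by (rule complex_vector.basis_exists)
  have "complex_vector.independent (f ` B)"
    using independent_image_clinear[OF f B(2) V B(1) inj] .
  moreover have "f ` B \<subseteq> W" using B fV by blast
  ultimately have fB: "finite (f ` B)" "card (f ` B) \<le> complex_vector.dim W"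
    using independent_card_le_dim[OF W] by blast+
  have injB: "inj_on f B" using inj B(1) by (rule inj_on_subset)
  then have "finite B" using fB(1) by (simp add: finite_image_iff)
  then show "finite_cdim V" using B(3) by (auto simp: finite_cdim_def)
  show "complex_vector.dim V \<le> complex_vector.dim W"
    using fB(2) B(4) by (simp add: card_image injB)
qed

lemma injective_endomorphism_surjective:
  fixes f :: "'a::complex_vector \<Rightarrow> 'a"
  assumes f: "clinear f" and V: "complex_vector.subspace V" "finite_cdim V"
    and inj: "inj_on f V" and fV: "f ` V \<subseteq> V"
  shows "V \<subseteq> f ` V"
proof
  fix y assume y: "y \<in> V"
  obtain B where B: "B \<subseteq> V" "complex_vector.independent B" "V \<subseteq> complex_vector.span B"
    "finite B" "card B = complex_vector.dim V"
    using finite_cdim_basis[OF V(2)] .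
  have ind: "complex_vector.independent (f ` B)"
    using independent_image_clinear[OF f B(2) V(1) B(1) inj] .
  have card: "card (f ` B) = complex_vector.dim V"
    using B(5) inj_on_subset[OF inj B(1)] by (simp add: card_image)
  have fB: "f ` B \<subseteq> V" using B(1) fV by blast
  have "y \<in> complex_vector.span (f ` B)"
  proof (rule ccontr)
    assume "y \<notin> complex_vector.span (f ` B)"
    then have "complex_vector.independent (insert y (f ` B))" "y \<notin> f ` B"
      using ind by (auto simp: complex_vector.independent_insertI complex_vector.span_base)
    then have "card (insert y (f ` B)) \<le> complex_vector.dim V" "card (insert y (f ` B)) = Suc (card (f ` B))"
      using y fB independent_card_le_dim[OF V(2), of "insert y (f ` B)"] B(4) by auto
    then show False using card by simp
  qed
  also have "complex_vector.span (f ` B) = f ` complex_vector.span B"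
  proof -
    interpret vector_space_pair "scaleC :: complex \<Rightarrow> 'a \<Rightarrow> 'a" "scaleC :: complex \<Rightarrow> 'a \<Rightarrow> 'a"
      by unfold_locales
    show ?thesis by (rule linear_span_image[OF f])
  qed
  also have "\<dots> \<subseteq> f ` V"
    using B(1) V(1) by (intro image_mono complex_vector.span_minimal)
  finally show "y \<in> f ` V" .
qed

lemma linear_relation:
  fixes x :: "nat \<Rightarrow> 'a::complex_vector"
  assumes B: "finite B" "card B \<le> n" and x: "\<And>i. x i \<in> complex_vector.span B"
  obtains c where "\<exists>i\<le>n. c i \<noteq> (0::complex)" "(\<Sum>i\<le>n. c i *\<^sub>C x i) = 0"
proof (cases "inj_on x {..n}")
  case True
  have "\<not> complex_vector.independent (x ` {..n})"
  proof
    assume "complex_vector.independent (x ` {..n})"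
    then have "card (x ` {..n}) \<le> card B"
      using complex_vector.independent_span_bound[OF B(1)] x by blast
    then show False using B(2) by (simp add: card_image[OF True])
  qed
  then obtain u where u: "\<exists>v\<in>x ` {..n}. u v \<noteq> 0" "(\<Sum>v\<in>x ` {..n}. u v *\<^sub>C v) = 0"
    by (auto simp: complex_vector.dependent_finite)
  show ?thesis
    by (rule that[of "\<lambda>i. u (x i)"]) (use u in \<open>auto simp: sum.reindex[OF True]\<close>)
next
  case False
  then obtain i j where ij: "i \<le> n" "j \<le> n" "i \<noteq> j" "x i = x j"
    by (auto simp: inj_on_def)
  define c :: "nat \<Rightarrow> complex" where "c k = (if k = i then 1 else if k = j then - 1 else 0)" for k
  have "(\<Sum>k\<le>n. c k *\<^sub>C x k) = (\<Sum>k\<in>{i, j}. c k *\<^sub>C x k)"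
    using ij by (intro sum.mono_neutral_right) (auto simp: c_def)
  also have "\<dots> = 0"
    using ij by (simp add: c_def complex_vector.scale_minus_left)
  finally show ?thesis
    using ij by (intro that[of c]) (auto simp: c_def)
qed

text \<open>All norms on a finite-dimensional space are equivalent: the coefficients with respect to a
  basis are bounded by the norm of the vector.\<close>

lemma coefficient_bound:
  fixes B :: "'a::complex_normed_vector set"
  assumes "finite B" "complex_vector.independent B"
  shows "\<exists>c>0. \<forall>\<alpha>. c * (\<Sum>b\<in>B. cmod (\<alpha> b)) \<le> norm (\<Sum>b\<in>B. \<alpha> b *\<^sub>C b)"
  using assms
proof (induction B rule: finite_induct)
  case empty
  show ?case by (auto intro: exI[of _ 1])
next
  case (insert x B)
  have xB: "x \<notin> complex_vector.span B" and ind: "complex_vector.independent B"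
    using insert.prems insert.hyps by (auto simp: complex_vector.independent_insert)
  obtain c where c: "0 < c" "\<And>\<alpha>. c * (\<Sum>b\<in>B. cmod (\<alpha> b)) \<le> norm (\<Sum>b\<in>B. \<alpha> b *\<^sub>C b)"
    using insert.IH[OF ind] by blast
  define s where "s \<alpha> = (\<Sum>b\<in>B. \<alpha> b *\<^sub>C b)" for \<alpha>
  \<comment> \<open>\<open>x\<close> has positive distance to \<open>span B\<close>: by the bound on \<open>B\<close>, the coefficients of an
    approximating sequence would converge.\<close>
  have "\<exists>d>0. \<forall>\<alpha>. d \<le> norm (x + s \<alpha>)"
  proof (rule ccontr)
    assume "\<not> ?thesis"
    then have "\<exists>\<alpha>. norm (x + s \<alpha>) < 1 / real (Suc n)" for n
      by (auto simp: not_le dest!: spec[of _ "1 / real (Suc n)"])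
    then obtain \<alpha> where \<alpha>: "\<And>n. norm (x + s (\<alpha> n)) < 1 / real (Suc n)"
      by metis
    have lim: "(\<lambda>n. x + s (\<alpha> n)) \<longlonglongrightarrow> 0"
      by (rule tendsto_norm_zero_cancel, rule tendsto_sandwich[OF _ _ tendsto_const LIMSEQ_inverse_real_of_nat])
        (use \<alpha> in \<open>auto intro!: always_eventually less_imp_le simp: field_simps\<close>)
    have "convergent (\<lambda>n. \<alpha> n b)" if b: "b \<in> B" for b
    proof (rule Cauchy_convergent, rule metric_CauchyI)
      fix e :: real assume e: "0 < e"
      from lim have "Cauchy (\<lambda>n. x + s (\<alpha> n))" by (rule LIMSEQ_imp_Cauchy)
      then obtain N where N: "\<And>m n. N \<le> m \<Longrightarrow> N \<le> n \<Longrightarrow> dist (x + s (\<alpha> m)) (x + s (\<alpha> n)) < c * e"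
        using metric_CauchyD[of _ "c * e"] c(1) e by (metis mult_pos_pos)
      have "dist (\<alpha> m b) (\<alpha> n b) < e" if "N \<le> m" "N \<le> n" for m n
      proof -
        have "c * cmod (\<alpha> m b - \<alpha> n b) \<le> c * (\<Sum>b\<in>B. cmod (\<alpha> m b - \<alpha> n b))"
          using c(1) b insert.hyps by (intro mult_left_mono member_le_sum) auto
        also have "\<dots> \<le> norm (\<Sum>b\<in>B. (\<alpha> m b - \<alpha> n b) *\<^sub>C b)"
          by (rule c(2))
        also have "(\<Sum>b\<in>B. (\<alpha> m b - \<alpha> n b) *\<^sub>C b) = (x + s (\<alpha> m)) - (x + s (\<alpha> n))"
          by (simp add: s_def scaleC_algebra sum_subtractf)
        also have "norm \<dots> < c * e"
          using N[OF that] by (simp add: dist_norm)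
        finally show ?thesis using c(1) by (simp add: dist_norm)
      qed
      then show "\<exists>M. \<forall>m\<ge>M. \<forall>n\<ge>M. dist (\<alpha> m b) (\<alpha> n b) < e" by blast
    qed
    then have "\<forall>b\<in>B. \<exists>l. (\<lambda>n. \<alpha> n b) \<longlonglongrightarrow> l" by (auto simp: convergent_def)
    then obtain \<beta> where \<beta>: "\<And>b. b \<in> B \<Longrightarrow> (\<lambda>n. \<alpha> n b) \<longlonglongrightarrow> \<beta> b" by metis
    have "(\<lambda>n. \<alpha> n b *\<^sub>C b) \<longlonglongrightarrow> \<beta> b *\<^sub>C b" if "b \<in> B" for b
    proof (rule LIM_zero_cancel, rule tendsto_norm_zero_cancel)
      have "(\<lambda>n. cmod (\<alpha> n b - \<beta> b) * norm b) \<longlonglongrightarrow> 0"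
        using tendsto_mult_left_zero[OF tendsto_norm_zero[OF LIM_zero[OF \<beta>[OF that]]]] .
      then show "(\<lambda>n. norm (\<alpha> n b *\<^sub>C b - \<beta> b *\<^sub>C b)) \<longlonglongrightarrow> 0"
        by (simp flip: complex_vector.scale_left_diff_distrib add: norm_scaleC)
    qed
    then have "(\<lambda>n. x + s (\<alpha> n)) \<longlonglongrightarrow> x + s \<beta>"
      unfolding s_def by (intro tendsto_intros)
    with lim have "x + s \<beta> = 0" by (rule LIMSEQ_unique[symmetric])
    then have "x = - s \<beta>" by (simp add: add_eq_0_iff2)
    also have "\<dots> \<in> complex_vector.span B"
      unfolding s_def
      by (intro complex_vector.span_neg complex_vector.span_sum complex_vector.span_scale
          complex_vector.span_base)
    finally show False using xB by contradiction
  qed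
  then obtain d where d: "0 < d" "\<And>\<alpha>. d \<le> norm (x + s \<alpha>)" by blast
  define K where "K = 1 / d + (1 + norm x / d) / c"
  have K: "0 < K" using c(1) d(1) by (auto simp: K_def intro!: add_pos_nonneg)
  have "(\<Sum>b\<in>insert x B. cmod (\<alpha> b)) \<le> K * norm (\<Sum>b\<in>insert x B. \<alpha> b *\<^sub>C b)" for \<alpha>
  proof -
    define a n where "a = \<alpha> x" and "n = norm (a *\<^sub>C x + s \<alpha>)"
    have 1: "cmod a * d \<le> n"
    proof (cases "a = 0")
      case False
      have "d \<le> norm (x + s (\<lambda>b. \<alpha> b / a))" by (rule d(2))
      also have "x + s (\<lambda>b. \<alpha> b / a) = (1 / a) *\<^sub>C (a *\<^sub>C x + s \<alpha>)"
        using False by (simp add: s_def scaleC_algebra complex_vector.scale_sum_right)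
      also have "norm \<dots> = n / cmod a"
        by (simp add: norm_scaleC n_def norm_divide)
      finally show ?thesis using False by (simp add: field_simps)
    qed (simp add: n_def)
    have "c * (\<Sum>b\<in>B. cmod (\<alpha> b)) \<le> norm (s \<alpha>)" unfolding s_def by (rule c(2))
    also have "\<dots> \<le> n + cmod a * norm x"
      using norm_triangle_ineq4[of "a *\<^sub>C x + s \<alpha>" "a *\<^sub>C x"] by (simp add: n_def norm_scaleC)
    also have "cmod a * norm x \<le> (n / d) * norm x"
      using 1 d(1) by (intro mult_right_mono) (auto simp: field_simps)
    finally have "(\<Sum>b\<in>B. cmod (\<alpha> b)) \<le> (n + (n / d) * norm x) / c"
      using c(1) by (simp add: field_simps)
    moreover have "cmod a \<le> n / d" using 1 d(1) by (simp add: field_simps)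
    ultimately have "cmod a + (\<Sum>b\<in>B. cmod (\<alpha> b)) \<le> K * n"
      by (simp add: K_def field_simps)
    then show ?thesis using insert.hyps by (simp add: a_def n_def s_def)
  qed
  then show ?case
    using K by (intro exI[of _ "1 / K"]) (simp add: field_simps)
qed

section \<open>Generalized eigenspaces\<close>

text \<open>The operator \<open>\<zeta> I - A\<close>.\<close>

definition shift :: "('a::complex_normed_vector \<Rightarrow>\<^sub>L 'a) \<Rightarrow> complex \<Rightarrow> 'a \<Rightarrow> 'a"
  where "shift A \<zeta> u = \<zeta> *\<^sub>C u - A u"

lemma clinear_shift: "clinear (blinfun_apply A) \<Longrightarrow> clinear (shift A \<zeta>)"
  by (auto simp: clinear_iff shift_def scaleC_algebra mult.commute)

lemma shift_commute: "clinear (blinfun_apply A) \<Longrightarrow> shift A \<zeta> (shift A \<eta> u) = shift A \<eta> (shift A \<zeta> u)"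
  by (simp add: shift_def clinear_diff clinear_scaleC scaleC_algebra mult.commute)

lemma shift_funpow_commute: "clinear (blinfun_apply A) \<Longrightarrow> (shift A \<zeta> ^^ n) (shift A \<eta> u) = shift A \<eta> ((shift A \<zeta> ^^ n) u)"
  by (induction n) (simp_all add: shift_commute)

lemma generalized_eigenspace_iff:
  "v \<in> generalized_eigenspace A \<zeta> \<longleftrightarrow> (\<exists>n. (shift A \<zeta> ^^ n) v = 0)"
proof -
  have "shift A \<zeta> = (\<lambda>u. \<zeta> *\<^sub>C u - A u)" by (simp add: shift_def fun_eq_iff)
  then show ?thesis by (simp add: generalized_eigenspace_def)
qed

lemma funpow_zero_mono:
  fixes f :: "'a::complex_vector \<Rightarrow> 'a"
  assumes "clinear f" "(f ^^ n) v = 0" "n \<le> m"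
  shows "(f ^^ m) v = 0"
proof -
  have "(f ^^ (m - n + n)) v = (f ^^ (m - n)) ((f ^^ n) v)"
    by (simp only: funpow_add comp_apply)
  with assms show ?thesis by (simp add: clinear_zero clinear_funpow)
qed

lemma subspace_generalized_eigenspace:
  assumes A: "clinear (blinfun_apply A)"
  shows "complex_vector.subspace (generalized_eigenspace A \<zeta>)"
proof (rule complex_vector.subspaceI)
  have S: "clinear (shift A \<zeta> ^^ n)" for n by (intro clinear_funpow clinear_shift A)
  show "0 \<in> generalized_eigenspace A \<zeta>"
    unfolding generalized_eigenspace_iff by (rule exI[of _ 0]) simp
  show "c *\<^sub>C x \<in> generalized_eigenspace A \<zeta>" if "x \<in> generalized_eigenspace A \<zeta>" for c x
  proof -
    from that obtain n where "(shift A \<zeta> ^^ n) x = 0" by (auto simp: generalized_eigenspace_iff)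
    then have "(shift A \<zeta> ^^ n) (c *\<^sub>C x) = 0" by (simp add: clinear_scaleC[OF S])
    then show ?thesis by (auto simp: generalized_eigenspace_iff)
  qed
  show "x + y \<in> generalized_eigenspace A \<zeta>"
    if "x \<in> generalized_eigenspace A \<zeta>" "y \<in> generalized_eigenspace A \<zeta>" for x y
  proof -
    from that obtain m n where "(shift A \<zeta> ^^ m) x = 0" "(shift A \<zeta> ^^ n) y = 0"
      by (auto simp: generalized_eigenspace_iff)
    then have "(shift A \<zeta> ^^ (max m n)) x = 0" "(shift A \<zeta> ^^ (max m n)) y = 0"
      using funpow_zero_mono[OF clinear_shift[OF A] _ max.cobounded1]
        funpow_zero_mono[OF clinear_shift[OF A] _ max.cobounded2] by blast+
    then have "(shift A \<zeta> ^^ (max m n)) (x + y) = 0" by (simp add: clinear_add[OF S])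
    then show ?thesis by (auto simp: generalized_eigenspace_iff)
  qed
qed

lemma shift_generalized_eigenspace:
  assumes "clinear (blinfun_apply A)" "v \<in> generalized_eigenspace A \<zeta>"
  shows "shift A \<eta> v \<in> generalized_eigenspace A \<zeta>"
proof -
  from assms(2) obtain n where "(shift A \<zeta> ^^ n) v = 0" by (auto simp: generalized_eigenspace_iff)
  then have "(shift A \<zeta> ^^ n) (shift A \<eta> v) = 0"
    using assms(1) by (simp add: shift_funpow_commute clinear_zero[OF clinear_shift])
  then show ?thesis unfolding generalized_eigenspace_iff by blast
qed

lemma shift_funpow_generalized_eigenspace:
  assumes "clinear (blinfun_apply A)" "v \<in> generalized_eigenspace A \<zeta>"
  shows "(shift A \<eta> ^^ n) v \<in> generalized_eigenspace A \<zeta>"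
  by (induction n) (simp_all add: assms shift_generalized_eigenspace)

lemma shift_injective_generalized_eigenspace:
  assumes A: "clinear (blinfun_apply A)" and v: "v \<in> generalized_eigenspace A \<eta>" and ne: "\<zeta> \<noteq> \<eta>"
    and zero: "shift A \<zeta> v = 0"
  shows "v = 0"
proof -
  from v obtain n where n: "(shift A \<eta> ^^ n) v = 0" by (auto simp: generalized_eigenspace_iff)
  have "(shift A \<eta> ^^ k) v = (\<eta> - \<zeta>) ^ k *\<^sub>C v" for k
  proof (induction k)
    case (Suc k)
    have "A v = \<zeta> *\<^sub>C v" using zero by (simp add: shift_def)
    then have "shift A \<eta> v = (\<eta> - \<zeta>) *\<^sub>C v" by (simp add: shift_def scaleC_algebra)
    then show ?case
      by (simp add: Suc clinear_scaleC[OF clinear_shift[OF A]] scaleC_scaleC mult.commute)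
  qed simp
  with n ne show ?thesis by simp
qed

lemma shift_funpow_injective_generalized_eigenspace:
  assumes A: "clinear (blinfun_apply A)" and v: "v \<in> generalized_eigenspace A \<eta>" and ne: "\<zeta> \<noteq> \<eta>"
    and zero: "(shift A \<zeta> ^^ n) v = 0"
  shows "v = 0"
  using zero
proof (induction n)
  case (Suc n)
  have "(shift A \<zeta> ^^ n) v = 0"
    using Suc.prems
    by (intro shift_injective_generalized_eigenspace[OF A
          shift_funpow_generalized_eigenspace[OF A v] ne]) simp
  then show ?case by (rule Suc.IH)
qed simp

lemma shift_surjective_generalized_eigenspace:
  assumes A: "clinear (blinfun_apply A)" and v: "v \<in> generalized_eigenspace A \<eta>" and ne: "\<zeta> \<noteq> \<eta>"
  obtains x where "x \<in> generalized_eigenspace A \<eta>" "shift A \<zeta> x = v"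
proof -
  note sub = subspace_generalized_eigenspace[OF A, of \<eta>]
  have "\<exists>x\<in>generalized_eigenspace A \<eta>. shift A \<zeta> x = v" if "(shift A \<eta> ^^ n) v = 0" for n v
    using that
  proof (induction n arbitrary: v)
    case 0
    then show ?case
      using complex_vector.subspace_0[OF sub] clinear_zero[OF clinear_shift[OF A, of \<zeta>]] by auto
  next
    case (Suc n)
    have "(shift A \<eta> ^^ n) (shift A \<eta> v) = 0"
      using Suc.prems by (simp add: funpow_swap1)
    then obtain y where y: "y \<in> generalized_eigenspace A \<eta>" "shift A \<zeta> y = shift A \<eta> v"
      using Suc.IH by blast
    have v: "v \<in> generalized_eigenspace A \<eta>"
      using Suc.prems unfolding generalized_eigenspace_iff by blast
    \<comment> \<open>The two shifts differ by the invertible scalar \<open>\<zeta> - \<eta>\<close>.\<close>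
    have "shift A \<zeta> (v - y) = (\<zeta> - \<eta>) *\<^sub>C v"
      unfolding clinear_diff[OF clinear_shift[OF A]] y(2) by (simp add: shift_def scaleC_algebra)
    then have "shift A \<zeta> ((1 / (\<zeta> - \<eta>)) *\<^sub>C (v - y)) = v"
      using ne by (simp add: clinear_scaleC[OF clinear_shift[OF A]] scaleC_scaleC)
    moreover have "(1 / (\<zeta> - \<eta>)) *\<^sub>C (v - y) \<in> generalized_eigenspace A \<eta>"
      using v y(1) by (intro complex_vector.subspace_scale[OF sub] complex_vector.subspace_diff[OF sub])
    ultimately show ?case by blast
  qed
  moreover from v obtain n where "(shift A \<eta> ^^ n) v = 0"
    unfolding generalized_eigenspace_iff by blast
  ultimately show ?thesis using that by blast
qed

lemma generalized_eigenspaces_independent: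
  assumes A: "clinear (blinfun_apply A)" and "finite F"
    and "\<And>\<zeta>. \<zeta> \<in> F \<Longrightarrow> u \<zeta> \<in> generalized_eigenspace A \<zeta>"
    and "(\<Sum>\<zeta>\<in>F. u \<zeta>) = 0" and "\<zeta> \<in> F"
  shows "u \<zeta> = 0"
  using assms(2-)
proof (induction F arbitrary: u \<zeta> rule: finite_induct)
  case (insert \<eta> F)
  obtain n where n: "(shift A \<eta> ^^ n) (u \<eta>) = 0"
    using insert.prems(1)[of \<eta>] by (auto simp: generalized_eigenspace_iff)
  have S: "clinear (shift A \<eta> ^^ n)" by (intro clinear_funpow clinear_shift A)
  have "0 = (shift A \<eta> ^^ n) (u \<eta> + (\<Sum>\<zeta>\<in>F. u \<zeta>))"
    using insert.prems(2) insert.hyps by (simp add: clinear_zero[OF S])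
  also have "\<dots> = (\<Sum>\<zeta>\<in>F. (shift A \<eta> ^^ n) (u \<zeta>))"
    by (simp add: clinear_add[OF S] clinear_sum[OF S] n)
  finally have sum0: "(\<Sum>\<zeta>\<in>F. (shift A \<eta> ^^ n) (u \<zeta>)) = 0" by simp
  have F: "u \<xi> = 0" if "\<xi> \<in> F" for \<xi>
  proof (rule shift_funpow_injective_generalized_eigenspace[OF A])
    show "u \<xi> \<in> generalized_eigenspace A \<xi>" using insert.prems(1) that by blast
    show "\<eta> \<noteq> \<xi>" using insert.hyps that by blast
    show "(shift A \<eta> ^^ n) (u \<xi>) = 0"
      using insert.IH[of "\<lambda>\<zeta>. (shift A \<eta> ^^ n) (u \<zeta>)", OF _ sum0 that]
        insert.prems(1) shift_funpow_generalized_eigenspace[OF A] by blast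
  qed
  then have "u \<eta> = 0" using insert.prems(2) insert.hyps by simp
  with F insert.prems(3) show ?case by blast
qed simp

text \<open>The kernel of a product of shifts is spanned by generalized eigenvectors. For the induction step,
  \<open>(\<zeta> I - A) v\<close> is a sum of generalized eigenvectors; those for eigenvalues other than \<open>\<zeta>\<close> have
  preimages of the same kind under \<open>\<zeta> I - A\<close>.\<close>

lemma fold_shift_zero_imp_span:
  assumes A: "clinear (blinfun_apply A)" and "fold (shift A) zs v = 0"
  shows "v \<in> complex_vector.span (\<Union>\<zeta>\<in>set zs. generalized_eigenspace A \<zeta>)"
  using assms(2)
proof (induction zs arbitrary: v)
  case Nil
  then show ?case by (simp add: complex_vector.span_zero)
next
  case (Cons \<zeta> zs)
  let ?S = "complex_vector.span (\<Union>\<eta>\<in>set (\<zeta> # zs). generalized_eigenspace A \<eta>)"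
  let ?G = "generalized_eigenspace A \<zeta>"
  have G: "?G \<subseteq> ?S" by (auto intro: complex_vector.span_base)
  note sub = subspace_generalized_eigenspace[OF A, of \<zeta>]
  note SH = clinear_shift[OF A, of \<zeta>]
  have "\<exists>x\<in>?S. w - shift A \<zeta> x \<in> ?G"
    if "w \<in> complex_vector.span (\<Union>\<eta>\<in>set zs. generalized_eigenspace A \<eta>)" for w
    using that
  proof (induction rule: complex_vector.span_induct_alt)
    case base
    show ?case
      by (rule bexI[of _ 0])
        (simp_all add: clinear_zero[OF SH] complex_vector.subspace_0[OF sub] complex_vector.span_zero)
  next
    case (step c g w)
    then obtain x where x: "x \<in> ?S" "w - shift A \<zeta> x \<in> ?G" by blast
    from step obtain \<eta> where \<eta>: "\<eta> \<in> set zs" "g \<in> generalized_eigenspace A \<eta>" by blast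
    have "\<exists>y\<in>?S. g - shift A \<zeta> y \<in> ?G"
    proof (cases "\<zeta> = \<eta>")
      case True
      then show ?thesis
        using \<eta> clinear_zero[OF SH]
        by (intro bexI[of _ 0]) (simp_all add: complex_vector.span_zero)
    next
      case False
      obtain y where y: "y \<in> generalized_eigenspace A \<eta>" "shift A \<zeta> y = g"
        using shift_surjective_generalized_eigenspace[OF A \<eta>(2) False] .
      show ?thesis
        using y \<eta>(1) by (intro bexI[of _ y])
          (auto simp: complex_vector.subspace_0[OF sub] intro: complex_vector.span_base)
    qed
    then obtain y where y: "y \<in> ?S" "g - shift A \<zeta> y \<in> ?G" by blast
    have "c *\<^sub>C (g - shift A \<zeta> y) + (w - shift A \<zeta> x) \<in> ?G"
      using x(2) y(2)
      by (intro complex_vector.subspace_add[OF sub] complex_vector.subspace_scale[OF sub])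
    also have "c *\<^sub>C (g - shift A \<zeta> y) + (w - shift A \<zeta> x) = (c *\<^sub>C g + w) - shift A \<zeta> (c *\<^sub>C y + x)"
      by (simp add: clinear_add[OF SH] clinear_scaleC[OF SH] scaleC_algebra)
    finally show ?case
      using x(1) y(1)
      by (intro bexI[of _ "c *\<^sub>C y + x"] complex_vector.span_add complex_vector.span_scale)
  qed
  moreover have "shift A \<zeta> v \<in> complex_vector.span (\<Union>\<eta>\<in>set zs. generalized_eigenspace A \<eta>)"
    using Cons.prems by (intro Cons.IH) simp
  ultimately obtain x where x: "x \<in> ?S" "shift A \<zeta> v - shift A \<zeta> x \<in> ?G" by blast
  then obtain n where "(shift A \<zeta> ^^ n) (shift A \<zeta> (v - x)) = 0"
    by (auto simp: generalized_eigenspace_iff clinear_diff[OF SH])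
  then have "(shift A \<zeta> ^^ Suc n) (v - x) = 0" by (simp add: funpow_swap1)
  then have "v - x \<in> ?G" unfolding generalized_eigenspace_iff by blast
  then have "v - x \<in> ?S" using G by blast
  then show ?case using x(1) complex_vector.span_add[of "v - x" _ x] by simp
qed

text \<open>The value at \<open>v\<close> of the polynomial \<open>p\<close> in the operator \<open>A\<close>.\<close>

definition poly_op :: "('a::complex_normed_vector \<Rightarrow>\<^sub>L 'a) \<Rightarrow> complex poly \<Rightarrow> 'a \<Rightarrow> 'a"
  where "poly_op A p v = (\<Sum>i\<le>degree p. coeff p i *\<^sub>C (blinfun_apply A ^^ i) v)"

lemma poly_op_bound:
  assumes "degree p \<le> n"
  shows "poly_op A p v = (\<Sum>i\<le>n. coeff p i *\<^sub>C (blinfun_apply A ^^ i) v)"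
  unfolding poly_op_def using assms
  by (intro sum.mono_neutral_left) (auto simp: coeff_eq_0 not_le)

lemma poly_op_linear_factor:
  assumes A: "clinear (blinfun_apply A)"
  shows "poly_op A ([:- \<zeta>, 1:] * q) v = - poly_op A q (shift A \<zeta> v)"
proof -
  let ?n = "degree q" and ?f = "\<lambda>i. (blinfun_apply A ^^ i) v"
  have S: "clinear (blinfun_apply A ^^ i)" for i by (intro clinear_funpow A)
  have "degree ([:- \<zeta>, 1:] * q) \<le> Suc ?n"
    using degree_mult_le[of "[:- \<zeta>, 1:]" q] by simp
  then have "poly_op A ([:- \<zeta>, 1:] * q) v = (\<Sum>i\<le>Suc ?n. coeff ([:- \<zeta>, 1:] * q) i *\<^sub>C ?f i)"
    by (rule poly_op_bound)
  also have "\<dots> = (\<Sum>i\<le>Suc ?n. coeff (pCons 0 q) i *\<^sub>C ?f i) - (\<Sum>i\<le>Suc ?n. (\<zeta> * coeff q i) *\<^sub>C ?f i)"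
    by (simp add: scaleC_algebra sum_subtractf del: sum.atMost_Suc)
  also have "(\<Sum>i\<le>Suc ?n. coeff (pCons 0 q) i *\<^sub>C ?f i) = (\<Sum>i\<le>?n. coeff q i *\<^sub>C ?f (Suc i))"
    by (subst sum.atMost_Suc_shift) simp
  also have "(\<Sum>i\<le>Suc ?n. (\<zeta> * coeff q i) *\<^sub>C ?f i) = (\<Sum>i\<le>?n. (\<zeta> * coeff q i) *\<^sub>C ?f i)"
    by (simp add: coeff_eq_0)
  also have "(\<Sum>i\<le>?n. coeff q i *\<^sub>C ?f (Suc i)) - (\<Sum>i\<le>?n. (\<zeta> * coeff q i) *\<^sub>C ?f i)
      = (\<Sum>i\<le>?n. - (coeff q i *\<^sub>C (blinfun_apply A ^^ i) (shift A \<zeta> v)))"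
    unfolding sum_subtractf[symmetric]
  proof (rule sum.cong[OF refl])
    fix i
    have "(blinfun_apply A ^^ i) (shift A \<zeta> v) = \<zeta> *\<^sub>C ?f i - ?f (Suc i)"
      by (simp add: shift_def clinear_diff[OF S] clinear_scaleC[OF S] funpow_swap1)
    then show "coeff q i *\<^sub>C ?f (Suc i) - (\<zeta> * coeff q i) *\<^sub>C ?f i =
        - (coeff q i *\<^sub>C (blinfun_apply A ^^ i) (shift A \<zeta> v))"
      by (simp add: scaleC_algebra mult.commute)
  qed
  also have "\<dots> = - poly_op A q (shift A \<zeta> v)"
    by (simp add: poly_op_def sum_negf)
  finally show ?thesis .
qed

lemma poly_op_zero_imp_fold_shift_zero:
  assumes A: "clinear (blinfun_apply A)" and "p \<noteq> 0" "poly_op A p v = 0"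
  shows "\<exists>zs. fold (shift A) zs v = 0"
  using assms(2,3)
proof (induction "degree p" arbitrary: p v rule: less_induct)
  case less
  show ?case
  proof (cases "degree p = 0")
    case True
    then have "poly_op A p v = coeff p 0 *\<^sub>C v" "coeff p 0 \<noteq> 0"
      using less.prems(1) leading_coeff_0_iff[of p] by (auto simp: poly_op_def)
    with less.prems(2) have "v = 0" by simp
    then show ?thesis by (intro exI[of _ "[]"]) simp
  next
    case False
    then obtain \<zeta> where "poly p \<zeta> = 0"
      using Fundamental_Theorem_Algebra.fundamental_theorem_of_algebra[of p] by (auto simp: constant_degree)
    then obtain q where q: "p = [:- \<zeta>, 1:] * q"
      by (auto simp: poly_eq_0_iff_dvd elim: dvdE)
    with less.prems(1) have "q \<noteq> 0" by auto
    then have "degree q < degree p" unfolding q by (subst degree_mult_eq) auto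
    moreover have "poly_op A q (shift A \<zeta> v) = 0"
      using less.prems(2) unfolding q poly_op_linear_factor[OF A] by simp
    ultimately obtain zs where "fold (shift A) zs (shift A \<zeta> v) = 0"
      using less.hyps \<open>q \<noteq> 0\<close> by blast
    then show ?thesis by (intro exI[of _ "\<zeta> # zs"]) simp
  qed
qed

lemma span_generalized_eigenspaces:
  assumes A: "clinear (blinfun_apply A)" and V: "finite_cdim V" "blinfun_apply A ` V \<subseteq> V" and v: "v \<in> V"
  shows "v \<in> complex_vector.span (\<Union>\<zeta>. generalized_eigenspace A \<zeta>)"
proof -
  obtain B where B: "V \<subseteq> complex_vector.span B" "finite B"
    using V(1) by (auto simp: finite_cdim_def)
  have "(blinfun_apply A ^^ i) v \<in> V" for i
    by (induction i) (use v V(2) in auto)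
  then obtain c where c: "\<exists>i\<le>card B. c i \<noteq> 0" "(\<Sum>i\<le>card B. c i *\<^sub>C (blinfun_apply A ^^ i) v) = 0"
    using linear_relation[OF B(2) order_refl, of "\<lambda>i. (blinfun_apply A ^^ i) v"] B(1) by blast
  define p where "p = (\<Sum>i\<le>card B. monom (c i) i)"
  have coeff: "coeff p i = (if i \<le> card B then c i else 0)" for i
    by (simp add: p_def coeff_sum)
  then have "p \<noteq> 0" using c(1) by (metis coeff_0)
  moreover have "degree p \<le> card B" by (rule degree_le) (simp add: coeff)
  then have "poly_op A p v = 0"
    using c(2) by (simp add: poly_op_bound coeff)
  ultimately obtain zs where "fold (shift A) zs v = 0"
    using poly_op_zero_imp_fold_shift_zero[OF A] by blast
  then have "v \<in> complex_vector.span (\<Union>\<zeta>\<in>set zs. generalized_eigenspace A \<zeta>)"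
    by (rule fold_shift_zero_imp_span[OF A])
  also have "\<dots> \<subseteq> complex_vector.span (\<Union>\<zeta>. generalized_eigenspace A \<zeta>)"
    by (intro complex_vector.span_mono) auto
  finally show ?thesis .
qed

lemma dim_span_generalized_eigenspaces:
  assumes A: "clinear (blinfun_apply A)" and F: "finite F"
    and fin: "\<And>\<zeta>. \<zeta> \<in> F \<Longrightarrow> finite_cdim (generalized_eigenspace A \<zeta>)"
  shows "complex_vector.dim (complex_vector.span (\<Union>\<zeta>\<in>F. generalized_eigenspace A \<zeta>)) =
    (\<Sum>\<zeta>\<in>F. complex_vector.dim (generalized_eigenspace A \<zeta>))"
proof -
  let ?G = "generalized_eigenspace A"
  have "\<forall>\<zeta>\<in>F. \<exists>B. B \<subseteq> ?G \<zeta> \<and> complex_vector.independent B \<and> ?G \<zeta> \<subseteq> complex_vector.span B \<and>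
      finite B \<and> card B = complex_vector.dim (?G \<zeta>)"
    using finite_cdim_basis[OF fin] by metis
  then obtain B where B: "\<And>\<zeta>. \<zeta> \<in> F \<Longrightarrow> B \<zeta> \<subseteq> ?G \<zeta>" "\<And>\<zeta>. \<zeta> \<in> F \<Longrightarrow> complex_vector.independent (B \<zeta>)"
    "\<And>\<zeta>. \<zeta> \<in> F \<Longrightarrow> ?G \<zeta> \<subseteq> complex_vector.span (B \<zeta>)" "\<And>\<zeta>. \<zeta> \<in> F \<Longrightarrow> finite (B \<zeta>)"
    "\<And>\<zeta>. \<zeta> \<in> F \<Longrightarrow> card (B \<zeta>) = complex_vector.dim (?G \<zeta>)"
    by metis
  have disj: "B \<zeta> \<inter> B \<eta> = {}" if "\<zeta> \<in> F" "\<eta> \<in> F" "\<zeta> \<noteq> \<eta>" for \<zeta> \<eta>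
  proof -
    have "x = 0" if x: "x \<in> B \<zeta>" "x \<in> B \<eta>" for x
    proof -
      have "x \<in> ?G \<zeta>" "x \<in> ?G \<eta>" using x B(1) \<open>\<zeta> \<in> F\<close> \<open>\<eta> \<in> F\<close> by auto
      then show ?thesis
        using shift_funpow_injective_generalized_eigenspace[OF A _ \<open>\<zeta> \<noteq> \<eta>\<close>, of x]
        by (auto simp: generalized_eigenspace_iff[of _ A \<zeta>])
    qed
    moreover have "0 \<notin> B \<zeta>" using B(2)[OF \<open>\<zeta> \<in> F\<close>] complex_vector.dependent_zero by blast
    ultimately show ?thesis by blast
  qed
  have fin_UN: "finite (\<Union>\<zeta>\<in>F. B \<zeta>)" using F B(4) by blast
  have "complex_vector.independent (\<Union>\<zeta>\<in>F. B \<zeta>)"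
  proof (rule complex_vector.independent_if_scalars_zero[OF fin_UN])
    fix f x assume "(\<Sum>x\<in>(\<Union>\<zeta>\<in>F. B \<zeta>). f x *\<^sub>C x) = 0" and x: "x \<in> (\<Union>\<zeta>\<in>F. B \<zeta>)"
    then have sum0: "(\<Sum>\<zeta>\<in>F. \<Sum>x\<in>B \<zeta>. f x *\<^sub>C x) = 0"
      using F B(4) disj by (subst (asm) sum.UNION_disjoint) auto
    obtain \<zeta> where \<zeta>: "\<zeta> \<in> F" "x \<in> B \<zeta>" using x by blast
    have "(\<Sum>x\<in>B \<zeta>. f x *\<^sub>C x) = 0"
      by (rule generalized_eigenspaces_independent[OF A F _ sum0 \<zeta>(1)])
        (use B(1) in \<open>auto intro!: complex_vector.subspace_sum complex_vector.subspace_scale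
          subspace_generalized_eigenspace A\<close>)
    with B(2)[OF \<zeta>(1)] B(4)[OF \<zeta>(1)] \<zeta>(2) show "f x = 0"
      by (auto simp: complex_vector.dependent_finite)
  qed
  moreover have "(\<Union>\<zeta>\<in>F. B \<zeta>) \<subseteq> complex_vector.span (\<Union>\<zeta>\<in>F. ?G \<zeta>)"
    using B(1) by (auto intro!: complex_vector.span_base)
  moreover have "complex_vector.span (\<Union>\<zeta>\<in>F. ?G \<zeta>) \<subseteq> complex_vector.span (\<Union>\<zeta>\<in>F. B \<zeta>)"
  proof (rule complex_vector.span_minimal)
    show "(\<Union>\<zeta>\<in>F. ?G \<zeta>) \<subseteq> complex_vector.span (\<Union>\<zeta>\<in>F. B \<zeta>)"
    proof
      fix x assume "x \<in> (\<Union>\<zeta>\<in>F. ?G \<zeta>)"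
      then obtain \<zeta> where "\<zeta> \<in> F" "x \<in> complex_vector.span (B \<zeta>)" using B(3) by blast
      moreover from this have "complex_vector.span (B \<zeta>) \<subseteq> complex_vector.span (\<Union>\<zeta>\<in>F. B \<zeta>)"
        by (intro complex_vector.span_mono) auto
      ultimately show "x \<in> complex_vector.span (\<Union>\<zeta>\<in>F. B \<zeta>)" by blast
    qed
  qed (rule complex_vector.subspace_span)
  ultimately have "complex_vector.dim (complex_vector.span (\<Union>\<zeta>\<in>F. ?G \<zeta>)) = card (\<Union>\<zeta>\<in>F. B \<zeta>)"
    by (metis complex_vector.basis_card_eq_dim)
  also have "\<dots> = (\<Sum>\<zeta>\<in>F. card (B \<zeta>))"
    using F B(4) disj by (intro card_UN_disjoint) auto
  finally show ?thesis using B(5) by simp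
qed

lemma eigenvalue_iff_generalized_eigenspace:
  assumes A: "clinear (blinfun_apply A)"
  shows "eigenvalue A \<zeta> \<longleftrightarrow> generalized_eigenspace A \<zeta> \<noteq> {0}"
proof
  assume "eigenvalue A \<zeta>"
  then obtain v where v: "v \<noteq> 0" "shift A \<zeta> v = 0"
    by (auto simp: eigenvalue_def eigenvector_def shift_def)
  then have "(shift A \<zeta> ^^ 1) v = 0" by simp
  then have "v \<in> generalized_eigenspace A \<zeta>" unfolding generalized_eigenspace_iff by blast
  with v show "generalized_eigenspace A \<zeta> \<noteq> {0}" by blast
next
  assume "generalized_eigenspace A \<zeta> \<noteq> {0}"
  moreover have "0 \<in> generalized_eigenspace A \<zeta>"
    by (rule complex_vector.subspace_0[OF subspace_generalized_eigenspace[OF A]])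
  ultimately obtain v where v: "v \<noteq> 0" "v \<in> generalized_eigenspace A \<zeta>" by blast
  then obtain n where "(shift A \<zeta> ^^ n) v = 0" by (auto simp: generalized_eigenspace_iff)
  then obtain m where m: "(shift A \<zeta> ^^ m) v \<noteq> 0" "(shift A \<zeta> ^^ Suc m) v = 0"
    using v(1) by (induction n) auto
  then have "eigenvector A \<zeta> ((shift A \<zeta> ^^ m) v)"
    by (simp add: eigenvector_def shift_def)
  then show "eigenvalue A \<zeta>" by (auto simp: eigenvalue_def)
qed

text \<open>The eigenvalues in \<open>U\<close> are counted by the dimension of the space spanned by their generalized
  eigenvectors.\<close>

lemma eigenvalue_count_eq_dim:
  assumes A: "clinear (blinfun_apply A)" and fin: "finite_cdim V"
    and V: "V = complex_vector.span (\<Union>\<zeta>\<in>U. generalized_eigenspace A \<zeta>)"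
  shows "eigenvalue_count A U = enat (complex_vector.dim V)"
proof -
  let ?G = "generalized_eigenspace A" and ?E = "{\<zeta>\<in>U. eigenvalue A \<zeta>}"
  have finG: "finite_cdim (?G \<zeta>)" if "\<zeta> \<in> U" for \<zeta>
    using that by (intro finite_cdim_mono[OF fin]) (auto simp: V intro!: complex_vector.span_base)
  have dim_pos: "1 \<le> complex_vector.dim (?G \<zeta>)" if "\<zeta> \<in> ?E" for \<zeta>
  proof -
    have "?G \<zeta> \<noteq> {0}" "0 \<in> ?G \<zeta>"
      using that eigenvalue_iff_generalized_eigenspace[OF A]
        complex_vector.subspace_0[OF subspace_generalized_eigenspace[OF A]] by auto
    then obtain v where v: "v \<in> ?G \<zeta>" "v \<noteq> 0" by blast
    have "complex_vector.independent {v}" using v(2) by simp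
    moreover have "{v} \<subseteq> ?G \<zeta>" using v(1) by simp
    moreover have "finite_cdim (?G \<zeta>)" using that finG by simp
    ultimately show ?thesis
      using independent_card_le_dim(2) by fastforce
  qed
  have "card F \<le> complex_vector.dim V" if F: "F \<subseteq> ?E" "finite F" for F
  proof -
    have "card F \<le> (\<Sum>\<zeta>\<in>F. complex_vector.dim (?G \<zeta>))"
      using sum_mono[of F "\<lambda>_. 1" "\<lambda>\<zeta>. complex_vector.dim (?G \<zeta>)"] dim_pos F by auto
    also have "\<dots> = complex_vector.dim (complex_vector.span (\<Union>\<zeta>\<in>F. ?G \<zeta>))"
      using F finG by (subst dim_span_generalized_eigenspaces[OF A]) auto
    also have "\<dots> \<le> complex_vector.dim V"
    proof (rule finite_cdim_injective(2)[OF _ _ _ _ fin])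
      show "clinear (\<lambda>x::'a. x)" by (simp add: clinear_iff)
      show "(\<lambda>x. x) ` complex_vector.span (\<Union>\<zeta>\<in>F. ?G \<zeta>) \<subseteq> V"
        unfolding V using F(1) by (simp, intro complex_vector.span_mono) auto
    qed (auto simp: complex_vector.subspace_span)
    finally show ?thesis .
  qed
  then have finE: "finite ?E" using finite_if_finite_subsets_card_bdd[of ?E] by blast
  have "V = complex_vector.span (\<Union>\<zeta>\<in>?E. ?G \<zeta>)"
    unfolding V
  proof (rule antisym)
    have "(\<Union>\<zeta>\<in>U. ?G \<zeta>) \<subseteq> insert 0 (\<Union>\<zeta>\<in>?E. ?G \<zeta>)"
      by (auto simp: eigenvalue_iff_generalized_eigenspace[OF A])
    then show "complex_vector.span (\<Union>\<zeta>\<in>U. ?G \<zeta>) \<subseteq> complex_vector.span (\<Union>\<zeta>\<in>?E. ?G \<zeta>)"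
      using complex_vector.span_mono complex_vector.span_insert_0 by blast
    show "complex_vector.span (\<Union>\<zeta>\<in>?E. ?G \<zeta>) \<subseteq> complex_vector.span (\<Union>\<zeta>\<in>U. ?G \<zeta>)"
      by (intro complex_vector.span_mono) auto
  qed
  then have "complex_vector.dim V = (\<Sum>\<zeta>\<in>?E. complex_vector.dim (?G \<zeta>))"
    using dim_span_generalized_eigenspaces[OF A finE] finG by simp
  moreover have "(\<Sum>\<zeta>\<in>?E. algebraic_multiplicity A \<zeta>) = (\<Sum>\<zeta>\<in>?E. enat (complex_vector.dim (?G \<zeta>)))"
    using finG by (intro sum.cong) (auto simp: algebraic_multiplicity_def cdim_def)
  moreover have "(\<Sum>\<zeta>\<in>E. enat (f \<zeta>)) = enat (\<Sum>\<zeta>\<in>E. f \<zeta>)" if "finite E" for f :: "complex \<Rightarrow> nat" and E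
    using that by (induction E) (auto simp: zero_enat_def)
  ultimately show ?thesis using finE by (simp add: eigenvalue_count_def)
qed

section \<open>Contour integrals of vector-valued functions\<close>

lemma bounded_bilinear_scaleC:
  "bounded_bilinear (scaleC :: complex \<Rightarrow> 'a \<Rightarrow> 'a::complex_normed_vector)"
proof
  fix r :: real and c d :: complex and x y :: 'a
  show "(c + d) *\<^sub>C x = c *\<^sub>C x + d *\<^sub>C x" "c *\<^sub>C (x + y) = c *\<^sub>C x + c *\<^sub>C y"
    by (simp_all add: scaleC_algebra)
  show "(r *\<^sub>R c) *\<^sub>C x = r *\<^sub>R c *\<^sub>C x" "c *\<^sub>C r *\<^sub>R x = r *\<^sub>R c *\<^sub>C x"
    by (simp_all add: scaleR_scaleC scaleC_scaleC scaleR_conv_of_real mult.commute)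
  show "\<exists>K. \<forall>(c::complex) (x::'a). norm (c *\<^sub>C x) \<le> norm c * norm x * K"
    by (rule exI[of _ 1]) (simp add: norm_scaleC)
qed

text \<open>Induction along a finite partition: a property that passes from each point to its successor
  holds at every point.\<close>

lemma partition_induct:
  fixes t :: "'a::linorder"
  assumes T: "finite T" "\<And>s. s \<in> T \<Longrightarrow> a \<le> s" and base: "P a"
    and step: "\<And>s t. s \<in> T \<Longrightarrow> t \<in> T \<Longrightarrow> s < t \<Longrightarrow> {s<..<t} \<inter> T = {} \<Longrightarrow> P s \<Longrightarrow> P t"
    and "t \<in> T" "a \<in> T"
  shows "P t"
  using \<open>t \<in> T\<close>
proof (induction "card {s\<in>T. s < t}" arbitrary: t rule: less_induct)
  case less
  let ?S = "{s\<in>T. s < t}"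
  show ?case
  proof (cases "t = a")
    case False
    then have "a \<in> ?S" using T(2)[OF less.prems] \<open>a \<in> T\<close> by auto
    then have "?S \<noteq> {}" by blast
    then have s: "Max ?S \<in> ?S" using T(1) by (intro Max_in) auto
    let ?s = "Max ?S"
    have "{s\<in>T. s < ?s} \<subset> ?S" using s by auto
    then have "card {s\<in>T. s < ?s} < card ?S" using T(1) by (intro psubset_card_mono) auto
    then have "P ?s" using s by (intro less.hyps) auto
    moreover have "x \<le> ?s" if "x \<in> T" "x < t" for x
      using T(1) that by (intro Max_ge) auto
    then have "{?s<..<t} \<inter> T = {}" by fastforce
    ultimately show ?thesis using step[of ?s t] s less.prems by blast
  qed (simp add: base)
qed

abbreviation velocity :: "(real \<Rightarrow> complex) \<Rightarrow> real \<Rightarrow> complex"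
  where "velocity \<gamma> t \<equiv> vector_derivative \<gamma> (at t within {0..1})"

text \<open>A partition of \<open>[0,1]\<close> as in \<^const>\<open>piecewise_C1_path\<close>, with the derivative in the open pieces
  expressed through the two-sided derivative and through the velocity that occurs in contour
  integrals.\<close>

definition C1_partition :: "(real \<Rightarrow> complex) \<Rightarrow> real set \<Rightarrow> bool"
  where "C1_partition \<gamma> T \<longleftrightarrow> finite T \<and> {0, 1} \<subseteq> T \<and> T \<subseteq> {0..1} \<and>
      (\<forall>s\<in>T. \<forall>t\<in>T. s < t \<and> {s<..<t} \<inter> T = {} \<longrightarrow>
        (\<exists>\<gamma>'. continuous_on {s..t} \<gamma>' \<and>
          (\<forall>x\<in>{s<..<t}. (\<gamma> has_vector_derivative \<gamma>' x) (at x) \<and> velocity \<gamma> x = \<gamma>' x)))"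

lemma piecewise_C1_path_partition:
  assumes "piecewise_C1_path \<gamma>"
  obtains T where "C1_partition \<gamma> T"
proof -
  obtain T where T: "finite T" "{0, 1} \<subseteq> T" "T \<subseteq> {0..1}"
    and pieces: "\<forall>s\<in>T. \<forall>t\<in>T. s < t \<and> {s<..<t} \<inter> T = {} \<longrightarrow>
        (\<exists>\<gamma>'. continuous_on {s..t} \<gamma>' \<and>
          (\<forall>x\<in>{s..t}. (\<gamma> has_vector_derivative \<gamma>' x) (at x within {s..t})))"
    using assms unfolding piecewise_C1_path_def by (elim exE conjE) (rule that; assumption)
  have "\<exists>\<gamma>'. continuous_on {s..t} \<gamma>' \<and>
      (\<forall>x\<in>{s<..<t}. (\<gamma> has_vector_derivative \<gamma>' x) (at x) \<and> velocity \<gamma> x = \<gamma>' x)"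
    if st: "s \<in> T" "t \<in> T" "s < t" "{s<..<t} \<inter> T = {}" for s t
  proof -
    obtain \<gamma>' where \<gamma>': "continuous_on {s..t} \<gamma>'"
      "\<And>x. x \<in> {s..t} \<Longrightarrow> (\<gamma> has_vector_derivative \<gamma>' x) (at x within {s..t})"
      using pieces[THEN bspec, OF st(1), THEN bspec, OF st(2), THEN mp, OF conjI[OF st(3,4)]] by (elim exE conjE) (rule that, auto)
    have der: "(\<gamma> has_vector_derivative \<gamma>' x) (at x)" if "x \<in> {s<..<t}" for x
      using \<gamma>'(2)[of x] that by (simp add: at_within_Icc_at)
    moreover have "velocity \<gamma> x = \<gamma>' x" if "x \<in> {s<..<t}" for x
      by (rule vector_derivative_at_within_ivl[OF der[OF that]]) (use that st T in auto)
    ultimately show ?thesis using \<gamma>'(1) by blast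
  qed
  then have "C1_partition \<gamma> T"
    unfolding C1_partition_def using T by (intro conjI ballI impI) simp_all
  then show ?thesis by (rule that)
qed

lemma C1_partition_piece:
  assumes "C1_partition \<gamma> T" "s \<in> T" "t \<in> T" "s < t" "{s<..<t} \<inter> T = {}"
  obtains \<gamma>' where "continuous_on {s..t} \<gamma>'"
    "\<And>x. x \<in> {s<..<t} \<Longrightarrow> (\<gamma> has_vector_derivative \<gamma>' x) (at x)"
    "\<And>x. x \<in> {s<..<t} \<Longrightarrow> velocity \<gamma> x = \<gamma>' x"
proof -
  have "\<exists>\<gamma>'. continuous_on {s..t} \<gamma>' \<and>
      (\<forall>x\<in>{s<..<t}. (\<gamma> has_vector_derivative \<gamma>' x) (at x) \<and> velocity \<gamma> x = \<gamma>' x)"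
    using assms unfolding C1_partition_def by simp
  then show ?thesis by (elim exE conjE) (rule that, assumption, drule (1) bspec, simp, drule (1) bspec, simp)
qed

lemma C1_partition_velocity_bounded:
  assumes "C1_partition \<gamma> T"
  obtains B where "\<And>x. x \<in> {0..1} \<Longrightarrow> norm (velocity \<gamma> x) \<le> B"
    "\<And>x. x \<in> {0..1} \<Longrightarrow> norm (vector_derivative \<gamma> (at x)) \<le> B"
proof -
  have T: "finite T" "{0, 1} \<subseteq> T" "T \<subseteq> {0..1}" using assms by (auto simp: C1_partition_def)
  let ?f = "\<lambda>x. norm (velocity \<gamma> x) + norm (vector_derivative \<gamma> (at x))"
  have "\<exists>B. \<forall>x\<in>{0..t}. ?f x \<le> B" if "t \<in> T" for t
  proof (rule partition_induct[OF T(1) _ _ _ that])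
    show "\<exists>B. \<forall>x\<in>{0..0}. ?f x \<le> B" by auto
  next
    fix s t assume st: "s \<in> T" "t \<in> T" "s < t" "{s<..<t} \<inter> T = {}"
      and "\<exists>B. \<forall>x\<in>{0..s}. ?f x \<le> B"
    then obtain B where B: "\<And>x. x \<in> {0..s} \<Longrightarrow> ?f x \<le> B" by blast
    obtain \<gamma>' where \<gamma>': "continuous_on {s..t} \<gamma>'" "\<And>x. x \<in> {s<..<t} \<Longrightarrow>
        (\<gamma> has_vector_derivative \<gamma>' x) (at x)"
      "\<And>x. x \<in> {s<..<t} \<Longrightarrow> velocity \<gamma> x = \<gamma>' x"
      by (rule C1_partition_piece[OF assms st]) (rule that)
    have "bounded (\<gamma>' ` {s..t})"
      by (intro compact_imp_bounded compact_continuous_image \<gamma>') simp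
    then obtain C where C: "\<And>x. x \<in> {s..t} \<Longrightarrow> norm (\<gamma>' x) \<le> C"
      unfolding bounded_iff by blast
    have "?f x \<le> max B (max (2 * C) (?f t))" if "x \<in> {0..t}" for x
    proof -
      from that consider "x \<in> {0..s}" | "x \<in> {s<..<t}" | "x = t"
        by (cases "x \<le> s"; cases "x = t") auto
      then show ?thesis
      proof cases
        case 2
        then have "velocity \<gamma> x = \<gamma>' x" "vector_derivative \<gamma> (at x) = \<gamma>' x" "norm (\<gamma>' x) \<le> C"
          using \<gamma>'(2,3) C[of x] by (auto intro: vector_derivative_at)
        then show ?thesis by simp
      qed (use B in \<open>auto simp: le_max_iff_disj\<close>)
    qed
    then show "\<exists>B. \<forall>x\<in>{0..t}. ?f x \<le> B" by blast
  qed (use T in auto)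
  moreover have "1 \<in> T" using T(2) by simp
  ultimately obtain B where B: "\<And>x. x \<in> {0..1} \<Longrightarrow> ?f x \<le> B" by blast
  have "norm (velocity \<gamma> x) \<le> B" "norm (vector_derivative \<gamma> (at x)) \<le> B" if "x \<in> {0..1}" for x
    using B[OF that] norm_ge_zero[of "velocity \<gamma> x"] norm_ge_zero[of "vector_derivative \<gamma> (at x)"]
    by linarith+
  then show ?thesis by (rule that)
qed

lemma C1_partition_neighbours:
  assumes "C1_partition \<gamma> T" "x \<in> {0..1} - T"
  obtains s t where "s \<in> T" "t \<in> T" "s < x" "x < t" "{s<..<t} \<inter> T = {}"
proof -
  have T: "finite T" "{0, 1} \<subseteq> T" using assms by (auto simp: C1_partition_def)
  define s t where "s = Max {y\<in>T. y < x}" and "t = Min {y\<in>T. x < y}"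
  have x: "0 < x" "x < 1" using assms(2) T(2) by (auto simp: less_le)
  then have ne: "{y\<in>T. y < x} \<noteq> {}" "{y\<in>T. x < y} \<noteq> {}" using T(2) by auto
  have s: "s \<in> {y\<in>T. y < x}" unfolding s_def using T(1) ne(1) by (intro Max_in) auto
  have t: "t \<in> {y\<in>T. x < y}" unfolding t_def using T(1) ne(2) by (intro Min_in) auto
  have 1: "y \<le> s" if "y \<in> T" "y < x" for y
    unfolding s_def using T(1) that by (intro Max_ge) auto
  have 2: "t \<le> y" if "y \<in> T" "x < y" for y
    unfolding t_def using T(1) that by (intro Min_le) auto
  have False if "y \<in> T" "s < y" "y < t" for y
    using that 1[of y] 2[of y] assms(2) by (cases y x rule: linorder_cases) auto
  then have "{s<..<t} \<inter> T = {}" by auto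
  with s t show ?thesis by (intro that) auto
qed

lemma C1_partition_valid_path:
  assumes T: "C1_partition \<gamma> T" and "path \<gamma>"
  shows "valid_path \<gamma>"
proof -
  let ?D = "\<lambda>x. vector_derivative \<gamma> (at x)"
  have *: "(\<gamma> has_vector_derivative ?D x) (at x) \<and> isCont ?D x" if x: "x \<in> {0..1} - T" for x
  proof -
    obtain s t where st: "s \<in> T" "t \<in> T" "s < x" "x < t" "{s<..<t} \<inter> T = {}"
      using C1_partition_neighbours[OF T x] .
    have "s < t" using st by simp
    obtain \<gamma>' where \<gamma>': "continuous_on {s..t} \<gamma>'" "\<And>y. y \<in> {s<..<t} \<Longrightarrow>
        (\<gamma> has_vector_derivative \<gamma>' y) (at y)"
      by (rule C1_partition_piece[OF T st(1,2) \<open>s < t\<close> st(5)]) (rule that)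
    then have D: "?D y = \<gamma>' y" if "y \<in> {s<..<t}" for y
      using that by (auto intro: vector_derivative_at)
    have "continuous_on {s<..<t} \<gamma>'" by (rule continuous_on_subset[OF \<gamma>'(1)]) auto
    then have "isCont \<gamma>' x" using st by (simp add: continuous_on_eq_continuous_at)
    moreover have "eventually (\<lambda>y. ?D y = \<gamma>' y) (nhds x)"
      using eventually_nhds_in_open[of "{s<..<t}" x] st D by (auto elim: eventually_mono)
    ultimately have "isCont ?D x" using isCont_cong[of ?D \<gamma>' x] by simp
    moreover have "(\<gamma> has_vector_derivative ?D x) (at x)" using \<gamma>'(2)[of x] D[of x] st by auto
    ultimately show ?thesis by blast
  qed
  have "\<gamma> C1_differentiable_on ({0..1} - T)"
    unfolding C1_differentiable_on_def
    using * by (intro exI[of _ ?D]) (auto intro!: continuous_at_imp_continuous_on)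
  moreover have "finite T" using T by (simp add: C1_partition_def)
  ultimately show ?thesis
    using \<open>path \<gamma>\<close> by (auto simp: valid_path_def piecewise_C1_differentiable_on_def path_def)
qed

text \<open>The contours over which vector-valued functions are integrated: piecewise \<open>C\<^sup>1\<close> paths,
  with their continuity recorded separately.\<close>

definition C1_contour :: "(real \<Rightarrow> complex) \<Rightarrow> bool"
  where "C1_contour \<gamma> \<longleftrightarrow> piecewise_C1_path \<gamma> \<and> path \<gamma>"

text \<open>The bound on the speed takes the place of the length in the standard estimate of an integral.\<close>

definition max_speed :: "(real \<Rightarrow> complex) \<Rightarrow> real"
  where "max_speed \<gamma> = (SUP t\<in>{0..1}. cmod (velocity \<gamma> t))"

lemma C1_contour_valid_path: "C1_contour \<gamma> \<Longrightarrow> valid_path \<gamma>"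
  unfolding C1_contour_def by (metis piecewise_C1_path_partition C1_partition_valid_path)

lemma velocity_le_max_speed:
  assumes "C1_contour \<gamma>" "t \<in> {0..1}"
  shows "cmod (velocity \<gamma> t) \<le> max_speed \<gamma>"
proof -
  obtain T where "C1_partition \<gamma> T"
    using assms by (auto simp: C1_contour_def elim: piecewise_C1_path_partition)
  then obtain B where "\<And>x. x \<in> {0..1} \<Longrightarrow> norm (velocity \<gamma> x) \<le> B"
    by (rule C1_partition_velocity_bounded) blast
  then show ?thesis
    unfolding max_speed_def using assms(2) by (intro cSUP_upper bdd_aboveI2[of _ _ B]) auto
qed

lemma max_speed_nonneg: "C1_contour \<gamma> \<Longrightarrow> 0 \<le> max_speed \<gamma>"
  using velocity_le_max_speed[of \<gamma> 0] norm_ge_zero[of "velocity \<gamma> 0"] by (simp del: norm_ge_zero)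

lemma vector_contour_integrable:
  fixes F :: "complex \<Rightarrow> 'a::complex_banach"
  assumes \<gamma>: "C1_contour \<gamma>" and F: "continuous_on (path_image \<gamma>) F"
  shows "(\<lambda>t. velocity \<gamma> t *\<^sub>C F (\<gamma> t)) integrable_on {0..1}"
proof -
  obtain T where par: "C1_partition \<gamma> T"
    using \<gamma> by (auto simp: C1_contour_def elim: piecewise_C1_path_partition)
  then have T: "finite T" "{0, 1} \<subseteq> T" "T \<subseteq> {0..1}" by (auto simp: C1_partition_def)
  have "continuous_on {0..1} \<gamma>" using \<gamma> by (simp add: C1_contour_def path_def)
  then have cont: "continuous_on {0..1} (\<lambda>t. F (\<gamma> t))"
    using F by (intro continuous_on_compose2[OF F]) (auto simp: path_image_def)
  have "(\<lambda>t. velocity \<gamma> t *\<^sub>C F (\<gamma> t)) integrable_on {0..t}" if "t \<in> T" for t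
  proof (rule partition_induct[OF T(1) _ _ _ that])
    show "(\<lambda>t. velocity \<gamma> t *\<^sub>C F (\<gamma> t)) integrable_on {0..0}"
      using integrable_on_refl[of _ 0] by (simp add: box_real)
  next
    fix s t assume st: "s \<in> T" "t \<in> T" "s < t" "{s<..<t} \<inter> T = {}"
      and IH: "(\<lambda>t. velocity \<gamma> t *\<^sub>C F (\<gamma> t)) integrable_on {0..s}"
    obtain \<gamma>' where \<gamma>': "continuous_on {s..t} \<gamma>'" "\<And>x. x \<in> {s<..<t} \<Longrightarrow> velocity \<gamma> x = \<gamma>' x"
      by (rule C1_partition_piece[OF par st]) (rule that)
    have "{s..t} \<subseteq> {0..1}" using st T by auto
    then have "continuous_on {s..t} (\<lambda>x. \<gamma>' x *\<^sub>C F (\<gamma> x))"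
      by (intro bounded_bilinear.continuous_on[OF bounded_bilinear_scaleC] \<gamma>'
          continuous_on_subset[OF cont])
    then have "(\<lambda>x. \<gamma>' x *\<^sub>C F (\<gamma> x)) integrable_on {s..t}"
      by (rule integrable_continuous_real)
    then have "(\<lambda>x. velocity \<gamma> x *\<^sub>C F (\<gamma> x)) integrable_on {s..t}"
      by (rule integrable_spike_finite[of "{s, t}", rotated 2]) (use \<gamma>'(2) in auto)
    with IH show "(\<lambda>t. velocity \<gamma> t *\<^sub>C F (\<gamma> t)) integrable_on {0..t}"
      using st T by (intro Henstock_Kurzweil_Integration.integrable_combine[where a = 0 and c = s and b = t]) auto
  qed (use T in auto)
  with T(2) show ?thesis by auto
qed

lemma vector_contour_integral_bound:
  fixes F :: "complex \<Rightarrow> 'a::complex_banach"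
  assumes \<gamma>: "C1_contour \<gamma>" and F: "continuous_on (path_image \<gamma>) F"
    and M: "\<And>z. z \<in> path_image \<gamma> \<Longrightarrow> norm (F z) \<le> M"
  shows "norm (vector_contour_integral \<gamma> F) \<le> max_speed \<gamma> * M"
proof -
  have "\<gamma> 0 \<in> path_image \<gamma>" by (auto simp: path_image_def)
  then have "0 \<le> M" by (rule order_trans[OF norm_ge_zero M])
  have "norm (vector_contour_integral \<gamma> F) \<le> (max_speed \<gamma> * M) * measure lborel {0..1::real}"
    unfolding vector_contour_integral_def
  proof (rule has_integral_bound_real[OF _ finite.emptyI])
    show "0 \<le> max_speed \<gamma> * M" using max_speed_nonneg[OF \<gamma>] \<open>0 \<le> M\<close> by simp
    show "((\<lambda>t. velocity \<gamma> t *\<^sub>C F (\<gamma> t)) has_integral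
        integral {0..1} (\<lambda>t. velocity \<gamma> t *\<^sub>C F (\<gamma> t))) {0..1}"
      using vector_contour_integrable[OF \<gamma> F] by (rule integrable_integral)
    show "norm (velocity \<gamma> t *\<^sub>C F (\<gamma> t)) \<le> max_speed \<gamma> * M" if "t \<in> {0..1} - {}" for t
      using that velocity_le_max_speed[OF \<gamma>] max_speed_nonneg[OF \<gamma>]
      by (auto simp: norm_scaleC path_image_def intro!: mult_mono M)
  qed
  then show ?thesis by simp
qed

lemma vector_contour_integral_cong:
  "(\<And>z. z \<in> path_image \<gamma> \<Longrightarrow> F z = G z) \<Longrightarrow>
    vector_contour_integral \<gamma> F = vector_contour_integral \<gamma> G"
  unfolding vector_contour_integral_def by (rule integral_cong) (auto simp: path_image_def)

lemma vector_contour_integral_linear: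
  fixes F :: "complex \<Rightarrow> 'a::complex_banach" and h :: "'a \<Rightarrow> 'b::complex_banach"
  assumes "C1_contour \<gamma>" "continuous_on (path_image \<gamma>) F"
    and h: "bounded_linear h" "\<And>c x. h (c *\<^sub>C x) = c *\<^sub>C h x"
  shows "h (vector_contour_integral \<gamma> F) = vector_contour_integral \<gamma> (\<lambda>z. h (F z))"
  using integral_linear[OF vector_contour_integrable[OF assms(1,2)] h(1)]
  by (simp add: vector_contour_integral_def comp_def h(2))

lemma vector_contour_integral_diff:
  fixes F G :: "complex \<Rightarrow> 'a::complex_banach"
  assumes "C1_contour \<gamma>" "continuous_on (path_image \<gamma>) F" "continuous_on (path_image \<gamma>) G"
  shows "vector_contour_integral \<gamma> (\<lambda>z. F z - G z) =
    vector_contour_integral \<gamma> F - vector_contour_integral \<gamma> G"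
  using integral_diff[OF vector_contour_integrable[OF assms(1,2)] vector_contour_integrable[OF assms(1,3)]]
  by (simp add: vector_contour_integral_def scaleC_algebra)

lemma vector_contour_integral_functional:
  fixes F :: "complex \<Rightarrow> 'a::complex_banach"
  assumes \<gamma>: "C1_contour \<gamma>" "continuous_on (path_image \<gamma>) F" and \<phi>: "cfunctional \<phi>"
  shows "((\<lambda>z. \<phi> (F z)) has_contour_integral \<phi> (vector_contour_integral \<gamma> F)) \<gamma>"
proof -
  have "bounded_linear \<phi>" "\<And>c x. \<phi> (c *\<^sub>C x) = c * \<phi> x" using \<phi> by (auto simp: cfunctional_def)
  with has_integral_linear[OF integrable_integral[OF vector_contour_integrable[OF \<gamma>]], of \<phi>]
  show ?thesis
    by (simp add: vector_contour_integral_def has_contour_integral_def comp_def mult.commute)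
qed

lemma vector_contour_integral_scalar:
  fixes x :: "'a::complex_banach"
  assumes "(f has_contour_integral i) \<gamma>"
  shows "vector_contour_integral \<gamma> (\<lambda>z. f z *\<^sub>C x) = i *\<^sub>C x"
proof -
  have "bounded_linear (\<lambda>c. c *\<^sub>C x)"
    by (rule bounded_bilinear.bounded_linear_left[OF bounded_bilinear_scaleC])
  from has_integral_linear[OF assms[unfolded has_contour_integral_def] this]
  show ?thesis
    by (simp add: vector_contour_integral_def comp_def scaleC_scaleC mult.commute integral_unique)
qed

section \<open>Jordan domains\<close>

lemma jordan_domain_contour: "jordan_domain U \<gamma> \<Longrightarrow> C1_contour \<gamma>"
  by (simp add: jordan_domain_def C1_contour_def simple_path_imp_path)

lemma jordan_domain_path_image: "jordan_domain U \<gamma> \<Longrightarrow> path_image \<gamma> = frontier U"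
  by (simp add: jordan_domain_def)

text \<open>\<open>U\<close> contains the inside of its boundary curve: a point of \<open>U\<close> lies inside, since its winding number
  is not zero, and the inside is connected and does not meet the frontier of \<open>U\<close>.\<close>

lemma jordan_domain_winding_outside:
  assumes J: "jordan_domain U \<gamma>" and z: "z \<notin> closure U"
  shows "winding_number \<gamma> z = 0"
proof -
  have \<gamma>: "simple_path \<gamma>" "pathfinish \<gamma> = pathstart \<gamma>" "path_image \<gamma> = frontier U" "U \<noteq> {}" "open U"
    "\<And>z. z \<in> U \<Longrightarrow> winding_number \<gamma> z = 1"
    using J by (auto simp: jordan_domain_def)
  note jordan = Jordan_inside_outside[OF \<gamma>(1,2)]
  have disj: "U \<inter> path_image \<gamma> = {}" using \<gamma>(3,5) by (auto simp: frontier_def interior_open)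
  have out0: "winding_number \<gamma> w = 0" if "w \<in> outside (path_image \<gamma>)" for w
    by (rule winding_number_zero_in_outside[OF simple_path_imp_path[OF \<gamma>(1)] \<gamma>(2) that])
  obtain u where u: "u \<in> U" using \<gamma>(4) by blast
  have "u \<in> inside (path_image \<gamma>)"
  proof (rule ccontr)
    assume "u \<notin> inside (path_image \<gamma>)"
    moreover have "u \<notin> path_image \<gamma>" using u disj by blast
    ultimately have "u \<in> outside (path_image \<gamma>)" using inside_Un_outside by blast
    then show False using out0 \<gamma>(6)[OF u] by simp
  qed
  moreover have "inside (path_image \<gamma>) \<inter> frontier U = {}" using \<gamma>(3) inside_no_overlap by blast
  moreover have "connected (inside (path_image \<gamma>))" using jordan by blast
  ultimately have "inside (path_image \<gamma>) \<subseteq> U"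
    using connected_Int_frontier[of "inside (path_image \<gamma>)" U] u by blast
  then have "z \<notin> inside (path_image \<gamma>)" using z closure_subset by blast
  moreover have "z \<notin> path_image \<gamma>" using z \<gamma>(3) frontier_subset_closed[of "closure U"]
    by (auto simp: frontier_def)
  ultimately show ?thesis using out0 inside_Un_outside by blast
qed

lemma jordan_domain_frontier:
  assumes "jordan_domain U \<gamma>"
  shows "frontier U \<noteq> {}" "compact (frontier U)" "U \<inter> frontier U = {}" "closure U = U \<union> frontier U"
proof -
  have *: "bounded U" "open U" "path_image \<gamma> = frontier U" using assms by (auto simp: jordan_domain_def)
  show "frontier U \<noteq> {}" using path_image_nonempty[of \<gamma>] *(3) by simp
  show "compact (frontier U)" using *(1) by (rule compact_frontier_bounded)
  show "U \<inter> frontier U = {}" "closure U = U \<union> frontier U"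
    using *(2) closure_subset[of U] by (auto simp: frontier_def interior_open)
qed

lemma jordan_domain_Cauchy:
  assumes J: "jordan_domain U \<gamma>" and S: "open S" "closure U \<subseteq> S" and f: "f holomorphic_on S"
  shows "(f has_contour_integral 0) \<gamma>"
proof (rule Cauchy_theorem_global[OF S(1) f])
  show "valid_path \<gamma>" using J by (intro C1_contour_valid_path jordan_domain_contour)
  show "pathfinish \<gamma> = pathstart \<gamma>" using J by (simp add: jordan_domain_def)
  show "path_image \<gamma> \<subseteq> S"
    using S(2) jordan_domain_frontier(4)[OF J] jordan_domain_path_image[OF J] by blast
  show "winding_number \<gamma> w = 0" if "w \<notin> S" for w
    using S(2) that by (intro jordan_domain_winding_outside[OF J]) blast
qed

lemma jordan_domain_simple_pole:
  assumes J: "jordan_domain U \<gamma>" and w: "w \<in> U"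
  shows "((\<lambda>z. 1 / (z - w)) has_contour_integral (2 * complex_of_real pi * \<i>)) \<gamma>"
proof -
  have "w \<notin> path_image \<gamma>"
    using jordan_domain_frontier(3)[OF J] jordan_domain_path_image[OF J] w by blast
  then have "((\<lambda>z. 1 / (z - w)) has_contour_integral (2 * complex_of_real pi * \<i> * winding_number \<gamma> w)) \<gamma>"
    using has_contour_integral_winding_number[OF C1_contour_valid_path[OF jordan_domain_contour[OF J]]]
    by simp
  moreover have "winding_number \<gamma> w = 1" using J w by (simp add: jordan_domain_def)
  ultimately show ?thesis by simp
qed

section \<open>Resolvents\<close>

lemma blinfun_apply_scaleC [simp]: "blinfun_apply (c *\<^sub>C A) x = c *\<^sub>C A x"
  by (simp add: scaleC_blinfun.rep_eq)

lemma norm_blinfun_compose_apply: "norm (A (B x)) \<le> norm A * (norm B * norm x)"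
  for A :: "'b::real_normed_vector \<Rightarrow>\<^sub>L 'c::real_normed_vector" and B :: "'a::real_normed_vector \<Rightarrow>\<^sub>L 'b"
  by (rule order_trans[OF norm_blinfun]) (simp add: mult_left_mono norm_blinfun)

lemma blinfun_apply_shift: "blinfun_apply (z *\<^sub>C id_blinfun - A) u = shift A z u"
  by (simp add: shift_def blinfun.diff_left)

lemma shift_diff_right: "shift A z (u - v) = shift A z u - shift A z v"
  unfolding blinfun_apply_shift[symmetric] by (rule blinfun.diff_right)

lemma shift_diff_point: "shift A w u - shift A z u = (w - z) *\<^sub>C u"
  by (simp add: shift_def scaleC_algebra)

lemma is_resolvent_iff:
  "is_resolvent A z R \<longleftrightarrow> (\<forall>u. shift A z (R u) = u) \<and> (\<forall>u. R (shift A z u) = u)"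
  by (simp add: is_resolvent_def blinfun_apply_inject[symmetric] fun_eq_iff blinfun_apply_shift)

lemma resolvent_eqI: "is_resolvent A z R \<Longrightarrow> resolvent A z = R"
  unfolding resolvent_def
proof (rule the_equality)
  fix R' assume "is_resolvent A z R" "is_resolvent A z R'"
  then have "R' u = R u" for u unfolding is_resolvent_iff by metis
  then show "R' = R" by (rule blinfun_eqI)
qed

lemma resolvent_cancel:
  assumes "z \<in> resolvent_set A"
  shows "shift A z (resolvent A z u) = u" "resolvent A z (shift A z u) = u"
proof -
  obtain R where R: "is_resolvent A z R" using assms by (auto simp: resolvent_set_def)
  then have "resolvent A z = R" by (rule resolvent_eqI)
  with R show "shift A z (resolvent A z u) = u" "resolvent A z (shift A z u) = u"
    by (simp_all add: is_resolvent_iff)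
qed

lemma shift_surj: "z \<in> resolvent_set A \<Longrightarrow> surj (shift A z)"
  using resolvent_cancel(1) by (metis surjI)

lemma resolvent_setI:
  fixes A :: "'a::complex_banach \<Rightarrow>\<^sub>L 'a"
  assumes surj: "surj (shift A z)" and c: "0 < c" "\<And>u. c * norm u \<le> norm (shift A z u)"
  shows "z \<in> resolvent_set A" "norm (resolvent A z) \<le> 1 / c"
proof -
  have inj: "inj (shift A z)"
  proof (rule injI)
    fix u v assume "shift A z u = shift A z v"
    then have "c * norm (u - v) \<le> 0" using c(2)[of "u - v"] by (simp add: shift_diff_right)
    then show "u = v" using c(1) by (simp add: mult_le_0_iff)
  qed
  define S where "S = inv (shift A z)"
  have S: "shift A z (S u) = u" "S (shift A z u) = u" for u
    unfolding S_def using surj inj by (simp_all add: surj_f_inv_f inv_f_f)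
  have bound: "norm (S u) \<le> norm u * (1 / c)" for u
    using c(2)[of "S u"] c(1) S(1) by (simp add: field_simps)
  have "bounded_linear S"
  proof (rule bounded_linear_intro[OF _ _ bound])
    have "shift A z (x + y) = shift A z x + shift A z y" for x y
      unfolding blinfun_apply_shift[symmetric] by (rule blinfun.add_right)
    then show "S (x + y) = S x + S y" for x y by (metis S)
    have "shift A z (r *\<^sub>R x) = r *\<^sub>R shift A z x" for r x
      unfolding blinfun_apply_shift[symmetric] by (rule blinfun.scaleR_right)
    then show "S (r *\<^sub>R x) = r *\<^sub>R S x" for r x by (metis S)
  qed
  then have "is_resolvent A z (Blinfun S)"
    by (simp add: is_resolvent_iff bounded_linear_Blinfun_apply S)
  then have R: "z \<in> resolvent_set A" "resolvent A z = Blinfun S"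
    by (auto simp: resolvent_set_def resolvent_eqI)
  then show "z \<in> resolvent_set A" by simp
  show "norm (resolvent A z) \<le> 1 / c"
    unfolding R(2) using bound c(1) \<open>bounded_linear S\<close>
    by (intro norm_blinfun_bound) (simp_all add: bounded_linear_Blinfun_apply mult.commute)
qed

lemma resolvent_bounded_below:
  assumes "z \<in> resolvent_set A"
  shows "norm u \<le> norm (resolvent A z) * norm (shift A z u)"
  using norm_blinfun[of "resolvent A z" "shift A z u"] by (simp add: resolvent_cancel(2)[OF assms])

text \<open>Surjectivity is stable under perturbations smaller than the lower bound; the solution of the
  perturbed equation is a fixed point of a contraction.\<close>

lemma shift_surj_perturb:
  fixes A B :: "'a::complex_banach \<Rightarrow>\<^sub>L 'a"
  assumes surj: "surj (shift A z)" and c: "0 < c" "\<And>u. c * norm u \<le> norm (shift A z u)"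
    and AB: "norm (A - B) < c"
  shows "surj (shift B z)"
proof -
  note z = resolvent_setI[OF surj c]
  let ?R = "resolvent A z"
  have "\<exists>u. shift B z u = f" for f
  proof -
    define F where "F u = ?R (f - (A - B) u)" for u
    have "\<exists>!u. F u = u"
    proof (rule banach_fix_type)
      show "0 \<le> norm (A - B) / c" "norm (A - B) / c < 1" using c(1) AB by auto
      show "\<forall>u v. dist (F u) (F v) \<le> norm (A - B) / c * dist u v"
      proof (intro allI)
        fix u v
        have "F u - F v = ?R ((A - B) (v - u))"
          by (simp add: F_def blinfun.diff_right)
        then have "dist (F u) (F v) \<le> norm ?R * (norm (A - B) * norm (v - u))"
          by (metis dist_norm norm_blinfun_compose_apply)
        also have "\<dots> \<le> (1 / c) * (norm (A - B) * norm (v - u))"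
          using z(2) by (intro mult_right_mono) auto
        finally show "dist (F u) (F v) \<le> norm (A - B) / c * dist u v"
          by (simp add: dist_norm norm_minus_commute)
      qed
    qed
    then obtain u where u: "F u = u" by blast
    have "shift A z u = f - (A - B) u"
      using resolvent_cancel(1)[OF z(1), of "f - (A - B) u"] u by (simp add: F_def)
    then have "shift B z u = f" by (simp add: shift_def blinfun.diff_left algebra_simps)
    then show ?thesis ..
  qed
  then show ?thesis by (metis surj_def)
qed

lemma resolvent_nearby:
  fixes A :: "'a::complex_banach \<Rightarrow>\<^sub>L 'a"
  assumes z: "z \<in> resolvent_set A"
  obtains e C where "0 < e" "\<And>w. dist w z < e \<Longrightarrow> w \<in> resolvent_set A \<and> norm (resolvent A w) \<le> C"
proof -
  define c where "c = 1 / (norm (resolvent A z) + 1)"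
  have c: "0 < c" by (simp add: c_def add_nonneg_pos)
  have low: "c * norm u \<le> norm (shift A z u)" for u
  proof -
    have "norm u \<le> (norm (resolvent A z) + 1) * norm (shift A z u)"
      using resolvent_bounded_below[OF z, of u] norm_ge_zero[of "shift A z u"]
      unfolding distrib_right by linarith
    moreover have "0 < norm (resolvent A z) + 1" by (rule add_nonneg_pos) auto
    ultimately show ?thesis by (simp add: c_def pos_divide_le_eq mult.commute)
  qed
  have "w \<in> resolvent_set A \<and> norm (resolvent A w) \<le> 1 / (c / 2)" if w: "dist w z < c / 2" for w
  proof -
    define B where "B = A - (w - z) *\<^sub>C id_blinfun"
    have shiftB: "shift B z = shift A w"
      by (simp add: fun_eq_iff shift_def B_def blinfun.diff_left scaleC_algebra)
    have "norm (A - B) \<le> cmod (w - z) * 1"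
      using mult_left_mono[OF norm_blinfun_id_le, of "cmod (w - z)"] by (simp add: B_def norm_scaleC)
    also have "\<dots> < c" using w c by (simp add: dist_norm)
    finally have surj: "surj (shift A w)"
      using shift_surj_perturb[OF shift_surj[OF z] c low] shiftB by metis
    have "(c / 2) * norm u \<le> norm (shift A w u)" for u
    proof -
      have "norm (shift A z u) - norm (shift A w u) \<le> norm (shift A z u - shift A w u)"
        by (rule norm_triangle_ineq2)
      also have "\<dots> = cmod (z - w) * norm u" by (simp add: shift_diff_point norm_scaleC)
      also have "\<dots> \<le> (c / 2) * norm u"
        using w by (intro mult_right_mono) (auto simp: dist_norm norm_minus_commute)
      finally show ?thesis using low[of u] by (simp add: field_simps)
    qed
    then show ?thesis using resolvent_setI[OF surj, of "c / 2"] c by simp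
  qed
  then show ?thesis using c by (intro that[of "c / 2"]) auto
qed

lemma resolvent_set_open: "open (resolvent_set A)" for A :: "'a::complex_banach \<Rightarrow>\<^sub>L 'a"
  unfolding open_dist
proof
  fix z assume "z \<in> resolvent_set A"
  then show "\<exists>e>0. \<forall>w. dist w z < e \<longrightarrow> w \<in> resolvent_set A"
    by (rule resolvent_nearby) blast
qed

lemma clinear_resolvent:
  fixes A :: "'a::complex_banach \<Rightarrow>\<^sub>L 'a"
  assumes A: "clinear (blinfun_apply A)" and z: "z \<in> resolvent_set A"
  shows "clinear (blinfun_apply (resolvent A z))"
  unfolding clinear_iff
proof (intro conjI allI)
  show "resolvent A z (x + y) = resolvent A z x + resolvent A z y" for x y
    by (rule blinfun.add_right)
  show "resolvent A z (c *\<^sub>C x) = c *\<^sub>C resolvent A z x" for c x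
    using resolvent_cancel[OF z] clinear_scaleC[OF clinear_shift[OF A]] by metis
qed

lemma resolvent_identity:
  fixes A :: "'a::complex_banach \<Rightarrow>\<^sub>L 'a"
  assumes A: "clinear (blinfun_apply A)" and z: "z \<in> resolvent_set A" and w: "w \<in> resolvent_set A"
  shows "resolvent A z - resolvent A w = (w - z) *\<^sub>C (resolvent A z o\<^sub>L resolvent A w)"
proof (rule blinfun_eqI)
  fix u
  let ?v = "resolvent A w u"
  have "resolvent A z u - resolvent A w u = resolvent A z (shift A w ?v) - resolvent A z (shift A z ?v)"
    by (simp add: resolvent_cancel z w)
  also have "\<dots> = (w - z) *\<^sub>C resolvent A z ?v"
    by (simp flip: blinfun.diff_right
        add: shift_diff_point clinear_scaleC[OF clinear_resolvent[OF A z]])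
  finally show "(resolvent A z - resolvent A w) u = ((w - z) *\<^sub>C (resolvent A z o\<^sub>L resolvent A w)) u"
    by (simp add: blinfun.diff_left)
qed

lemma resolvent_perturb:
  assumes z: "z \<in> resolvent_set A" "z \<in> resolvent_set B"
  shows "resolvent A z u - resolvent B z u = resolvent A z ((A - B) (resolvent B z u))"
proof -
  let ?v = "resolvent B z u"
  have "resolvent A z u - resolvent B z u = resolvent A z (shift B z ?v) - resolvent A z (shift A z ?v)"
    by (simp add: resolvent_cancel z)
  also have "\<dots> = resolvent A z ((A - B) ?v)"
    by (simp flip: blinfun.diff_right) (simp add: shift_def blinfun.diff_left)
  finally show ?thesis .
qed

lemma resolvent_commute:
  fixes A :: "'a::complex_banach \<Rightarrow>\<^sub>L 'a"
  assumes A: "clinear (blinfun_apply A)" and z: "z \<in> resolvent_set A"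
  shows "A (resolvent A z u) = resolvent A z (A u)"
proof -
  have "A (resolvent A z u) = z *\<^sub>C resolvent A z u - shift A z (resolvent A z u)"
    by (simp add: shift_def)
  also have "\<dots> = resolvent A z (z *\<^sub>C u) - resolvent A z (shift A z u)"
    by (simp add: resolvent_cancel z clinear_scaleC[OF clinear_resolvent[OF A z]])
  also have "\<dots> = resolvent A z (A u)"
    by (simp flip: blinfun.diff_right) (simp add: shift_def)
  finally show ?thesis .
qed

lemma isCont_resolvent:
  fixes A :: "'a::complex_banach \<Rightarrow>\<^sub>L 'a"
  assumes A: "clinear (blinfun_apply A)" and z: "z \<in> resolvent_set A"
  shows "isCont (resolvent A) z"
proof -
  obtain e C where e: "0 < e"
    and C: "\<And>w. dist w z < e \<Longrightarrow> w \<in> resolvent_set A \<and> norm (resolvent A w) \<le> C"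
    using resolvent_nearby[OF z] by metis
  have "((\<lambda>w. resolvent A w - resolvent A z) \<longlongrightarrow> 0) (at z)"
  proof (rule Lim_null_comparison)
    show "((\<lambda>w. cmod (z - w) * (C * C)) \<longlongrightarrow> 0) (at z)"
      by (rule tendsto_eq_intros refl | simp)+
    have "norm (resolvent A w - resolvent A z) \<le> cmod (z - w) * (C * C)" if w: "dist w z < e" for w
    proof -
      have "norm (resolvent A w - resolvent A z) = cmod (z - w) * norm (resolvent A w o\<^sub>L resolvent A z)"
        using C[OF w] z by (simp add: resolvent_identity[OF A] norm_scaleC)
      also have "\<dots> \<le> cmod (z - w) * (norm (resolvent A w) * norm (resolvent A z))"
        by (intro mult_left_mono norm_blinfun_compose) simp
      also have "\<dots> \<le> cmod (z - w) * (C * C)"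
        using C[OF w] C[of z] e order_trans[OF norm_ge_zero] by (intro mult_left_mono mult_mono) auto
      finally show ?thesis .
    qed
    then show "\<forall>\<^sub>F w in at z. norm (resolvent A w - resolvent A z) \<le> cmod (z - w) * (C * C)"
      using e by (auto simp: eventually_at)
  qed
  then show ?thesis by (simp add: isCont_def LIM_zero_iff)
qed

lemma continuous_on_resolvent:
  fixes A :: "'a::complex_banach \<Rightarrow>\<^sub>L 'a"
  assumes "clinear (blinfun_apply A)" "S \<subseteq> resolvent_set A"
  shows "continuous_on S (resolvent A)"
  using assms isCont_resolvent by (intro continuous_at_imp_continuous_on) blast

lemma resolvent_bounded_on_compact:
  fixes A :: "'a::complex_banach \<Rightarrow>\<^sub>L 'a"
  assumes "clinear (blinfun_apply A)" "S \<subseteq> resolvent_set A" "compact S"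
  obtains C where "0 < C" "\<And>z. z \<in> S \<Longrightarrow> norm (resolvent A z) \<le> C"
proof -
  have "bounded (resolvent A ` S)"
    using assms by (intro compact_imp_bounded compact_continuous_image continuous_on_resolvent)
  then show ?thesis using that unfolding bounded_pos by blast
qed

lemma functional_resolvent_holomorphic:
  fixes A :: "'a::complex_banach \<Rightarrow>\<^sub>L 'a"
  assumes A: "clinear (blinfun_apply A)" and \<phi>: "cfunctional \<phi>"
  shows "(\<lambda>z. \<phi> (resolvent A z)) holomorphic_on resolvent_set A"
proof (rule holomorphic_onI)
  fix w assume w: "w \<in> resolvent_set A"
  have lin: "bounded_linear \<phi>" "\<And>c x. \<phi> (c *\<^sub>C x) = c * \<phi> x"
    using \<phi> by (auto simp: cfunctional_def)
  have "((\<lambda>z. - \<phi> (resolvent A z o\<^sub>L resolvent A w)) \<longlongrightarrow>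
      - \<phi> (resolvent A w o\<^sub>L resolvent A w)) (at w)"
    using isCont_resolvent[OF A w]
    by (intro tendsto_minus bounded_linear.tendsto[OF lin(1)]
        bounded_bilinear.tendsto[OF bounded_bilinear_blinfun_compose]) (auto simp: isCont_def)
  moreover have "\<forall>\<^sub>F z in at w. z \<in> resolvent_set A \<and> z \<noteq> w"
    using resolvent_set_open w
    by (auto simp: eventually_at_topological)
  then have "\<forall>\<^sub>F z in at w. - \<phi> (resolvent A z o\<^sub>L resolvent A w) =
      (\<phi> (resolvent A z) - \<phi> (resolvent A w)) / (z - w)"
  proof eventually_elim
    case (elim z)
    have "\<phi> (resolvent A z) - \<phi> (resolvent A w) = (w - z) * \<phi> (resolvent A z o\<^sub>L resolvent A w)"
      using elim w by (simp flip: lin(2) linear_diff[OF bounded_linear.linear[OF lin(1)]]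
          add: resolvent_identity[OF A])
    then show ?case using elim by (simp add: field_simps)
  qed
  ultimately have "((\<lambda>z. (\<phi> (resolvent A z) - \<phi> (resolvent A w)) / (z - w)) \<longlongrightarrow>
      - \<phi> (resolvent A w o\<^sub>L resolvent A w)) (at w)"
    by (rule Lim_transform_eventually)
  then have "((\<lambda>z. \<phi> (resolvent A z)) has_field_derivative - \<phi> (resolvent A w o\<^sub>L resolvent A w)) (at w)"
    by (simp add: has_field_derivative_iff)
  then show "(\<lambda>z. \<phi> (resolvent A z)) field_differentiable at w within resolvent_set A"
    using field_differentiable_at_within field_differentiable_def by blast
qed

lemma eigenvalue_not_in_resolvent_set: "eigenvalue A \<zeta> \<Longrightarrow> \<zeta> \<notin> resolvent_set A"
proof
  assume "eigenvalue A \<zeta>" and \<zeta>: "\<zeta> \<in> resolvent_set A"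
  then obtain v where "v \<noteq> 0" "shift A \<zeta> v = 0"
    by (auto simp: eigenvalue_def eigenvector_def shift_def)
  then show False using resolvent_cancel(2)[OF \<zeta>, of v] by simp
qed

section \<open>Riesz projectors\<close>

text \<open>The standing assumptions under which the Riesz projector is defined.\<close>

locale riesz =
  fixes A :: "'a::complex_banach \<Rightarrow>\<^sub>L 'a" and U :: "complex set" and \<gamma> :: "real \<Rightarrow> complex"
  assumes clin: "clinear (blinfun_apply A)" and jordan: "jordan_domain U \<gamma>"
    and frontier: "frontier U \<subseteq> resolvent_set A"
begin

abbreviation "P \<equiv> riesz_projector A \<gamma>"
abbreviation "\<kappa> \<equiv> 1 / (2 * complex_of_real pi * \<i>)"

lemma contour: "C1_contour \<gamma>"
  by (rule jordan_domain_contour[OF jordan])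

lemma image: "path_image \<gamma> = frontier U"
  by (rule jordan_domain_path_image[OF jordan])

lemma in_resolvent_set: "z \<in> path_image \<gamma> \<Longrightarrow> z \<in> resolvent_set A"
  using image frontier by blast

lemma continuous_resolvent: "continuous_on (path_image \<gamma>) (resolvent A)"
  using image frontier by (intro continuous_on_resolvent clin) simp

lemma continuous_resolvent_apply: "continuous_on (path_image \<gamma>) (\<lambda>z. resolvent A z v)"
  by (intro bounded_linear.continuous_on[OF blinfun.bounded_linear_left] continuous_resolvent)

lemma apply_eq: "P v = \<kappa> *\<^sub>C vector_contour_integral \<gamma> (\<lambda>z. resolvent A z v)"
  unfolding riesz_projector_def
  by (simp add: vector_contour_integral_linear[OF contour continuous_resolvent
        blinfun.bounded_linear_left])

lemma clinear_projector: "clinear (blinfun_apply P)"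
  unfolding clinear_iff
proof (intro conjI allI)
  show "P (x + y) = P x + P y" for x y by (rule blinfun.add_right)
  show "P (c *\<^sub>C x) = c *\<^sub>C P x" for c x
  proof -
    have "vector_contour_integral \<gamma> (\<lambda>z. resolvent A z (c *\<^sub>C x)) =
        vector_contour_integral \<gamma> (\<lambda>z. c *\<^sub>C resolvent A z x)"
      by (intro vector_contour_integral_cong clinear_scaleC clinear_resolvent clin in_resolvent_set)
    also have "\<dots> = c *\<^sub>C vector_contour_integral \<gamma> (\<lambda>z. resolvent A z x)"
      by (rule vector_contour_integral_linear[OF contour continuous_resolvent_apply
            bounded_linear_scaleC, symmetric]) (simp add: scaleC_scaleC mult.commute)
    finally show ?thesis by (simp add: apply_eq scaleC_scaleC mult.commute)
  qed
qed

lemma commute: "A (P v) = P (A v)"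
proof -
  have "A (vector_contour_integral \<gamma> (\<lambda>z. resolvent A z v)) =
      vector_contour_integral \<gamma> (\<lambda>z. A (resolvent A z v))"
    by (rule vector_contour_integral_linear[OF contour continuous_resolvent_apply blinfun.bounded_linear_right])
      (rule clinear_scaleC[OF clin])
  also have "\<dots> = vector_contour_integral \<gamma> (\<lambda>z. resolvent A z (A v))"
    by (intro vector_contour_integral_cong resolvent_commute clin in_resolvent_set)
  finally show ?thesis by (simp add: apply_eq clinear_scaleC[OF clin])
qed

lemma shift_commute_projector: "shift A \<zeta> (P v) = P (shift A \<zeta> v)"
  by (simp add: shift_def commute blinfun.diff_right clinear_scaleC[OF clinear_projector])

text \<open>Idempotence with a single contour: by the resolvent identity, \<open>(P - I) R(w)\<close>, which is
  analytic on the resolvent set, agrees on \<open>U\<close> with the Cauchy-type integral of the resolvent over \<open>\<gamma>\<close>, which is analytic on the whole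
  of \<open>U\<close>. Together they form an analytic function on a neighbourhood of \<open>closure U\<close>, so the integral of
  \<open>(P - I) R(w)\<close> over \<open>\<gamma>\<close> vanishes.\<close>

lemma projector_idem: "P (P v) = P v"
proof -
  have "(P - id_blinfun) o\<^sub>L P = 0"
  proof (rule functional_eqI)
    fix \<phi> :: "('a \<Rightarrow>\<^sub>L 'a) \<Rightarrow> complex" assume \<phi>: "cfunctional \<phi>"
    then have lin: "bounded_linear \<phi>" "\<And>c x. \<phi> (c *\<^sub>C x) = c * \<phi> x"
      by (auto simp: cfunctional_def)
    note diff = linear_diff[OF bounded_linear.linear[OF lin(1)]]
    define \<psi> where "\<psi> X = \<phi> ((P - id_blinfun) o\<^sub>L X)" for X
    define f where "f z = \<phi> (resolvent A z)" for z
    define Q where "Q w = - \<kappa> * contour_integral \<gamma> (\<lambda>z. f z / (z - w))" for w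
    define T where "T w = (if w \<in> U then Q w else \<psi> (resolvent A w))" for w
    have clin_comp: "clinear (blinfun_apply (P - id_blinfun))"
      using clinear_projector by (simp add: clinear_iff blinfun.diff_left scaleC_algebra)
    have \<psi>: "cfunctional \<psi>"
      unfolding cfunctional_def
    proof
      show "bounded_linear \<psi>"
        unfolding \<psi>_def
        by (rule bounded_linear_compose[OF lin(1)
              bounded_bilinear.bounded_linear_right[OF bounded_bilinear_blinfun_compose]])
      have scale: "(P - id_blinfun) o\<^sub>L (c *\<^sub>C X) = c *\<^sub>C ((P - id_blinfun) o\<^sub>L X)"
        for c and X :: "'a \<Rightarrow>\<^sub>L 'a"
        by (rule blinfun_eqI) (simp add: clinear_scaleC[OF clin_comp])
      show "\<forall>c X. \<psi> (c *\<^sub>C X) = c * \<psi> X" unfolding \<psi>_def scale by (simp add: lin(2))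
    qed
    have f_cont: "continuous_on (path_image \<gamma>) f"
      unfolding f_def by (intro bounded_linear.continuous_on[OF lin(1)] continuous_resolvent)
    have valid: "valid_path \<gamma>" by (rule C1_contour_valid_path[OF contour])
    have f_int: "(\<lambda>z. f z / (z - w)) contour_integrable_on \<gamma>" if "w \<notin> path_image \<gamma>" for w
    proof -
      have "continuous_on (path_image \<gamma>) (\<lambda>z. (1 / (z - w)) *\<^sub>C resolvent A z)"
        using that by (intro bounded_bilinear.continuous_on[OF bounded_bilinear_scaleC]
            continuous_intros continuous_resolvent) auto
      from vector_contour_integral_functional[OF contour this \<phi>]
      show ?thesis by (auto simp: contour_integrable_on_def lin(2) f_def)
    qed
    have Q_holo: "Q holomorphic_on U"
    proof (rule holomorphic_onI)
      fix w assume w: "w \<in> U"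
      then have w': "w \<in> UNIV - path_image \<gamma>"
        using jordan_domain_frontier(3)[OF jordan] image by blast
      obtain T where "C1_partition \<gamma> T"
        using contour by (auto simp: C1_contour_def elim: piecewise_C1_path_partition)
      then obtain B where B: "\<And>x. x \<in> {0..1} \<Longrightarrow> norm (vector_derivative \<gamma> (at x)) \<le> B"
        by (rule C1_partition_velocity_bounded) blast
      have "((\<lambda>w. contour_integral \<gamma> (\<lambda>z. f z / (z - w))) has_field_derivative
          (of_nat 1 * contour_integral \<gamma> (\<lambda>z. f z / (z - w) ^ Suc 1))) (at w)"
        by (rule Cauchy_next_derivative(2)[OF f_cont B _ _ open_UNIV valid w'])
          (auto intro!: has_contour_integral_integral f_int)
      then have "(Q has_field_derivative
          - \<kappa> * (of_nat 1 * contour_integral \<gamma> (\<lambda>z. f z / (z - w) ^ Suc 1))) (at w)"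
        unfolding Q_def by (rule DERIV_cmult)
      then show "Q field_differentiable at w within U"
        using field_differentiable_at_within field_differentiable_def by blast
    qed
    have agree: "\<psi> (resolvent A w) = Q w" if w: "w \<in> U" "w \<in> resolvent_set A" for w
    proof -
      have w': "w \<notin> path_image \<gamma>"
        using jordan_domain_frontier(3)[OF jordan] image w(1) by blast
      have "((\<lambda>z. \<phi> (resolvent A z o\<^sub>L resolvent A w)) has_contour_integral
          \<phi> (vector_contour_integral \<gamma> (\<lambda>z. resolvent A z o\<^sub>L resolvent A w))) \<gamma>"
        by (intro vector_contour_integral_functional[OF contour _ \<phi>] continuous_resolvent
            bounded_bilinear.continuous_on[OF bounded_bilinear_blinfun_compose] continuous_on_const)
      moreover have "\<phi> (resolvent A z o\<^sub>L resolvent A w) = f w * (1 / (z - w)) - f z / (z - w)"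
        if z: "z \<in> path_image \<gamma>" for z
      proof -
        have "f z - f w = (w - z) * \<phi> (resolvent A z o\<^sub>L resolvent A w)"
          unfolding f_def diff[symmetric] resolvent_identity[OF clin in_resolvent_set[OF z] w(2)]
          by (rule lin(2))
        then have "f w - f z = (z - w) * \<phi> (resolvent A z o\<^sub>L resolvent A w)"
          by (simp add: algebra_simps)
        moreover have "z - w \<noteq> 0" using z w' by auto
        ultimately have "(f w - f z) / (z - w) = \<phi> (resolvent A z o\<^sub>L resolvent A w)" by simp
        then show ?thesis by (simp add: diff_divide_distrib)
      qed
      ultimately have "((\<lambda>z. f w * (1 / (z - w)) - f z / (z - w)) has_contour_integral
          \<phi> (vector_contour_integral \<gamma> (\<lambda>z. resolvent A z o\<^sub>L resolvent A w))) \<gamma>"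
        by (subst has_contour_integral_cong[OF _ refl refl]) auto
      moreover have "((\<lambda>z. f w * (1 / (z - w)) - f z / (z - w)) has_contour_integral
          f w * (2 * complex_of_real pi * \<i>) - contour_integral \<gamma> (\<lambda>z. f z / (z - w))) \<gamma>"
        by (intro has_contour_integral_diff has_contour_integral_lmul
            jordan_domain_simple_pole[OF jordan w(1)] has_contour_integral_integral f_int w')
      ultimately have "\<phi> (vector_contour_integral \<gamma> (\<lambda>z. resolvent A z o\<^sub>L resolvent A w)) =
          f w * (2 * complex_of_real pi * \<i>) - contour_integral \<gamma> (\<lambda>z. f z / (z - w))"
        by (rule has_contour_integral_unique)
      moreover have "P o\<^sub>L resolvent A w =
          \<kappa> *\<^sub>C vector_contour_integral \<gamma> (\<lambda>z. resolvent A z o\<^sub>L resolvent A w)"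
      proof -
        have scale: "(c *\<^sub>C X) o\<^sub>L resolvent A w = c *\<^sub>C (X o\<^sub>L resolvent A w)"
          for c and X :: "'a \<Rightarrow>\<^sub>L 'a"
          by (rule blinfun_eqI) simp
        show ?thesis
          unfolding riesz_projector_def scale
          by (subst vector_contour_integral_linear[OF contour continuous_resolvent
                bounded_bilinear.bounded_linear_left[OF bounded_bilinear_blinfun_compose]])
            (simp_all add: scale)
      qed
      ultimately have "\<phi> (P o\<^sub>L resolvent A w) = f w + Q w"
        by (simp add: lin(2) Q_def field_simps)
      moreover have "(P - id_blinfun) o\<^sub>L resolvent A w = (P o\<^sub>L resolvent A w) - resolvent A w"
        by (rule blinfun_eqI) (simp add: blinfun.diff_left)
      ultimately show ?thesis by (simp add: \<psi>_def diff f_def)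
    qed
    have U: "open U" using jordan by (simp add: jordan_domain_def)
    have "T holomorphic_on (U \<union> resolvent_set A)"
    proof (rule holomorphic_on_Un[OF _ _ U resolvent_set_open])
      show "T holomorphic_on U"
        by (rule holomorphic_transform[OF Q_holo]) (simp add: T_def)
      show "T holomorphic_on resolvent_set A"
        by (rule holomorphic_transform[OF functional_resolvent_holomorphic[OF clin \<psi>]])
          (simp add: T_def agree)
    qed
    moreover have "closure U \<subseteq> U \<union> resolvent_set A"
      using jordan_domain_frontier(4)[OF jordan] frontier by blast
    ultimately have "(T has_contour_integral 0) \<gamma>"
      using U by (intro jordan_domain_Cauchy[OF jordan]) (auto simp: resolvent_set_open)
    moreover have "T z = \<psi> (resolvent A z)" if "z \<in> path_image \<gamma>" for z
      using that image jordan_domain_frontier(3)[OF jordan] by (auto simp: T_def)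
    ultimately have "((\<lambda>z. \<psi> (resolvent A z)) has_contour_integral 0) \<gamma>"
      by (subst has_contour_integral_cong[OF _ refl refl, symmetric]) auto
    then have "\<psi> (vector_contour_integral \<gamma> (resolvent A)) = 0"
      using vector_contour_integral_functional[OF contour continuous_resolvent \<psi>]
      by (rule has_contour_integral_unique[symmetric])
    then have "\<psi> P = 0" using \<psi> by (simp add: riesz_projector_def cfunctional_def)
    then show "\<phi> ((P - id_blinfun) o\<^sub>L P) = \<phi> 0"
      using linear_0[OF bounded_linear.linear[OF lin(1)]] by (simp add: \<psi>_def)
  qed
  then have "((P - id_blinfun) o\<^sub>L P) v = 0" by simp
  then show ?thesis by (simp add: blinfun.diff_left)
qed

lemma eigenvector_integral:
  assumes v: "shift A \<zeta> v = 0" and \<zeta>: "\<zeta> \<notin> frontier U"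
    and i: "((\<lambda>z. 1 / (z - \<zeta>)) has_contour_integral i) \<gamma>"
  shows "P v = (\<kappa> * i) *\<^sub>C v"
proof -
  have "resolvent A z v = (1 / (z - \<zeta>)) *\<^sub>C v" if z: "z \<in> path_image \<gamma>" for z
  proof -
    have ne: "z \<noteq> \<zeta>" using z \<zeta> image by blast
    have "shift A z v = (z - \<zeta>) *\<^sub>C v" using v shift_diff_point[of A z v \<zeta>] by simp
    then have "(z - \<zeta>) *\<^sub>C resolvent A z v = v"
      using resolvent_cancel(2)[OF in_resolvent_set[OF z], of v]
      by (simp add: clinear_scaleC[OF clinear_resolvent[OF clin in_resolvent_set[OF z]]])
    then have "(1 / (z - \<zeta>)) *\<^sub>C v = (1 / (z - \<zeta>)) *\<^sub>C (z - \<zeta>) *\<^sub>C resolvent A z v" by simp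
    then show ?thesis using ne by (simp add: scaleC_scaleC)
  qed
  then have "vector_contour_integral \<gamma> (\<lambda>z. resolvent A z v) =
      vector_contour_integral \<gamma> (\<lambda>z. (1 / (z - \<zeta>)) *\<^sub>C v)"
    by (rule vector_contour_integral_cong)
  also have "\<dots> = i *\<^sub>C v" by (rule vector_contour_integral_scalar[OF i])
  finally show ?thesis by (simp add: apply_eq scaleC_scaleC)
qed

lemma eigenvector_inside: "shift A \<zeta> v = 0 \<Longrightarrow> \<zeta> \<in> U \<Longrightarrow> P v = v"
  using eigenvector_integral[OF _ _ jordan_domain_simple_pole[OF jordan], of \<zeta> v]
    jordan_domain_frontier(3)[OF jordan] by auto

lemma reciprocal_integral_outside:
  assumes "\<zeta> \<notin> closure U"
  shows "((\<lambda>z. 1 / (z - \<zeta>)) has_contour_integral 0) \<gamma>"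
proof (rule jordan_domain_Cauchy[OF jordan])
  show "open (- {\<zeta>})" by (intro open_Compl closed_singleton)
  show "closure U \<subseteq> - {\<zeta>}" using assms by blast
  show "(\<lambda>z. 1 / (z - \<zeta>)) holomorphic_on - {\<zeta>}" by (intro holomorphic_intros) auto
qed

lemma eigenvector_outside: "shift A \<zeta> v = 0 \<Longrightarrow> \<zeta> \<notin> closure U \<Longrightarrow> P v = 0"
  using eigenvector_integral[OF _ _ reciprocal_integral_outside, of \<zeta> v]
    jordan_domain_frontier(4)[OF jordan] by auto

text \<open>For a generalized eigenvector \<open>v\<close>, induction on its order shows that \<open>P v - v\<close> is an eigenvector or
  zero; it is then fixed by \<open>P\<close>, but \<open>P\<close> also annihilates it since \<open>P\<close> is idempotent.\<close>

lemma generalized_eigenvector_inside: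
  assumes "v \<in> generalized_eigenspace A \<zeta>" "\<zeta> \<in> U"
  shows "P v = v"
proof -
  have "P v = v" if "(shift A \<zeta> ^^ n) v = 0" for n v
    using that
  proof (induction n arbitrary: v)
    case (Suc n)
    have "P (shift A \<zeta> v) = shift A \<zeta> v"
      using Suc.prems by (intro Suc.IH) (simp add: funpow_swap1)
    then have "shift A \<zeta> (P v - v) = 0" by (simp add: shift_diff_right shift_commute_projector)
    then have "P (P v - v) = P v - v" using assms(2) by (rule eigenvector_inside)
    then show ?case by (simp add: blinfun.diff_right projector_idem)
  qed simp
  then show ?thesis using assms(1) by (auto simp: generalized_eigenspace_iff)
qed

lemma generalized_eigenvector_outside:
  assumes "v \<in> generalized_eigenspace A \<zeta>" "\<zeta> \<notin> closure U"
  shows "P v = 0"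
proof -
  have "P v = 0" if "(shift A \<zeta> ^^ n) v = 0" for n v
    using that
  proof (induction n arbitrary: v)
    case (Suc n)
    have "P (shift A \<zeta> v) = 0"
      using Suc.prems by (intro Suc.IH) (simp add: funpow_swap1)
    then have "shift A \<zeta> (P v) = 0" by (simp add: shift_commute_projector)
    then have "P (P v) = 0" using assms(2) by (rule eigenvector_outside)
    then show ?case by (simp add: projector_idem)
  qed simp
  then show ?thesis using assms(1) by (auto simp: generalized_eigenspace_iff)
qed

text \<open>From \<open>R(z) = (I + A R(z)) / z\<close>, where the integral of \<open>1 / z\<close> vanishes as \<open>0\<close> lies outside.\<close>

lemma range_finite_rank:
  assumes "0 \<notin> closure U" "finite_rank A"
  shows "finite_cdim (range (blinfun_apply P))"
proof -
  have "P v \<in> range (blinfun_apply A)" for v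
  proof -
    let ?F = "\<lambda>z. (1 / z) *\<^sub>C resolvent A z v"
    have nz: "z \<noteq> 0" if "z \<in> path_image \<gamma>" for z
      using that assms(1) image jordan_domain_frontier(4)[OF jordan] by blast
    have cont: "continuous_on (path_image \<gamma>) ?F"
      by (intro bounded_bilinear.continuous_on[OF bounded_bilinear_scaleC] continuous_intros
          continuous_resolvent_apply) (use nz in auto)
    have contA: "continuous_on (path_image \<gamma>) (\<lambda>z. A (?F z))"
      by (intro bounded_linear.continuous_on[OF blinfun.bounded_linear_right] cont)
    have "resolvent A z v = A (?F z) - (- 1 / z) *\<^sub>C v" if z: "z \<in> path_image \<gamma>" for z
    proof -
      have "z *\<^sub>C resolvent A z v = A (resolvent A z v) + v"
        using resolvent_cancel(1)[OF in_resolvent_set[OF z], of v] by (simp add: shift_def algebra_simps)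
      then have "(1 / z) *\<^sub>C z *\<^sub>C resolvent A z v = (1 / z) *\<^sub>C (A (resolvent A z v) + v)" by simp
      then show ?thesis
        using nz[OF z] by (simp add: scaleC_algebra clinear_scaleC[OF clin])
    qed
    then have "vector_contour_integral \<gamma> (\<lambda>z. resolvent A z v) =
        vector_contour_integral \<gamma> (\<lambda>z. A (?F z) - (- 1 / z) *\<^sub>C v)"
      by (rule vector_contour_integral_cong)
    also have "\<dots> = vector_contour_integral \<gamma> (\<lambda>z. A (?F z)) -
        vector_contour_integral \<gamma> (\<lambda>z. (- 1 / z) *\<^sub>C v)"
      by (intro vector_contour_integral_diff contour contA
          bounded_bilinear.continuous_on[OF bounded_bilinear_scaleC] continuous_intros)
        (use nz in auto)
    also have "((\<lambda>z. - 1 / z) has_contour_integral 0) \<gamma>"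
      using has_contour_integral_neg[OF reciprocal_integral_outside[OF assms(1)]] by simp
    then have "vector_contour_integral \<gamma> (\<lambda>z. (- 1 / z) *\<^sub>C v) = 0 *\<^sub>C v"
      by (rule vector_contour_integral_scalar)
    also have "vector_contour_integral \<gamma> (\<lambda>z. A (?F z)) = A (vector_contour_integral \<gamma> ?F)"
      by (rule vector_contour_integral_linear[OF contour cont blinfun.bounded_linear_right, symmetric])
        (rule clinear_scaleC[OF clin])
    finally have "P v = A (\<kappa> *\<^sub>C vector_contour_integral \<gamma> ?F)"
      by (simp add: apply_eq clinear_scaleC[OF clin])
    then show ?thesis by (metis rangeI)
  qed
  then have "range (blinfun_apply P) \<subseteq> range (blinfun_apply A)" by (rule image_subsetI)
  with assms(2) show ?thesis unfolding finite_rank_def by (rule finite_cdim_mono)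
qed

lemma range_eq_span:
  assumes fin: "finite_cdim (range (blinfun_apply P))"
  shows "range (blinfun_apply P) = complex_vector.span (\<Union>\<zeta>\<in>U. generalized_eigenspace A \<zeta>)"
proof (rule antisym)
  let ?S = "complex_vector.span (\<Union>\<zeta>\<in>U. generalized_eigenspace A \<zeta>)"
  show "?S \<subseteq> range (blinfun_apply P)"
  proof (rule complex_vector.span_minimal)
    show "complex_vector.subspace (range (blinfun_apply P))"
      by (rule subspace_range_clinear[OF clinear_projector])
    show "(\<Union>\<zeta>\<in>U. generalized_eigenspace A \<zeta>) \<subseteq> range (blinfun_apply P)"
    proof
      fix v assume "v \<in> (\<Union>\<zeta>\<in>U. generalized_eigenspace A \<zeta>)"
      then obtain \<zeta> where "v \<in> generalized_eigenspace A \<zeta>" "\<zeta> \<in> U" by blast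
      then have "P v = v" by (rule generalized_eigenvector_inside)
      then show "v \<in> range (blinfun_apply P)" by (metis rangeI)
    qed
  qed
  show "range (blinfun_apply P) \<subseteq> ?S"
  proof
    fix v assume v: "v \<in> range (blinfun_apply P)"
    have P_span: "P x \<in> ?S" if "x \<in> complex_vector.span (\<Union>\<zeta>. generalized_eigenspace A \<zeta>)" for x
      using that
    proof (induction rule: complex_vector.span_induct_alt)
      case base
      show ?case by (simp add: complex_vector.span_zero)
    next
      case (step c g y)
      then obtain \<zeta> where g: "g \<in> generalized_eigenspace A \<zeta>" by blast
      have "P g \<in> ?S"
      proof -
        consider "\<zeta> \<in> U" | "\<zeta> \<in> frontier U" | "\<zeta> \<notin> closure U"
          using jordan_domain_frontier(4)[OF jordan] by blast
        then show ?thesis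
        proof cases
          case 1
          then have "P g = g" using g by (intro generalized_eigenvector_inside)
          then show ?thesis using g 1 by (auto intro: complex_vector.span_base)
        next
          case 2
          then have "\<not> eigenvalue A \<zeta>" using frontier eigenvalue_not_in_resolvent_set by blast
          then have "g = 0" using g eigenvalue_iff_generalized_eigenspace[OF clin] by blast
          then show ?thesis by (simp add: complex_vector.span_zero)
        next
          case 3
          then have "P g = 0" using g by (intro generalized_eigenvector_outside)
          then show ?thesis by (simp add: complex_vector.span_zero)
        qed
      qed
      then show ?case
        using step.IH
        by (simp add: blinfun.add_right clinear_scaleC[OF clinear_projector] complex_vector.span_add
            complex_vector.span_scale)
    qed
    have "v \<in> complex_vector.span (\<Union>\<zeta>. generalized_eigenspace A \<zeta>)"
      by (rule span_generalized_eigenspaces[OF clin fin _ v]) (auto simp: commute)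
    then have "P v \<in> ?S" by (rule P_span)
    moreover have "P v = v" using v projector_idem by auto
    ultimately show "v \<in> ?S" by simp
  qed
qed

lemma eigenvalue_count_eq_rank:
  assumes fin: "finite_cdim (range (blinfun_apply P))"
  shows "eigenvalue_count A U = riesz_rank A \<gamma>"
  using eigenvalue_count_eq_dim[OF clin fin range_eq_span[OF fin]] fin
  by (simp add: riesz_rank_def cdim_def)

end

section \<open>Stability of the rank\<close>

lemma cdim_le_of_injective:
  fixes f :: "'a::complex_vector \<Rightarrow> 'b::complex_vector"
  assumes "clinear f" "complex_vector.subspace V" "inj_on f V" "f ` V \<subseteq> W"
  shows "cdim V \<le> cdim W"
  using finite_cdim_injective[OF assms] by (simp add: cdim_def)

text \<open>If \<open>\<parallel>P - Q\<parallel> < 1\<close> then \<open>Q\<close> is injective on the range of \<open>P\<close>.\<close>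

lemma close_projections_cdim_le:
  fixes P Q :: "'a::complex_normed_vector \<Rightarrow>\<^sub>L 'a"
  assumes P: "clinear (blinfun_apply P)" "\<And>v. P (P v) = P v" and Q: "clinear (blinfun_apply Q)"
    and less: "norm (P - Q) < 1"
  shows "cdim (range (blinfun_apply P)) \<le> cdim (range (blinfun_apply Q))"
proof (rule cdim_le_of_injective[OF Q])
  show "complex_vector.subspace (range (blinfun_apply P))" by (rule subspace_range_clinear[OF P(1)])
  show "inj_on (blinfun_apply Q) (range (blinfun_apply P))"
  proof (rule inj_onI)
    fix x y assume xy: "x \<in> range (blinfun_apply P)" "y \<in> range (blinfun_apply P)" "Q x = Q y"
    then have "(P - Q) (x - y) = x - y"
      using P(2) by (auto simp: blinfun.diff_left blinfun.diff_right)
    then have "norm (x - y) \<le> norm (P - Q) * norm (x - y)" by (metis norm_blinfun)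
    show "x = y"
    proof (rule ccontr)
      assume "x \<noteq> y"
      then have "norm (P - Q) * norm (x - y) < 1 * norm (x - y)"
        using less by (intro mult_strict_right_mono) auto
      then show False using \<open>norm (x - y) \<le> norm (P - Q) * norm (x - y)\<close> by simp
    qed
  qed
qed auto

lemma resolvent_perturb_blinfun:
  assumes "z \<in> resolvent_set A" "z \<in> resolvent_set B"
  shows "resolvent A z - resolvent B z = resolvent A z o\<^sub>L (A - B) o\<^sub>L resolvent B z"
  by (rule blinfun_eqI) (simp add: blinfun.diff_left resolvent_perturb[OF assms])

lemma norm_resolvent_diff_le:
  assumes z: "z \<in> resolvent_set A" "z \<in> resolvent_set B"
    and C: "norm (resolvent A z) \<le> C" "norm (resolvent B z) \<le> D"
  shows "norm (resolvent A z - resolvent B z) \<le> C * norm (A - B) * D"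
proof -
  have "norm (resolvent A z - resolvent B z) \<le> norm (resolvent A z o\<^sub>L (A - B)) * norm (resolvent B z)"
    unfolding resolvent_perturb_blinfun[OF z] by (rule norm_blinfun_compose)
  also have "\<dots> \<le> (norm (resolvent A z) * norm (A - B)) * norm (resolvent B z)"
    by (intro mult_right_mono norm_blinfun_compose) simp
  also have "\<dots> \<le> C * norm (A - B) * D"
    using C order_trans[OF norm_ge_zero C(1)] by (intro mult_mono) auto
  finally show ?thesis .
qed

lemma norm_riesz_projector_diff_le:
  assumes A: "riesz A U \<gamma>" and B: "riesz B U \<gamma>"
    and e: "\<And>z. z \<in> frontier U \<Longrightarrow> norm (resolvent A z - resolvent B z) \<le> e"
  shows "norm (riesz_projector A \<gamma> - riesz_projector B \<gamma>) \<le> max_speed \<gamma> * e / (2 * pi)"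
proof -
  interpret A: riesz A U \<gamma> by (rule A)
  interpret B: riesz B U \<gamma> by (rule B)
  have "norm (riesz_projector A \<gamma> - riesz_projector B \<gamma>) =
      norm ((1 / (2 * complex_of_real pi * \<i>)) *\<^sub>C
        vector_contour_integral \<gamma> (\<lambda>z. resolvent A z - resolvent B z))"
    by (simp add: riesz_projector_def scaleC_algebra
        vector_contour_integral_diff[OF A.contour A.continuous_resolvent B.continuous_resolvent])
  also have "\<dots> = norm (vector_contour_integral \<gamma> (\<lambda>z. resolvent A z - resolvent B z)) / (2 * pi)"
    by (simp add: norm_scaleC norm_divide norm_mult)
  also have "\<dots> \<le> (max_speed \<gamma> * e) / (2 * pi)"
    using e by (intro divide_right_mono vector_contour_integral_bound A.contour continuous_on_diff
        A.continuous_resolvent B.continuous_resolvent) (auto simp: A.image)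
  finally show ?thesis .
qed

lemma riesz_rank_step:
  fixes A B :: "'a::complex_banach \<Rightarrow>\<^sub>L 'a"
  assumes A: "riesz A U \<gamma>" and B: "clinear (blinfun_apply B)" and c: "0 < c"
    and low: "\<And>z u. z \<in> frontier U \<Longrightarrow> c * norm u \<le> norm (shift A z u)"
      "\<And>z u. z \<in> frontier U \<Longrightarrow> c * norm u \<le> norm (shift B z u)"
    and small: "norm (A - B) < c" "max_speed \<gamma> * norm (A - B) < c\<^sup>2"
  shows "riesz B U \<gamma>" "riesz_rank A \<gamma> = riesz_rank B \<gamma>"
proof -
  interpret A: riesz A U \<gamma> by (rule A)
  have z: "z \<in> resolvent_set A" if "z \<in> frontier U" for z using A.frontier that by blast
  have rA: "norm (resolvent A z) \<le> 1 / c" if "z \<in> frontier U" for z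
    using resolvent_setI(2)[OF shift_surj[OF z[OF that]] c low(1)[OF that]] .
  have surj: "surj (shift B z)" if "z \<in> frontier U" for z
    using shift_surj_perturb[OF shift_surj[OF z[OF that]] c low(1)[OF that] small(1)] .
  have zB: "z \<in> resolvent_set B" and rB: "norm (resolvent B z) \<le> 1 / c" if "z \<in> frontier U" for z
    using resolvent_setI[OF surj[OF that] c low(2)[OF that]] by auto
  then show rieszB: "riesz B U \<gamma>" using riesz.intro[OF B A.jordan] by blast
  then interpret B: riesz B U \<gamma> .
  have "norm (A.P - B.P) \<le> max_speed \<gamma> * (1 / c * norm (A - B) * (1 / c)) / (2 * pi)"
    by (intro norm_riesz_projector_diff_le[OF A rieszB] norm_resolvent_diff_le z zB rA rB)
  also have "\<dots> = (max_speed \<gamma> * norm (A - B)) / c\<^sup>2 / (2 * pi)"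
    by (simp add: power2_eq_square)
  also have "\<dots> \<le> (max_speed \<gamma> * norm (A - B)) / c\<^sup>2 / 1"
    using max_speed_nonneg[OF A.contour] pi_ge_two by (intro divide_left_mono) auto
  also have "\<dots> < 1" using small(2) c by (simp add: divide_less_eq)
  finally have less: "norm (A.P - B.P) < 1" .
  then have "norm (B.P - A.P) < 1" by (simp add: norm_minus_commute)
  with less show "riesz_rank A \<gamma> = riesz_rank B \<gamma>"
    unfolding riesz_rank_def
    by (intro antisym close_projections_cdim_le A.clinear_projector B.clinear_projector
        A.projector_idem B.projector_idem)
qed

text \<open>If \<open>z - A - t (B - A)\<close> is bounded below uniformly along the segment from \<open>A\<close> to \<open>B\<close>, then the
  frontier of \<open>U\<close> stays in the resolvent set along the segment. The rank is the same at adjacent points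
  of a fine enough subdivision.\<close>

lemma riesz_rank_homotopy:
  fixes A B :: "'a::complex_banach \<Rightarrow>\<^sub>L 'a"
  assumes A: "riesz A U \<gamma>" and B: "clinear (blinfun_apply B)" and c: "0 < c"
    and low: "\<And>t z u. 0 \<le> t \<Longrightarrow> t \<le> 1 \<Longrightarrow> z \<in> frontier U \<Longrightarrow>
      c * norm u \<le> norm (shift (A + t *\<^sub>R (B - A)) z u)"
  shows "riesz B U \<gamma>" "riesz_rank A \<gamma> = riesz_rank B \<gamma>"
proof -
  define d where "d = norm (B - A)"
  define S where "S = max_speed \<gamma>"
  have S: "0 \<le> S" unfolding S_def
    by (rule max_speed_nonneg[OF jordan_domain_contour[OF riesz.jordan[OF A]]])
  obtain N :: nat where N: "d / c + S * d / c\<^sup>2 < real N"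
    using reals_Archimedean2 by blast
  have "0 \<le> d / c + S * d / c\<^sup>2" using S c by (simp add: d_def)
  with N have N0: "0 < real N" by linarith
  define At where "At n = A + (real n / real N) *\<^sub>R (B - A)" for n
  have At_clinear: "clinear (blinfun_apply (At n))" for n
    using riesz.clin[OF A] B unfolding clinear_iff At_def
    by (simp add: blinfun.add_left blinfun.diff_left blinfun.scaleR_left scaleR_scaleC scaleC_algebra
        mult.commute)
  have low': "c * norm u \<le> norm (shift (At n) z u)" if "n \<le> N" "z \<in> frontier U" for n z u
    unfolding At_def using that N0 by (intro low) auto
  have diff: "norm (At n - At (Suc n)) = d / real N" for n
  proof -
    have "At n - At (Suc n) = - ((1 / real N) *\<^sub>R (B - A))"
      by (simp add: At_def add_divide_distrib scaleR_left_distrib)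
    then show ?thesis by (simp add: d_def)
  qed
  have small: "d / real N < c" "S * (d / real N) < c\<^sup>2"
  proof -
    have "0 \<le> d / c" "0 \<le> S * d / c\<^sup>2" using S c by (auto simp: d_def)
    then have "d / c < real N" "S * d / c\<^sup>2 < real N" using N by linarith+
    then show "d / real N < c" "S * (d / real N) < c\<^sup>2"
      using c N0 by (simp_all add: field_simps)
  qed
  have "n \<le> N \<longrightarrow> riesz (At n) U \<gamma> \<and> riesz_rank A \<gamma> = riesz_rank (At n) \<gamma>" for n
  proof (induction n)
    case 0
    then show ?case using A by (simp add: At_def)
  next
    case (Suc n)
    show ?case
    proof
      assume n: "Suc n \<le> N"
      then have IH: "riesz (At n) U \<gamma>" "riesz_rank A \<gamma> = riesz_rank (At n) \<gamma>" using Suc.IH by auto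
      have small': "norm (At n - At (Suc n)) < c" "max_speed \<gamma> * norm (At n - At (Suc n)) < c\<^sup>2"
        using small by (simp_all add: diff S_def)
      have "n \<le> N" using n by simp
      note step = riesz_rank_step[OF IH(1) At_clinear c low'[OF \<open>n \<le> N\<close>] low'[OF n] small']
      show "riesz (At (Suc n)) U \<gamma> \<and> riesz_rank A \<gamma> = riesz_rank (At (Suc n)) \<gamma>"
        using step IH(2) by simp
    qed
  qed
  moreover have "At N = B" using N0 by (simp add: At_def)
  ultimately show "riesz B U \<gamma>" "riesz_rank A \<gamma> = riesz_rank B \<gamma>" by force+
qed

lemma eigenvalue_count_isolated:
  assumes A: "riesz A U \<gamma>" and \<zeta>: "eigenvalue A \<zeta>" "\<zeta> \<in> U" "closure U \<inter> spectrum A = {\<zeta>}"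
  shows "eigenvalue_count A U = algebraic_multiplicity A \<zeta>"
proof -
  have "{\<eta> \<in> U. eigenvalue A \<eta>} = {\<zeta>}"
    using \<zeta> closure_subset[of U] eigenvalue_not_in_resolvent_set[of A]
    by (auto simp: spectrum_def)
  then show ?thesis by (simp add: eigenvalue_count_def)
qed

lemma isolated_frontier:
  assumes J: "jordan_domain U \<gamma>" and \<zeta>: "\<zeta> \<in> U" "closure U \<inter> spectrum A = {\<zeta>}"
  shows "frontier U \<subseteq> resolvent_set A"
  using jordan_domain_frontier(3,4)[OF J] \<zeta> by (auto simp: spectrum_def)

section \<open>Norm approximation by finite-rank operators\<close>

text \<open>The Fredholm alternative for finite rank: \<open>z I - A\<close> maps the range of \<open>A\<close> onto itself, and
  \<open>(f + y) / z\<close> solves \<open>z u - A u = f\<close> if \<open>y\<close> in the range of \<open>A\<close> solves \<open>z y - A y = A f\<close>.\<close>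

lemma finite_rank_shift_surj:
  fixes A :: "'a::complex_normed_vector \<Rightarrow>\<^sub>L 'a"
  assumes A: "clinear (blinfun_apply A)" "finite_rank A" and z: "z \<noteq> 0"
    and inj: "\<And>u. shift A z u = 0 \<Longrightarrow> u = 0"
  shows "surj (shift A z)"
proof -
  let ?Y = "range (blinfun_apply A)"
  have Y: "complex_vector.subspace ?Y" by (rule subspace_range_clinear[OF A(1)])
  have "?Y \<subseteq> shift A z ` ?Y"
  proof (rule injective_endomorphism_surjective[OF clinear_shift[OF A(1)] Y])
    show "finite_cdim ?Y" using A(2) by (simp add: finite_rank_def)
    show "inj_on (shift A z) ?Y"
    proof (rule inj_onI)
      fix x y assume "shift A z x = shift A z y"
      then have "shift A z (x - y) = 0" by (simp add: shift_diff_right)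
      then show "x = y" using inj[of "x - y"] by simp
    qed
    show "shift A z ` ?Y \<subseteq> ?Y"
      unfolding shift_def
      by (auto intro!: complex_vector.subspace_diff[OF Y] complex_vector.subspace_scale[OF Y])
  qed
  then have *: "\<exists>y. shift A z y = A f" for f by (metis imageE rangeI subsetD)
  have "\<exists>u. shift A z u = f" for f
  proof -
    obtain y where y: "shift A z y = A f" using * by blast
    have "shift A z (f + y) = z *\<^sub>C f"
      using y clinear_add[OF clinear_shift[OF A(1)], of z f y] by (simp add: shift_def)
    then have "shift A z ((1 / z) *\<^sub>C (f + y)) = f"
      using z by (simp add: clinear_scaleC[OF clinear_shift[OF A(1)]] scaleC_scaleC)
    then show ?thesis ..
  qed
  then show ?thesis by (metis surj_def)
qed

lemma finite_cdim_riesz_rank_eq: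
  assumes "riesz_rank A \<gamma> = riesz_rank B \<gamma>'" "finite_cdim (range (blinfun_apply (riesz_projector A \<gamma>)))"
  shows "finite_cdim (range (blinfun_apply (riesz_projector B \<gamma>')))"
  using assms by (auto simp: riesz_rank_def cdim_def split: if_splits)

lemma norm_shift_perturb:
  assumes "norm (B - A) \<le> e"
  shows "norm (shift A z u) - e * norm u \<le> norm (shift B z u)"
proof -
  have "norm (shift A z u) - norm (shift B z u) \<le> norm (shift A z u - shift B z u)"
    by (rule norm_triangle_ineq2)
  also have "shift A z u - shift B z u = (B - A) u" by (simp add: shift_def blinfun.diff_left)
  also have "norm \<dots> \<le> e * norm u"
    by (rule order_trans[OF norm_blinfun mult_right_mono[OF assms]]) simp
  finally show ?thesis by simp
qed

text \<open>The condition makes \<open>z I - F - t (L - F)\<close> bounded below for all \<open>t\<close> in \<open>[0,1]\<close>. The Riesz projector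
  of \<open>L\<close> then has the same rank as that of \<open>F\<close>, so it is finite and equals the number of
  eigenvalues.\<close>

lemma finite_rank_certificate:
  fixes L F :: "'a::complex_banach \<Rightarrow>\<^sub>L 'a"
  assumes L: "clinear (blinfun_apply L)" and F: "clinear (blinfun_apply F)" "finite_rank F"
    and e: "norm (L - F) \<le> e"
    and J: "jordan_domain U \<gamma>" "0 \<notin> closure U" and fr: "frontier U \<subseteq> resolvent_set F"
    and less: "(SUP z\<in>frontier U. e * norm (resolvent F z)) < 1"
  shows "riesz L U \<gamma>" "eigenvalue_count F U = eigenvalue_count L U"
    "riesz_rank F \<gamma> = riesz_rank L \<gamma>"
proof -
  define s where "s = (SUP z\<in>frontier U. e * norm (resolvent F z))"
  interpret F: riesz F U \<gamma> by (rule riesz.intro[OF F(1) J(1) fr])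
  have e0: "0 \<le> e" using e norm_ge_zero order_trans by blast
  obtain C where C: "0 < C" "\<And>z. z \<in> frontier U \<Longrightarrow> norm (resolvent F z) \<le> C"
    using resolvent_bounded_on_compact[OF F(1) fr jordan_domain_frontier(2)[OF J(1)]] by blast
  have s: "e * norm (resolvent F z) \<le> s" if "z \<in> frontier U" for z
    unfolding s_def
    by (intro cSUP_upper that bdd_aboveI2[of _ _ "e * C"] mult_left_mono C(2) e0)
  have s1: "s < 1" using less by (simp add: s_def)
  have low: "((1 - s) / C) * norm u \<le> norm (shift (F + t *\<^sub>R (L - F)) z u)"
    if t: "0 \<le> t" "t \<le> 1" and z: "z \<in> frontier U" for t z u
  proof -
    let ?R = "norm (resolvent F z)" and ?B = "F + t *\<^sub>R (L - F)"
    have "norm (?B - F) \<le> 1 * e"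
      using t e by (simp add: mult_mono[of t 1 "norm (L - F)" e, simplified])
    then have "norm (shift F z u) \<le> norm (shift ?B z u) + e * norm u"
      using norm_shift_perturb[of ?B F e z u] by simp
    then have "?R * norm (shift F z u) \<le> ?R * (norm (shift ?B z u) + e * norm u)"
      by (rule mult_left_mono) simp
    moreover have "norm u \<le> ?R * norm (shift F z u)"
      using z fr by (intro resolvent_bounded_below) blast
    moreover have "(e * ?R) * norm u \<le> s * norm u"
      using s[OF z] by (rule mult_right_mono) simp
    moreover have "?R * norm (shift ?B z u) \<le> C * norm (shift ?B z u)"
      using C(2)[OF z] by (rule mult_right_mono) simp
    ultimately have "(1 - s) * norm u \<le> C * norm (shift ?B z u)"
      by (simp add: algebra_simps)
    then show ?thesis using C(1) by (simp add: field_simps)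
  qed
  have "0 < (1 - s) / C" using s1 C(1) by simp
  note hom = riesz_rank_homotopy[OF F.riesz_axioms L this low]
  show L': "riesz L U \<gamma>" and rank: "riesz_rank F \<gamma> = riesz_rank L \<gamma>"
    using hom by blast+
  have finF: "finite_cdim (range (blinfun_apply F.P))"
    by (rule F.range_finite_rank[OF J(2) F(2)])
  then have finL: "finite_cdim (range (blinfun_apply (riesz_projector L \<gamma>)))"
    by (rule finite_cdim_riesz_rank_eq[OF rank])
  show "eigenvalue_count F U = eigenvalue_count L U"
    using F.eigenvalue_count_eq_rank[OF finF] riesz.eigenvalue_count_eq_rank[OF L' finL] rank by simp
qed

lemma norm_convergence_resolvents:
  fixes L :: "'a::complex_banach \<Rightarrow>\<^sub>L 'a" and F :: "nat \<Rightarrow> 'a \<Rightarrow>\<^sub>L 'a" and \<epsilon> :: "nat \<Rightarrow> real"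
  assumes L: "clinear (blinfun_apply L)"
    and F: "\<And>K. 1 \<le> K \<Longrightarrow> norm (L - F K) \<le> \<epsilon> K" and \<epsilon>: "\<epsilon> \<longlonglongrightarrow> 0"
    and S: "compact S" "S \<subseteq> resolvent_set L"
  obtains D K0 where "0 < D" "1 \<le> K0" "\<And>K. K0 \<le> K \<Longrightarrow> \<epsilon> K * D \<le> 1 / 2"
    "\<And>z. z \<in> S \<Longrightarrow> norm (resolvent L z) \<le> D"
    "\<And>K z. K0 \<le> K \<Longrightarrow> z \<in> S \<Longrightarrow> z \<in> resolvent_set (F K) \<and> norm (resolvent (F K) z) \<le> D"
proof -
  obtain C where C: "0 < C" "\<And>z. z \<in> S \<Longrightarrow> norm (resolvent L z) \<le> C"
    using resolvent_bounded_on_compact[OF L S(2,1)] by blast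
  have "\<forall>\<^sub>F K in sequentially. \<epsilon> K < 1 / (4 * C)"
    using order_tendstoD(2)[OF \<epsilon>, of "1 / (4 * C)"] C(1) by simp
  then obtain N where N: "\<And>K. N \<le> K \<Longrightarrow> \<epsilon> K < 1 / (4 * C)"
    by (auto simp: eventually_sequentially)
  have *: "z \<in> resolvent_set (F K) \<and> norm (resolvent (F K) z) \<le> 2 * C"
    if K: "max 1 N \<le> K" and z: "z \<in> S" for K z
  proof -
    have zL: "z \<in> resolvent_set L" using z S(2) by blast
    have low: "(1 / C) * norm u \<le> norm (shift L z u)" for u
    proof -
      have "norm u \<le> C * norm (shift L z u)"
        using resolvent_bounded_below[OF zL, of u] mult_right_mono[OF C(2)[OF z] norm_ge_zero]
        by (rule order_trans)
      then show ?thesis using C(1) by (simp add: field_simps)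
    qed
    have close: "norm (L - F K) \<le> 1 / (4 * C)" using F[of K] N[of K] K by simp
    also have "1 / (4 * C) < 1 / C" using C(1) by (simp add: field_simps)
    finally have surj: "surj (shift (F K) z)"
      using shift_surj_perturb[OF shift_surj[OF zL] _ low] C(1) by simp
    have "(1 / (2 * C)) * norm u \<le> norm (shift (F K) z u)" for u
    proof -
      have "norm (shift L z u) - 1 / (4 * C) * norm u \<le> norm (shift (F K) z u)"
        by (rule norm_shift_perturb) (simp add: norm_minus_commute close)
      moreover have "(1 / (2 * C)) * norm u + 1 / (4 * C) * norm u \<le> (1 / C) * norm u"
        unfolding distrib_right[symmetric] using C(1) by (intro mult_right_mono) (auto simp: field_simps)
      ultimately show ?thesis using low[of u] by linarith
    qed
    then show ?thesis using resolvent_setI[OF surj, of "1 / (2 * C)"] C(1) by simp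
  qed
  show ?thesis
  proof (rule that[of "2 * C" "max 1 N"])
    show "\<epsilon> K * (2 * C) \<le> 1 / 2" if "max 1 N \<le> K" for K
      using N[of K] that C(1) by (simp add: field_simps)
    show "norm (resolvent L z) \<le> 2 * C" if "z \<in> S" for z
      using C(2)[OF that] C(1) by linarith
  qed (use C(1) * in auto)
qed

lemma norm_tendsto_zero_le:
  fixes g :: "nat \<Rightarrow> real"
  assumes "\<And>n. N \<le> n \<Longrightarrow> norm (f n) \<le> g n" "g \<longlonglongrightarrow> 0"
  shows "(\<lambda>n. norm (f n)) \<longlonglongrightarrow> 0"
  using assms(1)
  by (intro tendsto_sandwich[OF _ _ tendsto_const assms(2)])
    (auto simp: eventually_sequentially intro!: exI[of _ N])

lemma norm_convergence_projectors:
  fixes L :: "'a::complex_banach \<Rightarrow>\<^sub>L 'a" and F :: "nat \<Rightarrow> 'a \<Rightarrow>\<^sub>L 'a" and \<epsilon> :: "nat \<Rightarrow> real"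
  assumes L: "riesz L U \<gamma>"
    and F: "\<And>K. 1 \<le> K \<Longrightarrow> clinear (blinfun_apply (F K))" "\<And>K. 1 \<le> K \<Longrightarrow> norm (L - F K) \<le> \<epsilon> K"
    and \<epsilon>: "\<epsilon> \<longlonglongrightarrow> 0"
  shows "(\<lambda>K. norm (riesz_projector (F K) \<gamma> - riesz_projector L \<gamma>)) \<longlonglongrightarrow> 0"
proof -
  interpret L: riesz L U \<gamma> by (rule L)
  obtain D K0 where D: "0 < D" "1 \<le> K0" "\<And>K. K0 \<le> K \<Longrightarrow> \<epsilon> K * D \<le> 1 / 2"
    "\<And>z. z \<in> frontier U \<Longrightarrow> norm (resolvent L z) \<le> D"
    "\<And>K z. K0 \<le> K \<Longrightarrow> z \<in> frontier U \<Longrightarrow> z \<in> resolvent_set (F K) \<and> norm (resolvent (F K) z) \<le> D"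
    by (rule norm_convergence_resolvents[OF L.clin F(2) \<epsilon> jordan_domain_frontier(2)[OF L.jordan]
          L.frontier]) (assumption, rule that)
  let ?b = "\<lambda>K. max_speed \<gamma> * (D * \<epsilon> K * D) / (2 * pi)"
  have "norm (riesz_projector (F K) \<gamma> - riesz_projector L \<gamma>) \<le> ?b K" if K: "K0 \<le> K" for K
  proof (rule norm_riesz_projector_diff_le)
    have K1: "1 \<le> K" using D(2) K by simp
    show "riesz (F K) U \<gamma>" using D(5)[OF K] F(1)[OF K1] L.jordan by (intro riesz.intro) auto
    fix z assume z: "z \<in> frontier U"
    have "norm (resolvent (F K) z - resolvent L z) \<le> D * norm (F K - L) * D"
      using D z K L.frontier by (intro norm_resolvent_diff_le) auto
    also have "\<dots> \<le> D * \<epsilon> K * D"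
      using F(2)[OF K1] D(1) by (intro mult_left_mono mult_right_mono) (auto simp: norm_minus_commute)
    finally show "norm (resolvent (F K) z - resolvent L z) \<le> D * \<epsilon> K * D" .
  qed (rule L)
  moreover have "?b \<longlonglongrightarrow> 0"
    using tendsto_mult[OF tendsto_const[of "max_speed \<gamma> * D * D / (2 * pi)"] \<epsilon>]
    by (simp add: mult.commute mult.left_commute)
  ultimately show ?thesis by (intro norm_tendsto_zero_le[where g = ?b])
qed

lemma compact_case_domain:
  fixes L :: "'a::complex_banach \<Rightarrow>\<^sub>L 'a" and LK :: "nat \<Rightarrow> 'a \<Rightarrow>\<^sub>L 'a" and \<epsilon> :: "nat \<Rightarrow> real"
  assumes L: "clinear (blinfun_apply L)"
    and LK: "\<And>K. 1 \<le> K \<Longrightarrow> clinear (blinfun_apply (LK K))" "\<And>K. 1 \<le> K \<Longrightarrow> finite_rank (LK K)"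
      "\<And>K. 1 \<le> K \<Longrightarrow> norm (L - LK K) \<le> \<epsilon> K"
    and \<epsilon>: "\<epsilon> \<longlonglongrightarrow> 0"
    and J: "jordan_domain U \<gamma>" "0 \<notin> closure U" and fr: "frontier U \<subseteq> resolvent_set L"
  shows "\<exists>K0\<ge>1. \<forall>K\<ge>K0.
      frontier U \<subseteq> resolvent_set (LK K) \<and>
      eigenvalue_count (LK K) U = eigenvalue_count L U \<and>
      riesz_rank (LK K) \<gamma> = riesz_rank L \<gamma> \<and>
      (SUP z\<in>frontier U. \<epsilon> K * norm (resolvent (LK K) z)) < 1"
proof -
  obtain D K0 where D: "0 < D" "1 \<le> K0" "\<And>K. K0 \<le> K \<Longrightarrow> \<epsilon> K * D \<le> 1 / 2"
    "\<And>z. z \<in> frontier U \<Longrightarrow> norm (resolvent L z) \<le> D"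
    "\<And>K z. K0 \<le> K \<Longrightarrow> z \<in> frontier U \<Longrightarrow> z \<in> resolvent_set (LK K) \<and> norm (resolvent (LK K) z) \<le> D"
    by (rule norm_convergence_resolvents[OF L LK(3) \<epsilon> jordan_domain_frontier(2)[OF J(1)] fr]) (assumption, rule that)
  have frK: "frontier U \<subseteq> resolvent_set (LK K)" if "K0 \<le> K" for K
    using D(5)[OF that] by blast
  have cert: "(SUP z\<in>frontier U. \<epsilon> K * norm (resolvent (LK K) z)) < 1" if K: "K0 \<le> K" for K
  proof -
    have "norm (L - LK K) \<le> \<epsilon> K" using LK(3)[of K] D(2) K by simp
    then have "0 \<le> \<epsilon> K" using norm_ge_zero order_trans by blast
    then have "\<epsilon> K * norm (resolvent (LK K) z) \<le> 1 / 2" if "z \<in> frontier U" for z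
      using mult_left_mono[of "norm (resolvent (LK K) z)" D "\<epsilon> K"] D(3)[OF K] D(5)[OF K that] by linarith
    then have "(SUP z\<in>frontier U. \<epsilon> K * norm (resolvent (LK K) z)) \<le> 1 / 2"
      by (intro cSUP_least jordan_domain_frontier(1)[OF J(1)])
    then show ?thesis by linarith
  qed
  note certificate = finite_rank_certificate[OF L LK(1) LK(2) LK(3) J frK cert]
  show "\<exists>K0\<ge>1. \<forall>K\<ge>K0.
      frontier U \<subseteq> resolvent_set (LK K) \<and>
      eigenvalue_count (LK K) U = eigenvalue_count L U \<and>
      riesz_rank (LK K) \<gamma> = riesz_rank L \<gamma> \<and>
      (SUP z\<in>frontier U. \<epsilon> K * norm (resolvent (LK K) z)) < 1"
  proof (intro exI[of _ K0] conjI allI impI D(2))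
    fix K assume K: "K0 \<le> K"
    then have K1: "1 \<le> K" using D(2) by simp
    show "frontier U \<subseteq> resolvent_set (LK K)" by (rule frK[OF K])
    show "(SUP z\<in>frontier U. \<epsilon> K * norm (resolvent (LK K) z)) < 1" by (rule cert[OF K])
    show "eigenvalue_count (LK K) U = eigenvalue_count L U" "riesz_rank (LK K) \<gamma> = riesz_rank L \<gamma>"
      using certificate(2,3)[OF K1 K1 K1 K K] by blast+
  qed
qed

lemma tendsto_projector_eigenvector:
  assumes A: "riesz A U \<gamma>" and v: "eigenvector A \<zeta> v" "\<zeta> \<in> U"
    and conv: "(\<lambda>K. norm (Q K - riesz_projector A \<gamma>)) \<longlonglongrightarrow> 0"
  shows "(\<lambda>K. Q K v) \<longlonglongrightarrow> v"
proof -
  interpret A: riesz A U \<gamma> by (rule A)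
  have "shift A \<zeta> v = 0" using v(1) by (simp add: eigenvector_def shift_def)
  then have "A.P v = v" using v(2) by (rule A.eigenvector_inside)
  moreover have "(\<lambda>K. Q K - A.P) \<longlonglongrightarrow> 0" using conv by (rule tendsto_norm_zero_cancel)
  then have "(\<lambda>K. (Q K - A.P) v) \<longlonglongrightarrow> 0"
    using bounded_linear.tendsto[OF blinfun.bounded_linear_left[of v], of _ 0] by simp
  ultimately show ?thesis by (simp add: blinfun.diff_left LIM_zero_iff)
qed

lemma compact_case_isolated:
  fixes L :: "'a::complex_banach \<Rightarrow>\<^sub>L 'a" and LK :: "nat \<Rightarrow> 'a \<Rightarrow>\<^sub>L 'a" and \<epsilon> :: "nat \<Rightarrow> real"
  assumes L: "clinear (blinfun_apply L)"
    and LK: "\<And>K. 1 \<le> K \<Longrightarrow> clinear (blinfun_apply (LK K))" "\<And>K. 1 \<le> K \<Longrightarrow> finite_rank (LK K)"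
      "\<And>K. 1 \<le> K \<Longrightarrow> norm (L - LK K) \<le> \<epsilon> K"
    and \<epsilon>: "\<epsilon> \<longlonglongrightarrow> 0"
    and \<zeta>: "eigenvalue L \<zeta>" "0 < r" and J: "jordan_domain (ball \<zeta> r) \<gamma>"
    and out: "0 \<notin> closure (ball \<zeta> r)" and iso: "closure (ball \<zeta> r) \<inter> spectrum L = {\<zeta>}"
  shows "\<forall>\<^sub>F K in sequentially. eigenvalue_count (LK K) (ball \<zeta> r) = algebraic_multiplicity L \<zeta>"
    "(\<lambda>K. norm (riesz_projector (LK K) \<gamma> - riesz_projector L \<gamma>)) \<longlonglongrightarrow> 0"
    "eigenvector L \<zeta> v \<Longrightarrow> (\<lambda>K. riesz_projector (LK K) \<gamma> v) \<longlonglongrightarrow> v"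
proof -
  have \<zeta>U: "\<zeta> \<in> ball \<zeta> r" using \<zeta>(2) by simp
  have fr: "frontier (ball \<zeta> r) \<subseteq> resolvent_set L" by (rule isolated_frontier[OF J \<zeta>U iso])
  have L': "riesz L (ball \<zeta> r) \<gamma>" by (rule riesz.intro[OF L J fr])
  show conv: "(\<lambda>K. norm (riesz_projector (LK K) \<gamma> - riesz_projector L \<gamma>)) \<longlonglongrightarrow> 0"
    by (rule norm_convergence_projectors[OF L' LK(1,3) \<epsilon>])
  obtain K0 where "\<forall>K\<ge>K0. eigenvalue_count (LK K) (ball \<zeta> r) = eigenvalue_count L (ball \<zeta> r)"
    using compact_case_domain[OF L LK \<epsilon> J out fr] by blast
  then show "\<forall>\<^sub>F K in sequentially. eigenvalue_count (LK K) (ball \<zeta> r) = algebraic_multiplicity L \<zeta>"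
    unfolding eventually_sequentially eigenvalue_count_isolated[OF L' \<zeta>(1) \<zeta>U iso] by blast
  show "(\<lambda>K. riesz_projector (LK K) \<gamma> v) \<longlonglongrightarrow> v" if "eigenvector L \<zeta> v"
    by (rule tendsto_projector_eigenvector[OF L' that \<zeta>U conv])
qed

section \<open>The strong--weak setting\<close>

context dfly_scheme
begin

text \<open>\<open>L\<^sub>k\<close> on the strong and on the weak space, \<open>\<delta>\<^sub>k\<close>, and the constant of the norm equivalence on the
  range of \<open>\<pi>\<^sub>k\<close>.\<close>

abbreviation "Lk k \<equiv> compression (\<pi>s k) Ls"
abbreviation "Lwk k \<equiv> compression (\<pi>w k) Lw"
abbreviation "\<Delta> k \<equiv> norm (\<iota> o\<^sub>L (Ls - Lk k))"
abbreviation "Ek k \<equiv> weak_to_strong_const \<iota> (\<pi>w k)"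

lemma compression_apply: "compression P T u = P (T (P u))"
  by (simp add: compression_def)

lemma embed_L: "\<iota> (Ls u) = Lw (\<iota> u)"
  using arg_cong[OF L_extension, of "\<lambda>X. blinfun_apply X u"] by simp

lemma embed_pi: "1 \<le> k \<Longrightarrow> \<iota> (\<pi>s k u) = \<pi>w k (\<iota> u)"
  using arg_cong[OF pi_restriction, of k "\<lambda>X. blinfun_apply X u"] by simp

lemma pi_pi: "1 \<le> k \<Longrightarrow> \<pi>w k (\<pi>w k v) = \<pi>w k v"
  using arg_cong[OF pi_idem, of k "\<lambda>X. blinfun_apply X v"] by simp

lemma embed_Lk: "1 \<le> k \<Longrightarrow> \<iota> (Lk k u) = Lwk k (\<iota> u)"
  by (simp add: compression_apply embed_pi embed_L)

lemma embed_shift_Lk: "1 \<le> k \<Longrightarrow> \<iota> (shift (Lk k) z u) = shift (Lwk k) z (\<iota> u)"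
  by (simp add: shift_def blinfun.diff_right clinear_scaleC[OF embedding(1)] embed_Lk)

lemma Lk_clinear: "1 \<le> k \<Longrightarrow> clinear (blinfun_apply (Lk k))"
  using pi_clinear(1)[of k] L_clinear(1) by (simp add: clinear_iff compression_apply)

lemma Lkw_clinear: "1 \<le> k \<Longrightarrow> clinear (blinfun_apply (Lwk k))"
  using pi_clinear(2)[of k] L_clinear(2) by (simp add: clinear_iff compression_apply)

lemma Lkw_finite_rank: "1 \<le> k \<Longrightarrow> finite_rank (Lwk k)"
  using pi_finite_rank[of k] unfolding finite_rank_def
  by (rule finite_cdim_mono) (auto simp: compression_apply)

lemma Lk_finite_rank: "1 \<le> k \<Longrightarrow> finite_rank (Lk k)"
  unfolding finite_rank_def
proof (rule finite_cdim_injective(1)[OF embedding(1)])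
  assume k: "1 \<le> k"
  show "complex_vector.subspace (range (blinfun_apply (Lk k)))"
    by (rule subspace_range_clinear[OF Lk_clinear[OF k]])
  show "inj_on (blinfun_apply \<iota>) (range (blinfun_apply (Lk k)))"
    using embedding(2) by (rule inj_on_subset) simp
  show "blinfun_apply \<iota> ` range (blinfun_apply (Lk k)) \<subseteq> range (blinfun_apply (\<pi>w k))"
    using k by (auto simp: compression_apply embed_pi)
  show "finite_cdim (range (blinfun_apply (\<pi>w k)))"
    using pi_finite_rank[OF k] by (simp add: finite_rank_def)
qed

lemma Lk_converges: "\<Delta> \<longlonglongrightarrow> 0"
proof -
  obtain \<epsilon> :: "nat \<Rightarrow> real" where \<epsilon>: "\<epsilon> \<longlonglongrightarrow> 0" "\<And>k. 1 \<le> k \<Longrightarrow>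
      norm (\<iota> o\<^sub>L (id_blinfun - \<pi>s k) o\<^sub>L Ls) + norm (\<iota> o\<^sub>L Ls o\<^sub>L (id_blinfun - \<pi>s k)) \<le> \<epsilon> k"
    using approximation by blast
  have "\<Delta> k \<le> \<epsilon> k" if k: "1 \<le> k" for k
  proof -
    have "\<iota> o\<^sub>L (Ls - Lk k) =
        (\<iota> o\<^sub>L (id_blinfun - \<pi>s k) o\<^sub>L Ls) + (\<pi>w k o\<^sub>L (\<iota> o\<^sub>L Ls o\<^sub>L (id_blinfun - \<pi>s k)))"
      by (rule blinfun_eqI)
        (simp add: blinfun.diff_left blinfun.diff_right blinfun.add_left compression_apply
          embed_pi[OF k])
    then have "\<Delta> k \<le> norm (\<iota> o\<^sub>L (id_blinfun - \<pi>s k) o\<^sub>L Ls) +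
        norm (\<pi>w k o\<^sub>L (\<iota> o\<^sub>L Ls o\<^sub>L (id_blinfun - \<pi>s k)))"
      by (metis norm_triangle_ineq)
    also have "norm (\<pi>w k o\<^sub>L (\<iota> o\<^sub>L Ls o\<^sub>L (id_blinfun - \<pi>s k))) \<le>
        norm (\<pi>w k) * norm (\<iota> o\<^sub>L Ls o\<^sub>L (id_blinfun - \<pi>s k))"
      by (rule norm_blinfun_compose)
    also have "\<dots> \<le> 1 * norm (\<iota> o\<^sub>L Ls o\<^sub>L (id_blinfun - \<pi>s k))"
      using pi_norm(1)[OF k] by (rule mult_right_mono) simp
    finally show ?thesis using \<epsilon>(2)[OF k] by simp
  qed
  then show ?thesis
    by (intro norm_tendsto_zero_le[OF _ \<epsilon>(1)])
qed

lemma embed_diff_le: "norm (\<iota> ((Ls - Lk k) u)) \<le> \<Delta> k * norm u"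
  using norm_blinfun[of "\<iota> o\<^sub>L (Ls - Lk k)" u] by simp

text \<open>The norm equivalence on the range of \<open>\<pi>\<^sub>k\<close>, which is finite-dimensional.\<close>

lemma strong_le_weak:
  assumes k: "1 \<le> k" and u: "\<iota> u \<in> range (blinfun_apply (\<pi>w k))"
  shows "norm u \<le> Ek k * norm (\<iota> u)" "0 \<le> Ek k"
proof -
  interpret \<iota>: vector_space_pair "scaleC :: complex \<Rightarrow> 's \<Rightarrow> 's" "scaleC :: complex \<Rightarrow> 'w \<Rightarrow> 'w"
    by unfold_locales
  let ?V = "{u. \<iota> u \<in> range (blinfun_apply (\<pi>w k))}"
  have sub: "complex_vector.subspace (range (blinfun_apply (\<pi>w k)))"
    by (rule subspace_range_clinear[OF pi_clinear(2)[OF k]])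
  have V: "complex_vector.subspace ?V"
    using complex_vector.subspace_0[OF sub] complex_vector.subspace_add[OF sub]
      complex_vector.subspace_scale[OF sub]
    by (intro complex_vector.subspaceI) (auto simp: blinfun.add_right clinear_scaleC[OF embedding(1)])
  have inj: "inj_on (blinfun_apply \<iota>) ?V"
    using embedding(2) by (rule inj_on_subset) simp
  have "finite_cdim ?V"
    by (rule finite_cdim_injective(1)[OF embedding(1) V inj _
          pi_finite_rank[OF k, unfolded finite_rank_def]]) auto
  then obtain B where B: "B \<subseteq> ?V" "complex_vector.independent B" "?V \<subseteq> complex_vector.span B" "finite B"
    by (rule finite_cdim_basis)
  have injB: "inj_on (blinfun_apply \<iota>) B" using inj B(1) by (rule inj_on_subset)
  have "complex_vector.independent (blinfun_apply \<iota> ` B)"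
    by (rule independent_image_clinear[OF embedding(1) B(2) V B(1) inj])
  then obtain c where c: "0 < c" "\<And>\<alpha>. c * (\<Sum>b\<in>blinfun_apply \<iota> ` B. cmod (\<alpha> b)) \<le>
      norm (\<Sum>b\<in>blinfun_apply \<iota> ` B. \<alpha> b *\<^sub>C b)"
    using coefficient_bound[of "blinfun_apply \<iota> ` B"] B(4) by blast
  define K where "K = (\<Sum>b\<in>B. norm b) / c"
  have K: "norm v \<le> K * norm (\<iota> v)" if v: "v \<in> ?V" for v
  proof -
    obtain \<beta> where \<beta>: "v = (\<Sum>b\<in>B. \<beta> b *\<^sub>C b)"
      using v B(3,4) complex_vector.span_finite[of B] by auto
    define \<alpha> where "\<alpha> x = \<beta> (inv_into B (blinfun_apply \<iota>) x)" for x
    have \<alpha>: "\<alpha> (\<iota> b) = \<beta> b" if "b \<in> B" for b using injB that by (simp add: \<alpha>_def)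
    have "\<iota> v = (\<Sum>b\<in>B. \<beta> b *\<^sub>C \<iota> b)"
      unfolding \<beta> by (simp add: clinear_sum[OF embedding(1)] clinear_scaleC[OF embedding(1)])
    also have "\<dots> = (\<Sum>b\<in>blinfun_apply \<iota> ` B. \<alpha> b *\<^sub>C b)"
      using \<alpha> by (simp add: sum.reindex[OF injB])
    finally have "c * (\<Sum>b\<in>blinfun_apply \<iota> ` B. cmod (\<alpha> b)) \<le> norm (\<iota> v)" using c(2) by simp
    also have "(\<Sum>b\<in>blinfun_apply \<iota> ` B. cmod (\<alpha> b)) = (\<Sum>b\<in>B. cmod (\<beta> b))"
      using \<alpha> by (simp add: sum.reindex[OF injB])
    finally have *: "(\<Sum>b\<in>B. cmod (\<beta> b)) \<le> norm (\<iota> v) / c" using c(1) by (simp add: field_simps)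
    have "norm v \<le> (\<Sum>b\<in>B. cmod (\<beta> b) * norm b)"
      unfolding \<beta> using norm_sum[of "\<lambda>b. \<beta> b *\<^sub>C b" B] by (simp add: norm_scaleC)
    also have "\<dots> \<le> (\<Sum>b\<in>B. cmod (\<beta> b) * (\<Sum>b\<in>B. norm b))"
      using B(4) by (intro sum_mono mult_left_mono member_le_sum) auto
    also have "\<dots> = (\<Sum>b\<in>B. cmod (\<beta> b)) * (\<Sum>b\<in>B. norm b)" by (simp add: sum_distrib_right)
    also have "\<dots> \<le> (norm (\<iota> v) / c) * (\<Sum>b\<in>B. norm b)"
      using * by (rule mult_right_mono) (simp add: sum_nonneg)
    finally show ?thesis by (simp add: K_def mult.commute)
  qed
  have "0 \<le> K" using c(1) by (simp add: K_def sum_nonneg)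
  have "norm v / norm (\<iota> v) \<le> K" if "v \<in> ?V" for v
  proof (cases "norm (\<iota> v) = 0")
    case False
    then have "0 < norm (\<iota> v)" using norm_ge_zero[of "\<iota> v"] by linarith
    then show ?thesis using K[OF that] by (simp add: pos_divide_le_eq)
  qed (use \<open>0 \<le> K\<close> in simp)
  then have "bdd_above ((\<lambda>u. norm u / norm (\<iota> u)) ` ?V)" by (intro bdd_aboveI2)
  then have upper: "norm v / norm (\<iota> v) \<le> Ek k" if "v \<in> ?V" for v
    unfolding weak_to_strong_const_def using that by (intro cSUP_upper)
  have "0 \<in> ?V" by (rule complex_vector.subspace_0[OF V])
  from upper[OF this] show "0 \<le> Ek k" by simp
  show "norm u \<le> Ek k * norm (\<iota> u)"
  proof (cases "norm (\<iota> u) = 0")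
    case True
    then have "\<iota> u = \<iota> 0" by simp
    then have "u = 0" using embedding(2) injD by metis
    then show ?thesis by simp
  next
    case False
    then have "0 < norm (\<iota> u)" using norm_ge_zero[of "\<iota> u"] by linarith
    then show ?thesis using upper[of u] u by (simp add: pos_divide_le_eq)
  qed
qed

subsection \<open>Consequences of the DFLY inequality\<close>

text \<open>Complex-linear operators on the strong space that satisfy the DFLY inequality, which is stated
  through the embedding: it holds for \<open>L\<close> and for all \<open>L\<^sub>k\<close> with the same constants.\<close>

definition dfly :: "('s \<Rightarrow>\<^sub>L 's) \<Rightarrow> bool"
  where "dfly T \<longleftrightarrow> clinear (blinfun_apply T) \<and>
    (\<forall>u. norm (T u) \<le> a * norm u + b * norm (\<iota> u) \<and> norm (\<iota> (T u)) \<le> M * norm (\<iota> u))"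

lemma dfly_L: "dfly Ls" and dfly_Lk: "1 \<le> k \<Longrightarrow> dfly (Lk k)"
  using L_strong L_weak Lk_strong Lk_weak L_clinear(1) Lk_clinear by (auto simp: dfly_def)

lemma dflyD: "dfly T \<Longrightarrow> norm (T u) \<le> a * norm u + b * norm (\<iota> u)"
  "dfly T \<Longrightarrow> norm (\<iota> (T u)) \<le> M * norm (\<iota> u)"
  "dfly T \<Longrightarrow> clinear (blinfun_apply T)"
  by (simp_all add: dfly_def)

lemma dfly_iterate:
  assumes T: "dfly T" and aM: "a < M"
  shows "norm (\<iota> ((blinfun_apply T ^^ n) u)) \<le> M ^ n * norm (\<iota> u)"
    "norm ((blinfun_apply T ^^ n) u) \<le> a ^ n * norm u + b / (M - a) * M ^ n * norm (\<iota> u)"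
proof -
  let ?T = "\<lambda>n. (blinfun_apply T ^^ n) u"
  show weak: "norm (\<iota> (?T n)) \<le> M ^ n * norm (\<iota> u)" for n
  proof (induction n)
    case (Suc n)
    have "norm (\<iota> (?T (Suc n))) \<le> M * norm (\<iota> (?T n))" using dflyD(2)[OF T] by simp
    also have "\<dots> \<le> M * (M ^ n * norm (\<iota> u))"
      using Suc.IH constants_pos(3) by (intro mult_left_mono) auto
    finally show ?case by simp
  qed simp
  show "norm (?T n) \<le> a ^ n * norm u + b / (M - a) * M ^ n * norm (\<iota> u)"
  proof (induction n)
    case 0
    show ?case using aM constants_pos by simp
  next
    case (Suc n)
    have "norm (?T (Suc n)) \<le> a * norm (?T n) + b * norm (\<iota> (?T n))" using dflyD(1)[OF T] by simp
    also have "\<dots> \<le> a * (a ^ n * norm u + b / (M - a) * M ^ n * norm (\<iota> u)) + b * (M ^ n * norm (\<iota> u))"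
      using Suc.IH weak[of n] constants_pos by (intro add_mono mult_left_mono) auto
    also have "\<dots> = a ^ Suc n * norm u + b / (M - a) * M ^ Suc n * norm (\<iota> u)"
      using aM by (simp add: field_simps)
    finally show ?case .
  qed
qed

text \<open>The constant of the Keller--Liverani estimate, for an operator whose resolvent on the strong space
  is bounded by \<open>C\<close>.\<close>

definition KL :: "real \<Rightarrow> real \<Rightarrow> real"
  where "KL \<mu> C = 1 / (M - \<mu>) + norm \<iota> * C + norm \<iota> * C * (b / (M - a))"

lemma KL_pos: "a < M \<Longrightarrow> \<mu> < M \<Longrightarrow> 0 \<le> C \<Longrightarrow> 0 < KL \<mu> C"
  unfolding KL_def using constants_pos by (intro add_pos_nonneg mult_nonneg_nonneg) auto

text \<open>The Keller--Liverani estimate: in the weak norm, \<open>R(z) g\<close> is bounded by the weak norm of \<open>g\<close>, up to a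
  multiple of the strong norm that is arbitrarily small for large \<open>n\<close>. It comes from the expansion of
  \<open>R(z)\<close> into the terms \<open>T\<^sup>j / z\<^bsup>j + 1\<^esup>\<close> with \<open>j < n\<close>, which are bounded on the weak space, and the
  remainder \<open>R(z) T\<^sup>n / z\<^sup>n\<close>, to which the iterated DFLY inequality applies.\<close>

lemma weak_resolvent_estimate:
  assumes T: "dfly T" and \<mu>: "a < \<mu>" "\<mu> < M" and z: "z \<in> resolvent_set T" "\<mu> \<le> cmod z"
    and C: "norm (resolvent T z) \<le> C"
  shows "norm (\<iota> (resolvent T z g)) \<le> KL \<mu> C * ((a / \<mu>) ^ n * norm g + (M / \<mu>) ^ n * norm (\<iota> g))"
proof -
  let ?R = "resolvent T z" and ?T = "\<lambda>n. (blinfun_apply T ^^ n) g"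
  have aM: "a < M" and \<mu>0: "0 < \<mu>" using \<mu> constants_pos by auto
  have C0: "0 \<le> C" using C norm_ge_zero order_trans by blast
  have R: "norm (\<iota> (?R x)) \<le> (norm (\<iota> x) + norm (\<iota> (?R (T x)))) / \<mu>" for x
  proof -
    have "z *\<^sub>C ?R x = x + ?R (T x)"
      using resolvent_cancel(1)[OF z(1), of x] resolvent_commute[OF dflyD(3)[OF T] z(1), of x]
      by (simp add: shift_def diff_eq_eq)
    then have "\<iota> (z *\<^sub>C ?R x) = \<iota> x + \<iota> (?R (T x))" by (simp add: blinfun.add_right)
    then have "cmod z * norm (\<iota> (?R x)) = norm (\<iota> x + \<iota> (?R (T x)))"
      by (simp add: clinear_scaleC[OF embedding(1)] flip: norm_scaleC)
    also have "\<dots> \<le> norm (\<iota> x) + norm (\<iota> (?R (T x)))" by (rule norm_triangle_ineq)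
    finally have "\<mu> * norm (\<iota> (?R x)) \<le> norm (\<iota> x) + norm (\<iota> (?R (T x)))"
      using mult_right_mono[OF z(2) norm_ge_zero[of "\<iota> (?R x)"]] by linarith
    then show ?thesis using \<mu>0 by (simp add: pos_le_divide_eq mult.commute)
  qed
  have "norm (\<iota> (?R g)) \<le> ((M / \<mu>) ^ n - 1) / (M - \<mu>) * norm (\<iota> g) + norm (\<iota> (?R (?T n))) / \<mu> ^ n" for n
  proof (induction n)
    case (Suc n)
    have "norm (\<iota> (?R (?T n))) \<le> (norm (\<iota> (?T n)) + norm (\<iota> (?R (?T (Suc n))))) / \<mu>"
      using R[of "?T n"] by simp
    also have "\<dots> \<le> (M ^ n * norm (\<iota> g) + norm (\<iota> (?R (?T (Suc n))))) / \<mu>"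
      using dfly_iterate(1)[OF T aM, of n g] \<mu>0 by (intro divide_right_mono add_right_mono) auto
    finally have "norm (\<iota> (?R (?T n))) / \<mu> ^ n \<le>
        (M ^ n * norm (\<iota> g) + norm (\<iota> (?R (?T (Suc n))))) / \<mu> / \<mu> ^ n"
      using \<mu>0 by (intro divide_right_mono) auto
    also have "\<dots> = (M / \<mu>) ^ n / \<mu> * norm (\<iota> g) + norm (\<iota> (?R (?T (Suc n)))) / \<mu> ^ Suc n"
      using \<mu>0 by (simp add: field_simps power_divide)
    also have "(M / \<mu>) ^ n / \<mu> * norm (\<iota> g) =
        ((M / \<mu>) ^ Suc n - 1) / (M - \<mu>) * norm (\<iota> g) - ((M / \<mu>) ^ n - 1) / (M - \<mu>) * norm (\<iota> g)"
    proof -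
      have "((M / \<mu>) ^ Suc n - 1) / (M - \<mu>) - ((M / \<mu>) ^ n - 1) / (M - \<mu>) =
          ((M / \<mu>) ^ Suc n - (M / \<mu>) ^ n) / (M - \<mu>)"
        by (simp add: diff_divide_distrib)
      also have "(M / \<mu>) ^ Suc n - (M / \<mu>) ^ n = (M / \<mu>) ^ n / \<mu> * (M - \<mu>)"
        using \<mu>0 by (simp add: right_diff_distrib)
      also have "\<dots> / (M - \<mu>) = (M / \<mu>) ^ n / \<mu>" using \<mu>(2) by simp
      finally show ?thesis unfolding left_diff_distrib[symmetric] by (simp only:)
    qed
    finally show ?case using Suc.IH by linarith
  qed simp
  then have 1: "norm (\<iota> (?R g)) \<le>
      ((M / \<mu>) ^ n - 1) / (M - \<mu>) * norm (\<iota> g) + norm (\<iota> (?R (?T n))) / \<mu> ^ n" .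
  have "((M / \<mu>) ^ n - 1) / (M - \<mu>) * norm (\<iota> g) \<le> (M / \<mu>) ^ n / (M - \<mu>) * norm (\<iota> g)"
    using \<mu>(2) by (intro mult_right_mono divide_right_mono) auto
  then have 2: "((M / \<mu>) ^ n - 1) / (M - \<mu>) * norm (\<iota> g) \<le>
      1 / (M - \<mu>) * ((M / \<mu>) ^ n * norm (\<iota> g))" by simp
  have expand: "norm \<iota> * (C * (a ^ n * norm g + B * M ^ n * norm (\<iota> g))) / \<mu> ^ n =
      norm \<iota> * C * ((a / \<mu>) ^ n * norm g) + norm \<iota> * C * B * ((M / \<mu>) ^ n * norm (\<iota> g))" for B
    using \<mu>0 by (simp add: power_divide field_simps)
  have "norm (\<iota> (?R (?T n))) \<le> norm \<iota> * (norm ?R * norm (?T n))" by (rule norm_blinfun_compose_apply)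
  also have "\<dots> \<le> norm \<iota> * (C * (a ^ n * norm g + b / (M - a) * M ^ n * norm (\<iota> g)))"
    using C dfly_iterate(2)[OF T aM, of n g] C0 by (intro mult_left_mono mult_mono) auto
  finally have "norm (\<iota> (?R (?T n))) / \<mu> ^ n \<le>
      norm \<iota> * (C * (a ^ n * norm g + b / (M - a) * M ^ n * norm (\<iota> g))) / \<mu> ^ n"
    using \<mu>0 by (intro divide_right_mono) auto
  also have "\<dots> =
      norm \<iota> * C * ((a / \<mu>) ^ n * norm g) + norm \<iota> * C * (b / (M - a)) * ((M / \<mu>) ^ n * norm (\<iota> g))"
    by (rule expand)
  finally have *: "norm (\<iota> (?R g)) \<le> 1 / (M - \<mu>) * ((M / \<mu>) ^ n * norm (\<iota> g)) +
      (norm \<iota> * C * ((a / \<mu>) ^ n * norm g) + norm \<iota> * C * (b / (M - a)) * ((M / \<mu>) ^ n * norm (\<iota> g)))"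
    using 1 2 by linarith
  define x y where "x = (a / \<mu>) ^ n * norm g" and "y = (M / \<mu>) ^ n * norm (\<iota> g)"
  have xy: "0 \<le> x" "0 \<le> y" using constants_pos \<mu>0 by (auto simp: x_def y_def)
  have pos: "0 \<le> 1 / (M - \<mu>)" "0 \<le> norm \<iota> * C" "0 \<le> norm \<iota> * C * (b / (M - a))"
    using \<mu> aM C0 constants_pos by auto
  have "1 / (M - \<mu>) * y + (norm \<iota> * C * x + norm \<iota> * C * (b / (M - a)) * y) \<le> KL \<mu> C * (x + y)"
    using mult_nonneg_nonneg[OF pos(1) xy(1)] mult_nonneg_nonneg[OF pos(3) xy(1)]
      mult_nonneg_nonneg[OF pos(2) xy(2)]
    unfolding KL_def distrib_left distrib_right by linarith
  with * show ?thesis unfolding x_def y_def by linarith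
qed

subsection \<open>The perturbation condition\<close>

text \<open>The perturbation condition makes \<open>z - L\<^sub>k - t (L - L\<^sub>k)\<close> bounded below on the strong space,
  uniformly in \<open>t\<close>: the DFLY inequality controls the strong norm by the weak one, and in the weak norm
  \<open>L - L\<^sub>k\<close> is a small perturbation of the invertible operator \<open>z - L\<^sub>k\<close>.\<close>

lemma dfly_certificate:
  assumes k: "1 \<le> k" and J: "jordan_domain U \<gamma>"
    and fr: "frontier U \<subseteq> resolvent_set (Lk k) \<inter> resolvent_set (Lwk k)"
    and less: "(SUP z\<in>frontier U. b * \<Delta> k * norm (resolvent (Lwk k) z)) < (INF z\<in>frontier U. cmod z - a)"
  shows "riesz Ls U \<gamma>" "riesz_rank (Lk k) \<gamma> = riesz_rank Ls \<gamma>"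
proof -
  define S where "S = (SUP z\<in>frontier U. b * \<Delta> k * norm (resolvent (Lwk k) z))"
  define I where "I = (INF z\<in>frontier U. cmod z - a)"
  have SI: "S < I" using less by (simp add: S_def I_def)
  have cpt: "compact (frontier U)" by (rule jordan_domain_frontier(2)[OF J])
  obtain C where C: "0 < C" "\<And>z. z \<in> frontier U \<Longrightarrow> norm (resolvent (Lwk k) z) \<le> C"
    using resolvent_bounded_on_compact[OF Lkw_clinear[OF k] _ cpt] fr by blast
  have b\<Delta>: "0 \<le> b * \<Delta> k" using constants_pos by simp
  have S: "b * \<Delta> k * norm (resolvent (Lwk k) z) \<le> S" if "z \<in> frontier U" for z
    unfolding S_def
    by (rule cSUP_upper[OF that], rule bdd_aboveI2[of _ _ "b * \<Delta> k * C"])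
      (rule mult_left_mono[OF C(2) b\<Delta>])
  have I: "I \<le> cmod z - a" if "z \<in> frontier U" for z
    unfolding I_def by (rule cINF_lower[OF _ that], rule bdd_belowI2[of _ "- a"]) simp
  define D where "D = 1 + b * C * norm \<iota>"
  have D: "0 < D" unfolding D_def using constants_pos C(1) by (intro add_pos_nonneg) auto
  have low: "((I - S) / D) * norm u \<le> norm (shift (Lk k + t *\<^sub>R (Ls - Lk k)) z u)"
    if t: "0 \<le> t" "t \<le> 1" and z: "z \<in> frontier U" for t z u
  proof -
    let ?A = "Lk k + t *\<^sub>R (Ls - Lk k)" and ?R = "resolvent (Lwk k) z"
    define f where "f = shift ?A z u"
    have zw: "z \<in> resolvent_set (Lwk k)" using z fr by blast
    have "?A u = (1 - t) *\<^sub>R Lk k u + t *\<^sub>R Ls u"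
      by (simp add: blinfun.add_left blinfun.diff_left blinfun.scaleR_left algebra_simps)
    then have "norm (?A u) \<le> (1 - t) * norm (Lk k u) + t * norm (Ls u)"
      using t norm_triangle_ineq[of "(1 - t) *\<^sub>R Lk k u" "t *\<^sub>R Ls u"] by simp
    also have "\<dots> \<le> (1 - t) * (a * norm u + b * norm (\<iota> u)) + t * (a * norm u + b * norm (\<iota> u))"
      using t dflyD(1)[OF dfly_L, of u] dflyD(1)[OF dfly_Lk[OF k], of u]
      by (intro add_mono mult_left_mono) auto
    finally have Au: "norm (?A u) \<le> a * norm u + b * norm (\<iota> u)" by (simp add: algebra_simps)
    have "z *\<^sub>C u = f + ?A u" by (simp add: f_def shift_def)
    then have "cmod z * norm u \<le> norm f + norm (?A u)"
      by (metis norm_scaleC norm_triangle_ineq)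
    with Au have strong: "(cmod z - a) * norm u \<le> norm f + b * norm (\<iota> u)"
      by (simp add: algebra_simps)
    have "shift (Lk k) z u = f + t *\<^sub>R ((Ls - Lk k) u)"
      by (simp add: f_def shift_def blinfun.add_left blinfun.scaleR_left)
    then have "shift (Lwk k) z (\<iota> u) = \<iota> f + t *\<^sub>R \<iota> ((Ls - Lk k) u)"
      by (simp add: blinfun.add_right blinfun.scaleR_right flip: embed_shift_Lk[OF k])
    then have "norm (\<iota> u) \<le> norm ?R * norm (\<iota> f + t *\<^sub>R \<iota> ((Ls - Lk k) u))"
      using resolvent_bounded_below[OF zw, of "\<iota> u"] by simp
    also have "\<dots> \<le> norm ?R * (norm \<iota> * norm f + \<Delta> k * norm u)"
    proof (rule mult_left_mono)
      have "norm (\<iota> f + t *\<^sub>R \<iota> ((Ls - Lk k) u)) \<le> norm (\<iota> f) + t * norm (\<iota> ((Ls - Lk k) u))"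
        using t norm_triangle_ineq[of "\<iota> f" "t *\<^sub>R \<iota> ((Ls - Lk k) u)"] by simp
      also have "t * norm (\<iota> ((Ls - Lk k) u)) \<le> 1 * norm (\<iota> ((Ls - Lk k) u))"
        using t by (intro mult_right_mono) auto
      finally show "norm (\<iota> f + t *\<^sub>R \<iota> ((Ls - Lk k) u)) \<le> norm \<iota> * norm f + \<Delta> k * norm u"
        using embed_diff_le[of k u] norm_blinfun[of \<iota> f] by linarith
    qed simp
    finally have "b * norm (\<iota> u) \<le> b * (norm ?R * (norm \<iota> * norm f + \<Delta> k * norm u))"
      using constants_pos by (intro mult_left_mono) auto
    also have "\<dots> = b * norm ?R * (norm \<iota> * norm f) + (b * \<Delta> k * norm ?R) * norm u"
      by (simp add: algebra_simps)
    also have "b * norm ?R * (norm \<iota> * norm f) \<le> b * C * (norm \<iota> * norm f)"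
      using C(2)[OF z] constants_pos by (intro mult_right_mono mult_left_mono) auto
    finally have weak: "b * norm (\<iota> u) \<le> b * C * (norm \<iota> * norm f) + (b * \<Delta> k * norm ?R) * norm u"
      by simp
    have "(b * \<Delta> k * norm ?R) * norm u \<le> S * norm u" using S[OF z] by (rule mult_right_mono) simp
    moreover have "I * norm u \<le> (cmod z - a) * norm u" using I[OF z] by (rule mult_right_mono) simp
    ultimately have "(I - S) * norm u \<le> D * norm f"
      using strong weak by (simp add: D_def algebra_simps)
    then show ?thesis using D by (simp add: f_def field_simps)
  qed
  have "riesz (Lk k) U \<gamma>" using fr J by (intro riesz.intro Lk_clinear k) auto
  moreover have "0 < (I - S) / D" using SI D by simp
  ultimately show "riesz Ls U \<gamma>" "riesz_rank (Lk k) \<gamma> = riesz_rank Ls \<gamma>"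
    using riesz_rank_homotopy[OF _ L_clinear(1) _ low] by blast+
qed

subsection \<open>Uniform resolvent bounds\<close>

lemma dfly_strong_le:
  assumes T: "dfly T" and z: "a + h \<le> cmod z" "0 < h"
  shows "norm u \<le> (norm (shift T z u) + b * norm (\<iota> u)) / h"
proof -
  have "z *\<^sub>C u = shift T z u + T u" by (simp add: shift_def)
  then have "cmod z * norm u \<le> norm (shift T z u) + norm (T u)"
    by (metis norm_scaleC norm_triangle_ineq)
  moreover have "(a + h) * norm u \<le> cmod z * norm u" using z(1) by (rule mult_right_mono) simp
  ultimately have "h * norm u \<le> norm (shift T z u) + b * norm (\<iota> u)"
    using dflyD(1)[OF T, of u] by (simp add: algebra_simps)
  then show ?thesis using z(2) by (simp add: field_simps)
qed

lemma diff_strong_le: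
  assumes "1 \<le> k"
  shows "norm ((Ls - Lk k) u) \<le> 2 * a * norm u + 2 * b * norm (\<iota> u)"
  using norm_triangle_ineq4[of "Ls u" "Lk k u"] dflyD(1)[OF dfly_L, of u]
    dflyD(1)[OF dfly_Lk[OF assms], of u]
  by (simp add: blinfun.diff_left)

text \<open>For large \<open>k\<close> the resolvents of \<open>L\<^sub>k\<close> on the strong space are bounded uniformly in \<open>k\<close>. With
  \<open>(z - L\<^sub>k) u = f\<close>, one has \<open>u = R(z) g\<close> for \<open>g = f - (L - L\<^sub>k) u\<close>, where \<open>(L - L\<^sub>k) u\<close> is bounded in the
  strong norm and small in the weak norm, relative to \<open>u\<close>, and the DFLY inequality bounds the strong
  norm of \<open>u\<close> by \<open>f\<close> and its weak norm. The Keller--Liverani estimate for \<open>L\<close>, with \<open>n\<close> fixed first and \<open>k\<close>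
  large afterwards, bounds the weak norm of \<open>u\<close> by \<open>f\<close> plus half of itself.\<close>

lemma strong_resolvents_bounded:
  assumes \<mu>: "a < \<mu>" "\<mu> < M" and S: "compact S" "S \<subseteq> resolvent_set Ls" "\<And>z. z \<in> S \<Longrightarrow> \<mu> \<le> cmod z"
  obtains D k0 where "0 < D" "1 \<le> k0" "\<And>z. z \<in> S \<Longrightarrow> norm (resolvent Ls z) \<le> D"
    "\<And>k z. k0 \<le> k \<Longrightarrow> z \<in> S \<Longrightarrow> z \<in> resolvent_set (Lk k) \<and> norm (resolvent (Lk k) z) \<le> D"
proof -
  obtain C where C: "0 < C" "\<And>z. z \<in> S \<Longrightarrow> norm (resolvent Ls z) \<le> C"
    using resolvent_bounded_on_compact[OF L_clinear(1) S(2,1)] by blast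
  define K where "K = KL \<mu> C"
  define h where "h = \<mu> - a"
  define G1 G2 where "G1 = 1 + 2 * a / h" and "G2 = 2 * a * b / h + 2 * b"
  have h: "0 < h" using \<mu> by (simp add: h_def)
  have K: "0 < K" unfolding K_def using \<mu> C(1) by (intro KL_pos) auto
  have G: "0 < G1" "0 < G2" using h constants_pos by (auto simp: G1_def G2_def intro!: add_pos_pos)
  have "(\<lambda>n. (a / \<mu>) ^ n) \<longlonglongrightarrow> 0"
    using \<mu> constants_pos by (intro LIMSEQ_realpow_zero) auto
  then have "(\<lambda>n. K * ((a / \<mu>) ^ n * G2)) \<longlonglongrightarrow> 0"
    by (intro tendsto_mult_right_zero tendsto_mult_left_zero)
  then have "\<forall>\<^sub>F n in sequentially. K * ((a / \<mu>) ^ n * G2) < 1 / 4"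
    by (rule order_tendstoD(2)) simp
  then obtain n where n: "K * ((a / \<mu>) ^ n * G2) < 1 / 4"
    by (auto simp: eventually_sequentially)
  define X where "X = (M / \<mu>) ^ n"
  have X: "0 < X" using \<mu> constants_pos by (simp add: X_def)
  have "(\<lambda>k. K * (X * (\<Delta> k * (b / h)))) \<longlonglongrightarrow> 0"
    by (intro tendsto_mult_right_zero tendsto_mult_left_zero Lk_converges)
  then have "\<forall>\<^sub>F k in sequentially. K * (X * (\<Delta> k * (b / h))) < 1 / 4"
    by (rule order_tendstoD(2)) simp
  moreover have "\<forall>\<^sub>F k in sequentially. \<Delta> k < 1"
    by (rule order_tendstoD(2)[OF Lk_converges]) simp
  ultimately have "\<forall>\<^sub>F k in sequentially. K * (X * (\<Delta> k * (b / h))) < 1 / 4 \<and> \<Delta> k < 1"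
    by (rule eventually_conj)
  then obtain k1 where k1: "\<And>k. k1 \<le> k \<Longrightarrow> K * (X * (\<Delta> k * (b / h))) < 1 / 4 \<and> \<Delta> k < 1"
    by (auto simp: eventually_sequentially)
  define H where "H = K * ((a / \<mu>) ^ n * G1 + X * (norm \<iota> + 1 / h))"
  have H: "0 \<le> H" unfolding H_def using K G X h constants_pos \<mu> by (intro mult_nonneg_nonneg add_nonneg_nonneg) auto
  define D where "D = (1 + b * (2 * H)) / h"
  have D: "0 < D" unfolding D_def using H h constants_pos by (intro divide_pos_pos add_pos_nonneg) auto
  have *: "z \<in> resolvent_set (Lk k) \<and> norm (resolvent (Lk k) z) \<le> D"
    if k: "max 1 k1 \<le> k" and z: "z \<in> S" for k z
  proof -
    have k': "1 \<le> k" "k1 \<le> k" using k by auto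
    have zL: "z \<in> resolvent_set Ls" using z S(2) by blast
    have z\<mu>: "\<mu> \<le> cmod z" by (rule S(3)[OF z])
    have low: "norm u \<le> D * norm (shift (Lk k) z u)" for u
    proof -
      define F w where "F = norm (shift (Lk k) z u)" and "w = norm (\<iota> u)"
      define g where "g = shift Ls z u"
      have Fw: "0 \<le> F" "0 \<le> w" by (simp_all add: F_def w_def)
      have u: "norm u \<le> (F + b * w) / h"
        unfolding F_def w_def using z\<mu> h by (intro dfly_strong_le dfly_Lk k') (simp_all add: h_def)
      have g: "g = shift (Lk k) z u - (Ls - Lk k) u"
        by (simp add: g_def shift_def blinfun.diff_left)
      have "norm g \<le> F + norm ((Ls - Lk k) u)" unfolding g F_def by (rule norm_triangle_ineq4)
      also have "\<dots> \<le> F + (2 * a * norm u + 2 * b * w)"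
        unfolding w_def by (intro add_left_mono diff_strong_le k')
      also have "\<dots> \<le> F + (2 * a * ((F + b * w) / h) + 2 * b * w)"
        using u constants_pos by (intro add_left_mono add_right_mono mult_left_mono) auto
      also have "\<dots> = G1 * F + G2 * w" using h by (simp add: G1_def G2_def field_simps)
      finally have g_s: "norm g \<le> G1 * F + G2 * w" .
      have "norm (\<iota> g) \<le> norm (\<iota> (shift (Lk k) z u)) + norm (\<iota> ((Ls - Lk k) u))"
        unfolding g by (simp only: blinfun.diff_right norm_triangle_ineq4)
      also have "norm (\<iota> (shift (Lk k) z u)) \<le> norm \<iota> * F" unfolding F_def by (rule norm_blinfun)
      also have "norm (\<iota> ((Ls - Lk k) u)) \<le> \<Delta> k * ((F + b * w) / h)"
        by (rule order_trans[OF embed_diff_le mult_left_mono[OF u]]) simp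
      finally have g_w: "norm (\<iota> g) \<le> norm \<iota> * F + \<Delta> k * ((F + b * w) / h)" by simp
      have "w = norm (\<iota> (resolvent Ls z g))" by (simp add: g_def w_def resolvent_cancel zL)
      also have "\<dots> \<le> K * ((a / \<mu>) ^ n * norm g + X * norm (\<iota> g))"
        unfolding K_def X_def by (rule weak_resolvent_estimate[OF dfly_L \<mu> zL z\<mu> C(2)[OF z]])
      also have "\<dots> \<le> K * ((a / \<mu>) ^ n * (G1 * F + G2 * w) + X * (norm \<iota> * F + \<Delta> k * ((F + b * w) / h)))"
        using g_s g_w K X \<mu> constants_pos by (intro mult_left_mono add_mono) auto
      also have "\<dots> = K * ((a / \<mu>) ^ n * G1 + X * (norm \<iota> + \<Delta> k / h)) * F +
          (K * ((a / \<mu>) ^ n * G2) + K * (X * (\<Delta> k * (b / h)))) * w"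
        by (simp add: algebra_simps add_divide_distrib)
      also have "\<dots> \<le> H * F + (1 / 4 + 1 / 4) * w"
      proof (intro add_mono mult_right_mono Fw)
        show "K * ((a / \<mu>) ^ n * G1 + X * (norm \<iota> + \<Delta> k / h)) \<le> H"
          unfolding H_def using K X h k1[OF k'(2)]
          by (intro mult_left_mono add_mono order_refl divide_right_mono) auto
        show "K * ((a / \<mu>) ^ n * G2) \<le> 1 / 4" "K * (X * (\<Delta> k * (b / h))) \<le> 1 / 4"
          using n k1[OF k'(2)] by auto
      qed
      finally have "w \<le> 2 * H * F" by simp
      then have "(F + b * w) / h \<le> (F + b * (2 * H * F)) / h"
        using h constants_pos by (intro divide_right_mono add_left_mono mult_left_mono) auto
      also have "\<dots> = D * F" by (simp add: D_def algebra_simps)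
      finally show ?thesis using u by (simp add: F_def)
    qed
    have "surj (shift (Lk k) z)"
    proof (rule finite_rank_shift_surj[OF Lk_clinear[OF k'(1)] Lk_finite_rank[OF k'(1)]])
      show "z \<noteq> 0" using z\<mu> \<mu> constants_pos by auto
      show "u = 0" if "shift (Lk k) z u = 0" for u using low[of u] that by simp
    qed
    moreover have "1 / D * norm u \<le> norm (shift (Lk k) z u)" for u
      using low[of u] D by (simp add: field_simps)
    ultimately show ?thesis using resolvent_setI[of "Lk k" z "1 / D"] D by simp
  qed
  show ?thesis
  proof (rule that[of "max C D" "max 1 k1"])
    show "norm (resolvent Ls z) \<le> max C D" if "z \<in> S" for z using C(2)[OF that] by simp
    show "z \<in> resolvent_set (Lk k) \<and> norm (resolvent (Lk k) z) \<le> max C D"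
      if "max 1 k1 \<le> k" "z \<in> S" for k z using *[OF that] by auto
  qed (use C(1) in auto)
qed

text \<open>The exponent \<open>n \<approx> ln E / ln (M / a)\<close> balances the two terms of the Keller--Liverani estimate; this
  is where the exponent \<open>q\<close> of the rate condition comes from.\<close>

lemma balanced_exponent:
  fixes E q :: real
  assumes \<mu>: "a < \<mu>" "\<mu> < M" and q: "q = \<bar>ln (\<mu> / M)\<bar> / \<bar>ln (a / M)\<bar>" and E: "0 \<le> E"
  obtains n where "(a / \<mu>) ^ n * E + (M / \<mu>) ^ n \<le> (2 + \<mu> / a) * (1 + E powr q)"
proof (cases "E \<le> 1")
  case True
  have "0 \<le> \<mu> / a" using \<mu> constants_pos by simp
  then have "(a / \<mu>) ^ 0 * E + (M / \<mu>) ^ 0 \<le> (2 + \<mu> / a) * (1 + 0)"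
    using True by simp
  also have "\<dots> \<le> (2 + \<mu> / a) * (1 + E powr q)"
    using \<mu> constants_pos by (intro mult_left_mono) auto
  finally show ?thesis by (rule that)
next
  case False
  have pos: "0 < a" "0 < \<mu>" "0 < M" "0 < E" using \<mu> constants_pos False by auto
  have ln1: "ln (\<mu> / M) < 0" "ln (a / M) < 0" using \<mu> pos by (auto simp: ln_div)
  then have q': "q = ln (M / \<mu>) / ln (M / a)" unfolding q using pos by (simp add: ln_div)
  have lnMa: "0 < ln (M / a)" using \<mu> pos by (simp add: ln_div)
  define x where "x = ln E / ln (M / a)"
  have x: "0 \<le> x" using lnMa False by (simp add: x_def)
  define n where "n = nat \<lfloor>x\<rfloor>"
  have n: "real n \<le> x" "x - 1 \<le> real n" using x unfolding n_def by linarith+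
  have Mx: "(M / \<mu>) powr x = E powr q"
    using pos by (simp add: powr_def q' x_def)
  have "(M / \<mu>) ^ n = (M / \<mu>) powr real n" using pos by (simp add: powr_realpow)
  also have "\<dots> \<le> (M / \<mu>) powr x" using n(1) \<mu> pos by (intro powr_mono) auto
  finally have 1: "(M / \<mu>) ^ n \<le> E powr q" using Mx by simp
  have "(a / \<mu>) ^ n = (a / \<mu>) powr real n" using pos by (simp add: powr_realpow)
  also have "\<dots> \<le> (a / \<mu>) powr (x - 1)" using n(2) \<mu> pos by (intro powr_mono') auto
  also have "\<dots> = (a / \<mu>) powr x * (\<mu> / a)" using pos by (simp add: powr_diff)
  finally have "(a / \<mu>) ^ n * E \<le> (a / \<mu>) powr x * (\<mu> / a) * E"
    using pos by (intro mult_right_mono) auto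
  also have "(a / \<mu>) powr x * (\<mu> / a) * E = (\<mu> / a) * ((a / \<mu>) powr x * E)" by simp
  also have "E = (M / a) powr x" using pos lnMa by (simp add: powr_def x_def)
  then have "(a / \<mu>) powr x * E = (M / \<mu>) powr x"
    using pos by (simp flip: powr_mult)
  finally have 2: "(a / \<mu>) ^ n * E \<le> (\<mu> / a) * E powr q" using Mx by simp
  have "(a / \<mu>) ^ n * E + (M / \<mu>) ^ n \<le> (1 + \<mu> / a) * E powr q"
    using 1 2 by (simp add: algebra_simps)
  also have "\<dots> \<le> (2 + \<mu> / a) * (1 + E powr q)"
    using pos by (intro mult_mono) auto
  finally show ?thesis by (rule that)
qed

text \<open>On the weak space the Keller--Liverani estimate is applied to \<open>L\<^sub>k\<close> itself, on the range of \<open>\<pi>\<^sub>k\<close>, where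
  the strong norm is at most \<open>E\<^sub>k\<close> times the weak one; on the kernel of \<open>\<pi>\<^sub>k\<close>, the operator \<open>z - L\<^sub>k\<close> is
  multiplication by \<open>z\<close>.\<close>

lemma weak_resolvent_bound:
  assumes k: "1 \<le> k" and \<mu>: "a < \<mu>" "\<mu> < M" and q: "q = \<bar>ln (\<mu> / M)\<bar> / \<bar>ln (a / M)\<bar>"
    and z: "z \<in> resolvent_set (Lk k)" "\<mu> \<le> cmod z" and D: "norm (resolvent (Lk k) z) \<le> D"
  shows "z \<in> resolvent_set (Lwk k)"
    "norm (resolvent (Lwk k) z) \<le> (KL \<mu> D * (2 + \<mu> / a) + 2 / \<mu>) * (1 + Ek k powr q)"
proof -
  let ?p = "\<pi>w k" and ?T = "Lwk k"
  define W where "W = (KL \<mu> D * (2 + \<mu> / a) + 2 / \<mu>) * (1 + Ek k powr q)"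
  have pos: "0 < a" "0 < \<mu>" "0 < M" using \<mu> constants_pos by auto
  have D0: "0 \<le> D" using D norm_ge_zero order_trans by blast
  have K: "0 < KL \<mu> D" using \<mu> D0 by (intro KL_pos) auto
  have z0: "z \<noteq> 0" using z(2) pos by auto
  have p_norm: "norm (?p v) \<le> norm v" for v
    using norm_blinfun[of ?p v] mult_right_mono[OF pi_norm(1)[OF k], of "norm v"] by simp
  note p_lin = pi_clinear(2)[OF k]
  have low: "norm v \<le> W * norm (shift ?T z v)" for v
  proof -
    define f where "f = shift ?T z v"
    have pf: "?p f = shift ?T z (?p v)"
      by (simp add: f_def shift_def blinfun.diff_right clinear_scaleC[OF p_lin] compression_apply pi_pi[OF k])
    \<comment> \<open>\<open>\<pi>\<^sub>k L\<^sub>k = L\<^sub>k = L\<^sub>k \<pi>\<^sub>k\<close>, so the components in the range and in the kernel decouple.\<close>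
    have "f - ?p f = z *\<^sub>C (v - ?p v)"
      unfolding pf by (simp add: f_def shift_def scaleC_algebra compression_apply pi_pi[OF k])
    then have "cmod z * norm (v - ?p v) = norm (f - ?p f)" by (simp add: norm_scaleC)
    also have "\<dots> \<le> 2 * norm f" using norm_triangle_ineq4[of f "?p f"] p_norm[of f] by simp
    finally have "\<mu> * norm (v - ?p v) \<le> 2 * norm f"
      using mult_right_mono[OF z(2) norm_ge_zero[of "v - ?p v"]] by linarith
    then have compl: "norm (v - ?p v) \<le> 2 / \<mu> * norm f" using pos by (simp add: field_simps)
    obtain u where u: "\<iota> u = ?p v" using pi_range[OF k] by (metis rangeE rangeI subsetD)
    obtain g where g: "\<iota> g = ?p f" using pi_range[OF k] by (metis rangeE rangeI subsetD)
    have "\<iota> (shift (Lk k) z u) = \<iota> g" by (simp add: embed_shift_Lk[OF k] u g pf)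
    then have "shift (Lk k) z u = g" using embedding(2) by (simp add: inj_eq)
    then have Rg: "resolvent (Lk k) z g = u" using resolvent_cancel(2)[OF z(1), of u] by simp
    have "\<iota> g \<in> range (blinfun_apply ?p)" by (simp add: g)
    note E = strong_le_weak[OF k this]
    obtain n where n: "(a / \<mu>) ^ n * Ek k + (M / \<mu>) ^ n \<le> (2 + \<mu> / a) * (1 + Ek k powr q)"
      using balanced_exponent[OF \<mu> q E(2)] .
    have "norm (?p v) \<le> KL \<mu> D * ((a / \<mu>) ^ n * norm g + (M / \<mu>) ^ n * norm (\<iota> g))"
      using weak_resolvent_estimate[OF dfly_Lk[OF k] \<mu> z D, of g n] by (simp add: Rg u)
    also have "\<dots> \<le> KL \<mu> D * ((a / \<mu>) ^ n * (Ek k * norm (\<iota> g)) + (M / \<mu>) ^ n * norm (\<iota> g))"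
      using E(1) K pos by (intro mult_left_mono add_right_mono) auto
    also have "\<dots> = KL \<mu> D * (((a / \<mu>) ^ n * Ek k + (M / \<mu>) ^ n) * norm (\<iota> g))"
      by (simp add: algebra_simps)
    also have "\<dots> \<le> KL \<mu> D * (((2 + \<mu> / a) * (1 + Ek k powr q)) * norm f)"
      using n K p_norm[of f] pos by (intro mult_left_mono mult_mono) (auto simp: g)
    finally have "norm (?p v) \<le> KL \<mu> D * (((2 + \<mu> / a) * (1 + Ek k powr q)) * norm f)" .
    moreover have "norm v \<le> norm (?p v) + norm (v - ?p v)"
      using norm_triangle_ineq[of "?p v" "v - ?p v"] by simp
    moreover have "2 / \<mu> * 1 \<le> 2 / \<mu> * (1 + Ek k powr q)"
      using pos by (intro mult_left_mono) auto
    then have "2 / \<mu> * norm f \<le> 2 / \<mu> * (1 + Ek k powr q) * norm f"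
      by (intro mult_right_mono) auto
    ultimately have "norm v \<le> KL \<mu> D * (((2 + \<mu> / a) * (1 + Ek k powr q)) * norm f) +
        2 / \<mu> * (1 + Ek k powr q) * norm f"
      using compl by linarith
    also have "\<dots> = W * norm f" by (simp add: W_def algebra_simps add_divide_distrib)
    finally show ?thesis by (simp add: f_def)
  qed
  have W: "0 < W"
    unfolding W_def using K pos by (intro mult_pos_pos add_pos_nonneg) auto
  have surj: "surj (shift ?T z)"
  proof (rule finite_rank_shift_surj[OF Lkw_clinear[OF k] Lkw_finite_rank[OF k] z0])
    show "v = 0" if "shift ?T z v = 0" for v using low[of v] that by simp
  qed
  have low': "1 / W * norm v \<le> norm (shift ?T z v)" for v
    using low[of v] W by (simp add: field_simps)
  show "z \<in> resolvent_set ?T" using resolvent_setI(1)[OF surj _ low'] W by simp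
  show "norm (resolvent ?T z) \<le> (KL \<mu> D * (2 + \<mu> / a) + 2 / \<mu>) * (1 + Ek k powr q)"
    using resolvent_setI(2)[OF surj _ low'] W by (simp add: W_def)
qed

subsection \<open>Convergence of spectral data\<close>

lemma dfly_case_domain:
  assumes \<mu>: "a < \<mu>" "\<mu> < M" and q: "q = \<bar>ln (\<mu> / M)\<bar> / \<bar>ln (a / M)\<bar>"
    and rate: "(\<lambda>k. \<Delta> k * Ek k powr q) \<longlonglongrightarrow> 0"
    and J: "jordan_domain U \<gamma>" and fr: "frontier U \<subseteq> resolvent_set Ls"
    and z\<mu>: "\<And>z. z \<in> frontier U \<Longrightarrow> \<mu> \<le> cmod z"
  shows "\<exists>k0\<ge>1. \<forall>k\<ge>k0.
      frontier U \<subseteq> resolvent_set (Lk k) \<inter> resolvent_set (Lwk k) \<and>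
      riesz_rank (Lk k) \<gamma> = riesz_rank Ls \<gamma> \<and>
      (SUP z\<in>frontier U. b * \<Delta> k * norm (resolvent (Lwk k) z)) < (INF z\<in>frontier U. cmod z - a)"
proof -
  note ne = jordan_domain_frontier(1)[OF J]
  obtain D k1 where D: "0 < D" "1 \<le> k1" "\<And>z. z \<in> frontier U \<Longrightarrow> norm (resolvent Ls z) \<le> D"
    "\<And>k z. k1 \<le> k \<Longrightarrow> z \<in> frontier U \<Longrightarrow> z \<in> resolvent_set (Lk k) \<and> norm (resolvent (Lk k) z) \<le> D"
    by (rule strong_resolvents_bounded[OF \<mu> jordan_domain_frontier(2)[OF J] fr z\<mu>]) (assumption, rule that)
  define W where "W = KL \<mu> D * (2 + \<mu> / a) + 2 / \<mu>"
  have "(\<lambda>k. b * W * (\<Delta> k + \<Delta> k * Ek k powr q)) \<longlonglongrightarrow> b * W * (0 + 0)"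
    by (intro tendsto_mult_left tendsto_add Lk_converges rate)
  then have "\<forall>\<^sub>F k in sequentially. b * W * (\<Delta> k + \<Delta> k * Ek k powr q) < \<mu> - a"
    using \<mu>(1) by (intro order_tendstoD(2)) auto
  then obtain k2 where k2: "\<And>k. k2 \<le> k \<Longrightarrow> b * W * (\<Delta> k + \<Delta> k * Ek k powr q) < \<mu> - a"
    by (auto simp: eventually_sequentially)
  show ?thesis
  proof (intro exI[of _ "max k1 k2"] conjI allI impI)
    show "1 \<le> max k1 k2" using D(2) by simp
    fix k assume k: "max k1 k2 \<le> k"
    then have k': "1 \<le> k" "k1 \<le> k" "k2 \<le> k" using D(2) by auto
    have zk: "z \<in> resolvent_set (Lk k)" "norm (resolvent (Lk k) z) \<le> D" if "z \<in> frontier U" for z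
      using D(4)[OF k'(2) that] by auto
    have w: "z \<in> resolvent_set (Lwk k)" "norm (resolvent (Lwk k) z) \<le> W * (1 + Ek k powr q)"
      if "z \<in> frontier U" for z
      unfolding W_def
      using weak_resolvent_bound[OF k'(1) \<mu> q zk(1)[OF that] z\<mu>[OF that] zk(2)[OF that]] by auto
    show fr': "frontier U \<subseteq> resolvent_set (Lk k) \<inter> resolvent_set (Lwk k)" using zk w by blast
    have "b * \<Delta> k * norm (resolvent (Lwk k) z) \<le> b * W * (\<Delta> k + \<Delta> k * Ek k powr q)"
      if "z \<in> frontier U" for z
    proof -
      have "b * \<Delta> k * norm (resolvent (Lwk k) z) \<le> b * \<Delta> k * (W * (1 + Ek k powr q))"
        using w(2)[OF that] constants_pos by (intro mult_left_mono) auto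
      then show ?thesis by (simp add: algebra_simps)
    qed
    then have "(SUP z\<in>frontier U. b * \<Delta> k * norm (resolvent (Lwk k) z)) \<le>
        b * W * (\<Delta> k + \<Delta> k * Ek k powr q)"
      by (rule cSUP_least[OF ne])
    also have "\<dots> < \<mu> - a" by (rule k2[OF k'(3)])
    also have "\<dots> \<le> (INF z\<in>frontier U. cmod z - a)"
      using z\<mu> by (intro cINF_greatest ne) auto
    finally show less: "(SUP z\<in>frontier U. b * \<Delta> k * norm (resolvent (Lwk k) z)) <
        (INF z\<in>frontier U. cmod z - a)" .
    show "riesz_rank (Lk k) \<gamma> = riesz_rank Ls \<gamma>"
      by (rule dfly_certificate(2)[OF k'(1) J fr' less])
  qed
qed

lemma embed_compose_scaleC:
  "\<iota> o\<^sub>L (c *\<^sub>C X) = c *\<^sub>C (\<iota> o\<^sub>L X)" for X :: "'s \<Rightarrow>\<^sub>L 's"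
  by (rule blinfun_eqI) (simp add: clinear_scaleC[OF embedding(1)])

lemma weak_projector_diff_le:
  assumes A: "riesz A U \<gamma>" and B: "riesz B U \<gamma>"
    and e: "\<And>z. z \<in> frontier U \<Longrightarrow> norm (\<iota> o\<^sub>L (resolvent A z - resolvent B z)) \<le> e"
  shows "norm (\<iota> o\<^sub>L (riesz_projector A \<gamma> - riesz_projector B \<gamma>)) \<le> max_speed \<gamma> * e / (2 * pi)"
proof -
  interpret A: riesz A U \<gamma> by (rule A)
  interpret B: riesz B U \<gamma> by (rule B)
  have cont: "continuous_on (path_image \<gamma>) (\<lambda>z. resolvent A z - resolvent B z)"
    by (intro continuous_on_diff A.continuous_resolvent B.continuous_resolvent)
  have lin: "bounded_linear (\<lambda>X::'s \<Rightarrow>\<^sub>L 's. \<iota> o\<^sub>L X)"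
    by (rule bounded_bilinear.bounded_linear_right[OF bounded_bilinear_blinfun_compose])
  have "riesz_projector A \<gamma> - riesz_projector B \<gamma> =
      (1 / (2 * complex_of_real pi * \<i>)) *\<^sub>C vector_contour_integral \<gamma> (\<lambda>z. resolvent A z - resolvent B z)"
    by (simp add: riesz_projector_def scaleC_algebra
        vector_contour_integral_diff[OF A.contour A.continuous_resolvent B.continuous_resolvent])
  then have "norm (\<iota> o\<^sub>L (riesz_projector A \<gamma> - riesz_projector B \<gamma>)) =
      norm (\<iota> o\<^sub>L vector_contour_integral \<gamma> (\<lambda>z. resolvent A z - resolvent B z)) / (2 * pi)"
    by (simp add: embed_compose_scaleC norm_scaleC norm_divide norm_mult)
  also have "\<iota> o\<^sub>L vector_contour_integral \<gamma> (\<lambda>z. resolvent A z - resolvent B z) =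
      vector_contour_integral \<gamma> (\<lambda>z. \<iota> o\<^sub>L (resolvent A z - resolvent B z))"
    by (rule vector_contour_integral_linear[OF A.contour cont lin embed_compose_scaleC])
  also have "norm \<dots> / (2 * pi) \<le> max_speed \<gamma> * e / (2 * pi)"
    using e by (intro divide_right_mono vector_contour_integral_bound A.contour
        bounded_linear.continuous_on[OF lin] cont) (auto simp: A.image)
  finally show ?thesis .
qed

lemma dfly_case_projectors:
  assumes \<mu>: "a < \<mu>" "\<mu> < M" and L: "riesz Ls U \<gamma>"
    and z\<mu>: "\<And>z. z \<in> frontier U \<Longrightarrow> \<mu> \<le> cmod z"
  shows "(\<lambda>k. norm (\<iota> o\<^sub>L (riesz_projector (Lk k) \<gamma> - riesz_projector Ls \<gamma>))) \<longlonglongrightarrow> 0"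
proof -
  interpret L: riesz Ls U \<gamma> by (rule L)
  obtain D k1 where D: "0 < D" "1 \<le> k1" "\<And>z. z \<in> frontier U \<Longrightarrow> norm (resolvent Ls z) \<le> D"
    "\<And>k z. k1 \<le> k \<Longrightarrow> z \<in> frontier U \<Longrightarrow> z \<in> resolvent_set (Lk k) \<and> norm (resolvent (Lk k) z) \<le> D"
    by (rule strong_resolvents_bounded[OF \<mu> jordan_domain_frontier(2)[OF L.jordan] L.frontier z\<mu>])
      (assumption, rule that)
  define G where "G = 2 * a + 2 * b * norm \<iota>"
  define K where "K = KL \<mu> D"
  define S where "S = max_speed \<gamma> / (2 * pi)"
  have G: "0 \<le> G" using constants_pos by (simp add: G_def)
  have K: "0 < K" unfolding K_def using \<mu> D(1) by (intro KL_pos) auto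
  have S: "0 \<le> S" unfolding S_def using max_speed_nonneg[OF L.contour] by simp
  have pos: "0 < \<mu>" "0 < a" "0 < M" using \<mu> constants_pos by auto
  let ?e = "\<lambda>n k. K * ((a / \<mu>) ^ n * (G * D) + (M / \<mu>) ^ n * (\<Delta> k * D))"
  have bound: "norm (\<iota> o\<^sub>L (riesz_projector (Lk k) \<gamma> - riesz_projector Ls \<gamma>)) \<le> S * ?e n k"
    if k: "k1 \<le> k" for k n
  proof -
    have k': "1 \<le> k" using k D(2) by simp
    have "norm (\<iota> o\<^sub>L (riesz_projector (Lk k) \<gamma> - riesz_projector Ls \<gamma>)) \<le> max_speed \<gamma> * ?e n k / (2 * pi)"
    proof (rule weak_projector_diff_le[OF _ L])
      show "riesz (Lk k) U \<gamma>" using D(4)[OF k] L.jordan by (intro riesz.intro Lk_clinear k') auto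
      fix z assume z: "z \<in> frontier U"
      have zL: "z \<in> resolvent_set Ls" and zk: "z \<in> resolvent_set (Lk k)" "norm (resolvent (Lk k) z) \<le> D"
        using z L.frontier D(4)[OF k z] by auto
      show "norm (\<iota> o\<^sub>L (resolvent (Lk k) z - resolvent Ls z)) \<le> ?e n k"
      proof (rule norm_blinfun_bound)
        fix f
        define v where "v = resolvent (Lk k) z f"
        define g where "g = (Ls - Lk k) v"
        have v: "norm v \<le> D * norm f"
          unfolding v_def using norm_blinfun mult_right_mono[OF zk(2) norm_ge_zero] by (rule order_trans)
        have "norm g \<le> 2 * a * norm v + 2 * b * norm (\<iota> v)"
          unfolding g_def by (rule diff_strong_le[OF k'])
        also have "\<dots> \<le> 2 * a * norm v + 2 * b * (norm \<iota> * norm v)"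
          using constants_pos by (intro add_left_mono mult_left_mono norm_blinfun) auto
        also have "\<dots> = G * norm v" by (simp add: G_def algebra_simps)
        also have "\<dots> \<le> G * (D * norm f)" using v G by (rule mult_left_mono)
        finally have g_s: "norm g \<le> G * (D * norm f)" .
        have g_w: "norm (\<iota> g) \<le> \<Delta> k * (D * norm f)"
          unfolding g_def by (rule order_trans[OF embed_diff_le mult_left_mono[OF v]]) simp
        have "(\<iota> o\<^sub>L (resolvent (Lk k) z - resolvent Ls z)) f = - \<iota> (resolvent Ls z g)"
          unfolding g_def v_def resolvent_perturb[OF zL zk(1), symmetric]
          by (simp add: blinfun.diff_left blinfun.diff_right)
        then have "norm ((\<iota> o\<^sub>L (resolvent (Lk k) z - resolvent Ls z)) f) = norm (\<iota> (resolvent Ls z g))"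
          by simp
        also have "\<dots> \<le> K * ((a / \<mu>) ^ n * norm g + (M / \<mu>) ^ n * norm (\<iota> g))"
          unfolding K_def by (rule weak_resolvent_estimate[OF dfly_L \<mu> zL z\<mu>[OF z] D(3)[OF z]])
        also have "\<dots> \<le> K * ((a / \<mu>) ^ n * (G * (D * norm f)) + (M / \<mu>) ^ n * (\<Delta> k * (D * norm f)))"
          using g_s g_w K pos by (intro mult_left_mono add_mono) auto
        also have "\<dots> = ?e n k * norm f" by (simp add: algebra_simps)
        finally show "norm ((\<iota> o\<^sub>L (resolvent (Lk k) z - resolvent Ls z)) f) \<le> ?e n k * norm f" .
      qed (use K G D(1) pos in auto)
    qed
    then show ?thesis by (simp add: S_def)
  qed
  have small: "\<exists>k0. \<forall>k\<ge>k0. norm (\<iota> o\<^sub>L (riesz_projector (Lk k) \<gamma> - riesz_projector Ls \<gamma>)) < r"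
    if r: "0 < r" for r
  proof -
    have "(\<lambda>n. (a / \<mu>) ^ n) \<longlonglongrightarrow> 0"
      using \<mu> pos by (intro LIMSEQ_realpow_zero) auto
    then have "(\<lambda>n. S * (K * ((a / \<mu>) ^ n * (G * D)))) \<longlonglongrightarrow> 0"
      by (intro tendsto_mult_right_zero tendsto_mult_left_zero)
    then have "\<forall>\<^sub>F n in sequentially. S * (K * ((a / \<mu>) ^ n * (G * D))) < r / 2"
      using r by (intro order_tendstoD(2)) auto
    then obtain n where n: "S * (K * ((a / \<mu>) ^ n * (G * D))) < r / 2"
      by (auto simp: eventually_sequentially)
    have "(\<lambda>k. S * (K * ((M / \<mu>) ^ n * (\<Delta> k * D)))) \<longlonglongrightarrow> 0"
      by (intro tendsto_mult_right_zero tendsto_mult_left_zero Lk_converges)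
    then have "\<forall>\<^sub>F k in sequentially. S * (K * ((M / \<mu>) ^ n * (\<Delta> k * D))) < r / 2"
      using r by (intro order_tendstoD(2)) auto
    then obtain k2 where k2: "\<And>k. k2 \<le> k \<Longrightarrow> S * (K * ((M / \<mu>) ^ n * (\<Delta> k * D))) < r / 2"
      by (auto simp: eventually_sequentially)
    have "norm (\<iota> o\<^sub>L (riesz_projector (Lk k) \<gamma> - riesz_projector Ls \<gamma>)) < r" if "max k1 k2 \<le> k" for k
    proof -
      have "S * ?e n k = S * (K * ((a / \<mu>) ^ n * (G * D))) + S * (K * ((M / \<mu>) ^ n * (\<Delta> k * D)))"
        by (simp only: distrib_left)
      then show ?thesis using bound[of k n] n k2[of k] that by simp
    qed
    then show ?thesis by blast
  qed
  show ?thesis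
    unfolding lim_sequentially dist_real_def diff_0_right abs_norm_cancel
    by (intro allI impI small)
qed

lemma dfly_case_isolated:
  assumes \<mu>: "a < \<mu>" "\<mu> < M" and q: "q = \<bar>ln (\<mu> / M)\<bar> / \<bar>ln (a / M)\<bar>"
    and rate: "(\<lambda>k. \<Delta> k * Ek k powr q) \<longlonglongrightarrow> 0"
    and \<zeta>: "eigenvalue Ls \<zeta>" "0 < r" and J: "jordan_domain (ball \<zeta> r) \<gamma>"
    and sub: "closure (ball \<zeta> r) \<subseteq> {z. \<mu> \<le> cmod z}"
    and iso: "closure (ball \<zeta> r) \<inter> spectrum Ls = {\<zeta>}"
  shows "\<forall>\<^sub>F k in sequentially. eigenvalue_count (Lk k) (ball \<zeta> r) = algebraic_multiplicity Ls \<zeta>"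
    "(\<lambda>k. norm (\<iota> o\<^sub>L (riesz_projector (Lk k) \<gamma> - riesz_projector Ls \<gamma>))) \<longlonglongrightarrow> 0"
    "eigenvector Ls \<zeta> v \<Longrightarrow> (\<lambda>k. norm (\<iota> (riesz_projector (Lk k) \<gamma> v - v))) \<longlonglongrightarrow> 0"
proof -
  have \<zeta>U: "\<zeta> \<in> ball \<zeta> r" using \<zeta>(2) by simp
  have fr: "frontier (ball \<zeta> r) \<subseteq> resolvent_set Ls" by (rule isolated_frontier[OF J \<zeta>U iso])
  interpret L: riesz Ls "ball \<zeta> r" \<gamma> by (rule riesz.intro[OF L_clinear(1) J fr])
  have z\<mu>: "\<mu> \<le> cmod z" if "z \<in> frontier (ball \<zeta> r)" for z
    using sub that jordan_domain_frontier(4)[OF J] by blast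
  have out: "0 \<notin> closure (ball \<zeta> r)" using sub \<mu> constants_pos by auto
  show conv: "(\<lambda>k. norm (\<iota> o\<^sub>L (riesz_projector (Lk k) \<gamma> - riesz_projector Ls \<gamma>))) \<longlonglongrightarrow> 0"
    by (rule dfly_case_projectors[OF \<mu> L.riesz_axioms z\<mu>])
  obtain k0 where k0: "1 \<le> k0" "\<forall>k\<ge>k0.
      frontier (ball \<zeta> r) \<subseteq> resolvent_set (Lk k) \<inter> resolvent_set (Lwk k) \<and>
      riesz_rank (Lk k) \<gamma> = riesz_rank Ls \<gamma> \<and>
      (SUP z\<in>frontier (ball \<zeta> r). b * \<Delta> k * norm (resolvent (Lwk k) z)) <
        (INF z\<in>frontier (ball \<zeta> r). cmod z - a)"
    using dfly_case_domain[OF \<mu> q rate J fr z\<mu>] by blast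
  have "eigenvalue_count (Lk k) (ball \<zeta> r) = algebraic_multiplicity Ls \<zeta>" if k: "k0 \<le> k" for k
  proof -
    have k1: "1 \<le> k" using k k0(1) by simp
    have "frontier (ball \<zeta> r) \<subseteq> resolvent_set (Lk k)" and rank: "riesz_rank (Lk k) \<gamma> = riesz_rank Ls \<gamma>"
      using k0(2) k by auto
    then interpret A: riesz "Lk k" "ball \<zeta> r" \<gamma> by (intro riesz.intro Lk_clinear k1 J)
    have fin: "finite_cdim (range (blinfun_apply A.P))"
      by (rule A.range_finite_rank[OF out Lk_finite_rank[OF k1]])
    have "finite_cdim (range (blinfun_apply L.P))"
      by (rule finite_cdim_riesz_rank_eq[OF rank fin])
    then have "eigenvalue_count Ls (ball \<zeta> r) = riesz_rank Ls \<gamma>" by (rule L.eigenvalue_count_eq_rank)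
    then show ?thesis
      using A.eigenvalue_count_eq_rank[OF fin] rank
        eigenvalue_count_isolated[OF L.riesz_axioms \<zeta>(1) \<zeta>U iso] by simp
  qed
  then show "\<forall>\<^sub>F k in sequentially. eigenvalue_count (Lk k) (ball \<zeta> r) = algebraic_multiplicity Ls \<zeta>"
    unfolding eventually_sequentially by blast
  assume v: "eigenvector Ls \<zeta> v"
  then have "shift Ls \<zeta> v = 0" by (simp add: eigenvector_def shift_def)
  then have Pv: "L.P v = v" using \<zeta>U by (rule L.eigenvector_inside)
  have "norm (\<iota> (riesz_projector (Lk k) \<gamma> v - v)) \<le>
      norm (\<iota> o\<^sub>L (riesz_projector (Lk k) \<gamma> - riesz_projector Ls \<gamma>)) * norm v" for k
    using norm_blinfun[of "\<iota> o\<^sub>L (riesz_projector (Lk k) \<gamma> - riesz_projector Ls \<gamma>)" v]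
    by (simp add: blinfun.diff_left Pv)
  then show "(\<lambda>k. norm (\<iota> (riesz_projector (Lk k) \<gamma> v - v))) \<longlonglongrightarrow> 0"
    by (rule norm_tendsto_zero_le[OF _ tendsto_mult_left_zero[OF conv]])
qed

end

section \<open>The approximation theorem\<close>

theorem theorem1p2:
  fixes L :: "'a::complex_banach \<Rightarrow>\<^sub>L 'a" and LK :: "nat \<Rightarrow> 'a \<Rightarrow>\<^sub>L 'a" and \<epsilon> :: "nat \<Rightarrow> real"
    and \<iota> :: "'s::complex_banach \<Rightarrow>\<^sub>L 'w::complex_banach"
    and Ls :: "'s \<Rightarrow>\<^sub>L 's" and Lw :: "'w \<Rightarrow>\<^sub>L 'w"
    and \<pi>s :: "nat \<Rightarrow> 's \<Rightarrow>\<^sub>L 's" and \<pi>w :: "nat \<Rightarrow> 'w \<Rightarrow>\<^sub>L 'w"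
    and a b M \<mu> q :: real
    and Lks :: "nat \<Rightarrow> 's \<Rightarrow>\<^sub>L 's" and Lkw :: "nat \<Rightarrow> 'w \<Rightarrow>\<^sub>L 'w" and \<delta> E :: "nat \<Rightarrow> real"
  shows
  "(clinear L \<and>
    (\<forall>K\<ge>1. clinear (LK K) \<and> finite_rank (LK K) \<and> norm (L - LK K) \<le> \<epsilon> K) \<and>
    \<epsilon> \<longlonglongrightarrow> 0
    \<longrightarrow>
    (\<forall>U \<gamma>. jordan_domain U \<gamma> \<and> 0 \<notin> closure U \<longrightarrow>
      (frontier U \<subseteq> resolvent_set L \<longrightarrow>
        (\<exists>K0\<ge>1. \<forall>K\<ge>K0.
          frontier U \<subseteq> resolvent_set (LK K) \<and>
          eigenvalue_count (LK K) U = eigenvalue_count L U \<and>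
          riesz_rank (LK K) \<gamma> = riesz_rank L \<gamma> \<and>
          (SUP z\<in>frontier U. \<epsilon> K * norm (resolvent (LK K) z)) < 1) \<and>
        (\<lambda>K. norm (riesz_projector (LK K) \<gamma> - riesz_projector L \<gamma>)) \<longlonglongrightarrow> 0) \<and>
      (\<forall>K\<ge>1.
        frontier U \<subseteq> resolvent_set (LK K) \<and>
        (SUP z\<in>frontier U. \<epsilon> K * norm (resolvent (LK K) z)) < 1 \<longrightarrow>
          frontier U \<subseteq> resolvent_set L \<and>
          eigenvalue_count (LK K) U = eigenvalue_count L U \<and>
          riesz_rank (LK K) \<gamma> = riesz_rank L \<gamma>)) \<and>
    (\<forall>\<zeta> r \<gamma>.
      \<zeta> \<noteq> 0 \<and> eigenvalue L \<zeta> \<and> 0 < r \<and> jordan_domain (ball \<zeta> r) \<gamma> \<and>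
      0 \<notin> closure (ball \<zeta> r) \<and> closure (ball \<zeta> r) \<inter> spectrum L = {\<zeta>} \<longrightarrow>
        (\<forall>\<^sub>F K in sequentially.
          eigenvalue_count (LK K) (ball \<zeta> r) = algebraic_multiplicity L \<zeta>) \<and>
        (\<lambda>K. norm (riesz_projector (LK K) \<gamma> - riesz_projector L \<gamma>)) \<longlonglongrightarrow> 0 \<and>
        (\<forall>v. eigenvector L \<zeta> v \<longrightarrow> (\<lambda>K. riesz_projector (LK K) \<gamma> v) \<longlonglongrightarrow> v)))
   \<and>
   (dfly_scheme \<iota> Ls Lw \<pi>s \<pi>w a b M \<and>
    Lks = (\<lambda>k. compression (\<pi>s k) Ls) \<and>
    Lkw = (\<lambda>k. compression (\<pi>w k) Lw) \<and>
    \<delta> = (\<lambda>k. norm (\<iota> o\<^sub>L (Ls - Lks k))) \<and>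
    E = (\<lambda>k. weak_to_strong_const \<iota> (\<pi>w k)) \<and>
    a < M \<and> a < \<mu> \<and> \<mu> < M \<and> q = \<bar>ln (\<mu> / M)\<bar> / \<bar>ln (a / M)\<bar> \<and>
    (\<lambda>k. \<delta> k * E k powr q) \<longlonglongrightarrow> 0
    \<longrightarrow>
    (\<forall>U \<gamma>. jordan_domain U \<gamma> \<and> (INF z\<in>frontier U. cmod z) \<ge> \<mu> \<and> U \<inter> {z. cmod z \<le> a} = {} \<longrightarrow>
      (frontier U \<subseteq> resolvent_set Ls \<longrightarrow>
        (\<exists>k0\<ge>1. \<forall>k\<ge>k0.
          frontier U \<subseteq> resolvent_set (Lks k) \<inter> resolvent_set (Lkw k) \<and>
          riesz_rank (Lks k) \<gamma> = riesz_rank Ls \<gamma> \<and>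
          (SUP z\<in>frontier U. b * \<delta> k * norm (resolvent (Lkw k) z)) <
            (INF z\<in>frontier U. cmod z - a)) \<and>
        (\<lambda>k. norm (\<iota> o\<^sub>L (riesz_projector (Lks k) \<gamma> - riesz_projector Ls \<gamma>))) \<longlonglongrightarrow> 0) \<and>
      (\<forall>k\<ge>1.
        frontier U \<subseteq> resolvent_set (Lks k) \<inter> resolvent_set (Lkw k) \<and>
        (SUP z\<in>frontier U. b * \<delta> k * norm (resolvent (Lkw k) z)) <
          (INF z\<in>frontier U. cmod z - a) \<longrightarrow>
          frontier U \<subseteq> resolvent_set Ls \<and>
          riesz_rank (Lks k) \<gamma> = riesz_rank Ls \<gamma>)) \<and>
    (\<forall>\<zeta> r \<gamma>.
      eigenvalue Ls \<zeta> \<and> \<mu> < cmod \<zeta> \<and> 0 < r \<and> jordan_domain (ball \<zeta> r) \<gamma> \<and>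
      closure (ball \<zeta> r) \<subseteq> {z. \<mu> \<le> cmod z} \<and> closure (ball \<zeta> r) \<inter> spectrum Ls = {\<zeta>} \<longrightarrow>
        (\<forall>\<^sub>F k in sequentially.
          eigenvalue_count (Lks k) (ball \<zeta> r) = algebraic_multiplicity Ls \<zeta>) \<and>
        (\<lambda>k. norm (\<iota> o\<^sub>L (riesz_projector (Lks k) \<gamma> - riesz_projector Ls \<gamma>))) \<longlonglongrightarrow> 0 \<and>
        (\<forall>v. eigenvector Ls \<zeta> v \<longrightarrow>
          (\<lambda>k. norm (\<iota> (riesz_projector (Lks k) \<gamma> v - v))) \<longlonglongrightarrow> 0)))"
proof (rule conjI; rule impI)
  assume "clinear L \<and>
    (\<forall>K\<ge>1. clinear (LK K) \<and> finite_rank (LK K) \<and> norm (L - LK K) \<le> \<epsilon> K) \<and> \<epsilon> \<longlonglongrightarrow> 0"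
  then have L: "clinear L" and \<epsilon>: "\<epsilon> \<longlonglongrightarrow> 0"
    and LK: "\<And>K. 1 \<le> K \<Longrightarrow> clinear (LK K)" "\<And>K. 1 \<le> K \<Longrightarrow> finite_rank (LK K)"
      "\<And>K. 1 \<le> K \<Longrightarrow> norm (L - LK K) \<le> \<epsilon> K"
    by auto
  show "(\<forall>U \<gamma>. jordan_domain U \<gamma> \<and> 0 \<notin> closure U \<longrightarrow>
      (frontier U \<subseteq> resolvent_set L \<longrightarrow>
        (\<exists>K0\<ge>1. \<forall>K\<ge>K0.
          frontier U \<subseteq> resolvent_set (LK K) \<and>
          eigenvalue_count (LK K) U = eigenvalue_count L U \<and>
          riesz_rank (LK K) \<gamma> = riesz_rank L \<gamma> \<and>
          (SUP z\<in>frontier U. \<epsilon> K * norm (resolvent (LK K) z)) < 1) \<and>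
        (\<lambda>K. norm (riesz_projector (LK K) \<gamma> - riesz_projector L \<gamma>)) \<longlonglongrightarrow> 0) \<and>
      (\<forall>K\<ge>1.
        frontier U \<subseteq> resolvent_set (LK K) \<and>
        (SUP z\<in>frontier U. \<epsilon> K * norm (resolvent (LK K) z)) < 1 \<longrightarrow>
          frontier U \<subseteq> resolvent_set L \<and>
          eigenvalue_count (LK K) U = eigenvalue_count L U \<and>
          riesz_rank (LK K) \<gamma> = riesz_rank L \<gamma>)) \<and>
    (\<forall>\<zeta> r \<gamma>.
      \<zeta> \<noteq> 0 \<and> eigenvalue L \<zeta> \<and> 0 < r \<and> jordan_domain (ball \<zeta> r) \<gamma> \<and>
      0 \<notin> closure (ball \<zeta> r) \<and> closure (ball \<zeta> r) \<inter> spectrum L = {\<zeta>} \<longrightarrow>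
        (\<forall>\<^sub>F K in sequentially.
          eigenvalue_count (LK K) (ball \<zeta> r) = algebraic_multiplicity L \<zeta>) \<and>
        (\<lambda>K. norm (riesz_projector (LK K) \<gamma> - riesz_projector L \<gamma>)) \<longlonglongrightarrow> 0 \<and>
        (\<forall>v. eigenvector L \<zeta> v \<longrightarrow> (\<lambda>K. riesz_projector (LK K) \<gamma> v) \<longlonglongrightarrow> v))"
  proof (intro conjI allI impI; elim conjE)
    fix U \<gamma> assume J: "jordan_domain U \<gamma>" "0 \<notin> closure U"
    show "\<exists>K0\<ge>1. \<forall>K\<ge>K0.
          frontier U \<subseteq> resolvent_set (LK K) \<and>
          eigenvalue_count (LK K) U = eigenvalue_count L U \<and>
          riesz_rank (LK K) \<gamma> = riesz_rank L \<gamma> \<and>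
          (SUP z\<in>frontier U. \<epsilon> K * norm (resolvent (LK K) z)) < 1"
      if "frontier U \<subseteq> resolvent_set L"
      by (rule compact_case_domain(1)[OF L LK \<epsilon> J that])
    show "(\<lambda>K. norm (riesz_projector (LK K) \<gamma> - riesz_projector L \<gamma>)) \<longlonglongrightarrow> 0"
      if "frontier U \<subseteq> resolvent_set L"
      by (rule norm_convergence_projectors[OF riesz.intro[OF L J(1) that] LK(1,3) \<epsilon>])
    fix K :: nat
    assume K: "1 \<le> K" and cert: "frontier U \<subseteq> resolvent_set (LK K)"
      "(SUP z\<in>frontier U. \<epsilon> K * norm (resolvent (LK K) z)) < 1"
    note certificate = finite_rank_certificate[OF L LK[OF K] J cert]
    show "frontier U \<subseteq> resolvent_set L" by (rule riesz.frontier[OF certificate(1)])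
    show "eigenvalue_count (LK K) U = eigenvalue_count L U" by (rule certificate(2))
    show "riesz_rank (LK K) \<gamma> = riesz_rank L \<gamma>" by (rule certificate(3))
  next
    fix \<zeta> r \<gamma>
    assume disc: "eigenvalue L \<zeta>" "0 < r" "jordan_domain (ball \<zeta> r) \<gamma>"
      "0 \<notin> closure (ball \<zeta> r)" "closure (ball \<zeta> r) \<inter> spectrum L = {\<zeta>}"
    note isolated = compact_case_isolated[OF L LK \<epsilon> disc]
    show "\<forall>\<^sub>F K in sequentially. eigenvalue_count (LK K) (ball \<zeta> r) = algebraic_multiplicity L \<zeta>"
      by (rule isolated(1))
    show "(\<lambda>K. norm (riesz_projector (LK K) \<gamma> - riesz_projector L \<gamma>)) \<longlonglongrightarrow> 0"
      by (rule isolated(2))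
    show "(\<lambda>K. riesz_projector (LK K) \<gamma> v) \<longlonglongrightarrow> v" if "eigenvector L \<zeta> v" for v
      by (rule isolated(3)) (assumption | rule that)+
  qed
next
  assume H: "dfly_scheme \<iota> Ls Lw \<pi>s \<pi>w a b M \<and>
    Lks = (\<lambda>k. compression (\<pi>s k) Ls) \<and>
    Lkw = (\<lambda>k. compression (\<pi>w k) Lw) \<and>
    \<delta> = (\<lambda>k. norm (\<iota> o\<^sub>L (Ls - Lks k))) \<and>
    E = (\<lambda>k. weak_to_strong_const \<iota> (\<pi>w k)) \<and>
    a < M \<and> a < \<mu> \<and> \<mu> < M \<and> q = \<bar>ln (\<mu> / M)\<bar> / \<bar>ln (a / M)\<bar> \<and>
    (\<lambda>k. \<delta> k * E k powr q) \<longlonglongrightarrow> 0"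
  interpret dfly_scheme \<iota> Ls Lw \<pi>s \<pi>w a b M using H by blast
  have Lks: "Lks = Lk" and Lkw: "Lkw = Lwk" and \<delta>: "\<delta> = \<Delta>"
    using H by auto
  have \<mu>: "a < \<mu>" "\<mu> < M" and q: "q = \<bar>ln (\<mu> / M)\<bar> / \<bar>ln (a / M)\<bar>"
    and rate: "(\<lambda>k. \<Delta> k * Ek k powr q) \<longlonglongrightarrow> 0"
    using H by auto
  show "(\<forall>U \<gamma>. jordan_domain U \<gamma> \<and> (INF z\<in>frontier U. cmod z) \<ge> \<mu> \<and> U \<inter> {z. cmod z \<le> a} = {} \<longrightarrow>
      (frontier U \<subseteq> resolvent_set Ls \<longrightarrow>
        (\<exists>k0\<ge>1. \<forall>k\<ge>k0.
          frontier U \<subseteq> resolvent_set (Lks k) \<inter> resolvent_set (Lkw k) \<and>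
          riesz_rank (Lks k) \<gamma> = riesz_rank Ls \<gamma> \<and>
          (SUP z\<in>frontier U. b * \<delta> k * norm (resolvent (Lkw k) z)) <
            (INF z\<in>frontier U. cmod z - a)) \<and>
        (\<lambda>k. norm (\<iota> o\<^sub>L (riesz_projector (Lks k) \<gamma> - riesz_projector Ls \<gamma>))) \<longlonglongrightarrow> 0) \<and>
      (\<forall>k\<ge>1.
        frontier U \<subseteq> resolvent_set (Lks k) \<inter> resolvent_set (Lkw k) \<and>
        (SUP z\<in>frontier U. b * \<delta> k * norm (resolvent (Lkw k) z)) <
          (INF z\<in>frontier U. cmod z - a) \<longrightarrow>
          frontier U \<subseteq> resolvent_set Ls \<and>
          riesz_rank (Lks k) \<gamma> = riesz_rank Ls \<gamma>)) \<and>
    (\<forall>\<zeta> r \<gamma>.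
      eigenvalue Ls \<zeta> \<and> \<mu> < cmod \<zeta> \<and> 0 < r \<and> jordan_domain (ball \<zeta> r) \<gamma> \<and>
      closure (ball \<zeta> r) \<subseteq> {z. \<mu> \<le> cmod z} \<and> closure (ball \<zeta> r) \<inter> spectrum Ls = {\<zeta>} \<longrightarrow>
        (\<forall>\<^sub>F k in sequentially.
          eigenvalue_count (Lks k) (ball \<zeta> r) = algebraic_multiplicity Ls \<zeta>) \<and>
        (\<lambda>k. norm (\<iota> o\<^sub>L (riesz_projector (Lks k) \<gamma> - riesz_projector Ls \<gamma>))) \<longlonglongrightarrow> 0 \<and>
        (\<forall>v. eigenvector Ls \<zeta> v \<longrightarrow>
          (\<lambda>k. norm (\<iota> (riesz_projector (Lks k) \<gamma> v - v))) \<longlonglongrightarrow> 0))"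
    unfolding Lks Lkw \<delta>
  proof (intro conjI allI impI; elim conjE)
    fix U \<gamma> assume J: "jordan_domain U \<gamma>" and inf: "\<mu> \<le> (INF z\<in>frontier U. cmod z)"
    have z\<mu>: "\<mu> \<le> cmod z" if "z \<in> frontier U" for z
    proof -
      have "(INF z\<in>frontier U. cmod z) \<le> cmod z"
        by (rule cINF_lower[OF _ that], rule bdd_belowI2[of _ 0]) simp
      with inf show ?thesis by linarith
    qed
    show "\<exists>k0\<ge>1. \<forall>k\<ge>k0.
        frontier U \<subseteq> resolvent_set (Lk k) \<inter> resolvent_set (Lwk k) \<and>
        riesz_rank (Lk k) \<gamma> = riesz_rank Ls \<gamma> \<and>
        (SUP z\<in>frontier U. b * \<Delta> k * norm (resolvent (Lwk k) z)) < (INF z\<in>frontier U. cmod z - a)"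
      if "frontier U \<subseteq> resolvent_set Ls"
      by (rule dfly_case_domain[OF \<mu> q rate J that z\<mu>])
    show "(\<lambda>k. norm (\<iota> o\<^sub>L (riesz_projector (Lk k) \<gamma> - riesz_projector Ls \<gamma>))) \<longlonglongrightarrow> 0"
      if "frontier U \<subseteq> resolvent_set Ls"
      by (rule dfly_case_projectors[OF \<mu> riesz.intro[OF L_clinear(1) J that] z\<mu>])
    fix k :: nat
    assume k: "1 \<le> k" and cert: "frontier U \<subseteq> resolvent_set (Lk k) \<inter> resolvent_set (Lwk k)"
      "(SUP z\<in>frontier U. b * \<Delta> k * norm (resolvent (Lwk k) z)) < (INF z\<in>frontier U. cmod z - a)"
    note certificate = dfly_certificate[OF k J cert]
    show "frontier U \<subseteq> resolvent_set Ls" by (rule riesz.frontier[OF certificate(1)])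
    show "riesz_rank (Lk k) \<gamma> = riesz_rank Ls \<gamma>" by (rule certificate(2))
  next
    fix \<zeta> r \<gamma>
    assume disc: "eigenvalue Ls \<zeta>" "0 < r" "jordan_domain (ball \<zeta> r) \<gamma>"
      "closure (ball \<zeta> r) \<subseteq> {z. \<mu> \<le> cmod z}" "closure (ball \<zeta> r) \<inter> spectrum Ls = {\<zeta>}"
    note isolated = dfly_case_isolated[OF \<mu> q rate disc]
    show "\<forall>\<^sub>F k in sequentially. eigenvalue_count (Lk k) (ball \<zeta> r) = algebraic_multiplicity Ls \<zeta>"
      by (rule isolated(1))
    show "(\<lambda>k. norm (\<iota> o\<^sub>L (riesz_projector (Lk k) \<gamma> - riesz_projector Ls \<gamma>))) \<longlonglongrightarrow> 0"
      by (rule isolated(2))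
    show "(\<lambda>k. norm (\<iota> (riesz_projector (Lk k) \<gamma> v - v))) \<longlonglongrightarrow> 0" if "eigenvector Ls \<zeta> v" for v
      using that by (rule isolated(3))
  qed
qed

end
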